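(* Let $m\in\mathbb{N}\cup\{0\}$, $\operatorname{Re}(y)>0$ and $\operatorname{Re}(a)>-2m-3$. Then $$\sum_{n=1}^\infty\sigma_a(n)e^{-ny}+\frac12\left(\left(\frac{2\pi}{y}\right)^{1+a}\operatorname{cosec}\left(\frac{\pi a}{2}\right)+1\right)\zeta(-a)-\frac{\zeta(1-a)}{y}$$ $$=\frac{2\sqrt{2\pi}}{y^{1+\frac a2}}\sum_{n=1}^\infty\sigma_a(n)n^{-\frac a2}\left\{{}_{\frac12}K_{\frac a2}\!\left(\frac{4\pi^2n}{y},0\right)-\frac{\pi2^{\frac32+a}}{\sin\left(\frac{\pi a}{2}\right)}\left(\frac{4\pi^2n}{y}\right)^{-\frac a2-2}A_m\!\left(\frac12,\frac a2,0;\frac{4\pi^2n}{y}\right)\right\}-\frac{y(2\pi)^{-a-3}}{\sin\left(\frac{\pi a}{2}\right)}\sum_{k=0}^m\frac{\zeta(a+2k+2)\zeta(2k+2)}{\Gamma(-a-1-2k)}\left(\frac{4\pi^2}{y}\right)^{-2k}.$$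
   Context: $\sigma_a(n)=\sum_{d\mid n}d^a$, $\zeta$ is the Riemann zeta function. For $\nu\in\mathbb{C}\setminus(\mathbb{Z}\setminus\{0\})$ and $z,\mu,w\in\mathbb{C}$ with $\mu+w\notin\{-\tfrac12,-\tfrac32,\dots\}$, $${}_{\mu}K_{\nu}(z,w):=\frac{\pi z^w2^{\mu+\nu-1}}{\sin(\nu\pi)}\Bigg\{\left(\frac z2\right)^{-\nu}\frac{\Gamma(\mu+w+\frac12)}{\Gamma(1-\nu)\Gamma(w+\frac12-\nu)}{}_1F_2\!\left(\mu+w+\tfrac12;w+\tfrac12-\nu,1-\nu;\tfrac{z^2}{4}\right)-\left(\frac z2\right)^{\nu}\frac{\Gamma(\mu+\nu+w+\frac12)}{\Gamma(1+\nu)\Gamma(w+\frac12)}{}_1F_2\!\left(\mu+\nu+w+\tfrac12;w+\tfrac12,1+\nu;\tfrac{z^2}{4}\right)\Bigg\},$$ and $$A_m(\mu,\nu,w;z):=\sum_{k=0}^m\frac{(-1)^{-\mu-w-\frac12}\Gamma\left(\mu+w+\frac12+k\right)}{k!\,\Gamma(-\nu-\mu-k)\,\Gamma\left(\frac12-\nu-\mu-w-k\right)}\left(\frac z2\right)^{-2k}.$$ *)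

theory Defs
  imports "HOL-Complex_Analysis.Complex_Analysis"
begin

definition sigma_pow :: "complex \<Rightarrow> nat \<Rightarrow> complex" where
  "sigma_pow a n = (\<Sum>d | d dvd n. of_nat d powr a)"

text \<open>
  The Riemann zeta function as the analytic continuation of its Dirichlet series to the plane
  without 1. By the identity theorem the continuation is unique there; only its value at the
  pole 1 is left unspecified.
\<close>
definition zeta :: "complex \<Rightarrow> complex" where
  "zeta = (SOME f. f holomorphic_on (- {1}) \<and>
             (\<forall>s. Re s > 1 \<longrightarrow> (\<lambda>n. of_nat (Suc n) powr (- s)) sums f s))"

definition hyp1F2 :: "complex \<Rightarrow> complex \<Rightarrow> complex \<Rightarrow> complex \<Rightarrow> complex" where
  "hyp1F2 a b c x =
     (\<Sum>n. pochhammer a n / (pochhammer b n * pochhammer c n) * x ^ n / fact n)"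

text \<open>
  The generalised modified Bessel function, with arguments in the order
  \<open>\<mu> \<nu> z w\<close>. Complex powers are principal. The formula is meaningful when
  \<open>\<nu>\<close> is not an integer, neither \<open>w + 1/2 - \<nu>\<close> nor
  \<open>w + 1/2\<close> is a nonpositive integer, and the numerator Gammas have no pole; at the
  remaining parameter values it has to be read as a limit.
\<close>
definition gen_bessel_K :: "complex \<Rightarrow> complex \<Rightarrow> complex \<Rightarrow> complex \<Rightarrow> complex" where
  "gen_bessel_K \<mu> \<nu> z w =
     of_real pi * z powr w * 2 powr (\<mu> + \<nu> - 1) / sin (\<nu> * of_real pi) *
     ((z / 2) powr (- \<nu>) * (Gamma (\<mu> + w + 1/2) / (Gamma (1 - \<nu>) * Gamma (w + 1/2 - \<nu>))) *
        hyp1F2 (\<mu> + w + 1/2) (w + 1/2 - \<nu>) (1 - \<nu>) (z\<^sup>2 / 4)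
      - (z / 2) powr \<nu> * (Gamma (\<mu> + \<nu> + w + 1/2) / (Gamma (1 + \<nu>) * Gamma (w + 1/2))) *
        hyp1F2 (\<mu> + \<nu> + w + 1/2) (w + 1/2) (1 + \<nu>) (z\<^sup>2 / 4))"

text \<open>
  Since \<^const>\<open>Gamma\<close> is 0 at its poles and division by 0 gives 0, the quotients below
  agree with the usual convention that \<open>1/\<Gamma>\<close> vanishes at the poles of
  \<open>\<Gamma>\<close>.
\<close>
definition A_sum :: "nat \<Rightarrow> complex \<Rightarrow> complex \<Rightarrow> complex \<Rightarrow> complex \<Rightarrow> complex" where
  "A_sum m \<mu> \<nu> w z =
     (\<Sum>k = 0..m. (-1) powr (- \<mu> - w - 1/2) * Gamma (\<mu> + w + 1/2 + of_nat k) /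
        (fact k * Gamma (- \<nu> - \<mu> - of_nat k) * Gamma (1/2 - \<nu> - \<mu> - w - of_nat k)) *
        (z / 2) powi (- 2 * int k))"

definition zeta_part :: "complex \<Rightarrow> complex \<Rightarrow> complex" where
  "zeta_part y a =
     1/2 * ((2 * of_real pi / y) powr (1 + a) * (1 / sin (of_real pi * a / 2)) + 1) * zeta (- a)
     - zeta (1 - a) / y"

definition bessel_part :: "nat \<Rightarrow> complex \<Rightarrow> nat \<Rightarrow> complex \<Rightarrow> complex" where
  "bessel_part m y n a = (let z = 4 * (of_real pi)\<^sup>2 * of_nat n / y in
     gen_bessel_K (1/2) (a / 2) z 0
     - of_real pi * 2 powr (3/2 + a) / sin (of_real pi * a / 2) * z powr (- a / 2 - 2) *
       A_sum m (1/2) (a / 2) 0 z)"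

definition finite_part :: "nat \<Rightarrow> complex \<Rightarrow> complex \<Rightarrow> complex" where
  "finite_part m y a =
     y * (2 * of_real pi) powr (- a - 3) / sin (of_real pi * a / 2) *
     (\<Sum>k = 0..m. zeta (a + 2 * of_nat k + 2) * zeta (2 * of_nat k + 2) /
        Gamma (- a - 1 - 2 * of_nat k) * (4 * (of_real pi)\<^sup>2 / y) powi (- 2 * int k))"

end

(*
  Removing the first m + 1 terms of A_m from the Bessel kernel leaves, up to elementary factors, a
  function of z and s = a + 2 m + 4 alone, and for Re s > 0 that function is a sum of two Laplace
  transforms of u^(s-1) / (1 + u^2), taken along two rays close to the imaginary axis. In this form it
  is holomorphic in a and O(|z|^(-Re s)), also at the integers. Summing the integrals over the
  multiples 2 pi d w and expanding 1 / (e^u - 1) into partial fractions gives, for -1 < Re a < 0, a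
  closed form of the sum over k of k^(a+1) / (w^2 + k^2); shifting s by 2 exposes one term of the
  finite sum at a time, so the identity theorem extends it to -2 m - 3 < Re a < 0. For Re a < -1 the
  series of sigma_a(n) e^(-n y) is, by partial fractions again, a sum of such rational series at
  w = 2 pi j / y, and inserting the closed form proves the formula on the strip -2 < Re a < -1.
  The kernel bound makes both sides holomorphic for Re a > -2 m - 3 off the integers, and the
  integers follow by continuity.
*)
theory Submission imports Defs
begin

section \<open>Parameter integrals and Euler's integral\<close>

text \<open>The two ingredients live on disjoint strips. The closed form comes from integrals that
  converge for 1 < Re s < 2 with s = a + 2, while the Lambert series needs Re a < -1 for the
  Dirichlet series of zeta(-a). So the continuation in a is carried out on a single lattice sum: its
  rational side converges for Re a < 0, and its kernel side, after m + 1 shifts of s by 2, for Re a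
  > -2 m - 3. The second obstacle is size. Both 1F2 functions in the Bessel kernel grow
  exponentially in Re z, and no termwise estimate shows their cancellation. It becomes visible once
  the kernel is written as an even power series minus cosh z, which equals -sin(pi s / 2) times a
  Laplace integral. That sine also cancels the division by sin(pi a / 2), which makes the integers
  accessible. No contour is deformed: every integral is evaluated for real parameters and extended
  by the identity theorem, so that tilting the rays costs only bookkeeping of branches. As
  \<open>zeta\<close> is chosen by \<open>SOME\<close>, its continuation is constructed as well, by
  expanding a telescoping sum.\<close>

lemma holomorphic_on_suminf:
  fixes f :: "nat \<Rightarrow> complex \<Rightarrow> complex"
  assumes S: "open S" and hol: "\<And>n. f n holomorphic_on S"
    and bound: "\<And>x. x \<in> S \<Longrightarrow> \<exists>d>0. \<exists>M. summable M \<and> (\<forall>n. \<forall>y\<in>ball x d \<inter> S. norm (f n y) \<le> M n)"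
  shows "(\<lambda>x. \<Sum>n. f n x) holomorphic_on S"
proof (rule holomorphic_uniform_sequence[OF S])
  show "(\<lambda>x. \<Sum>i<n. f i x) holomorphic_on S" for n
    by (intro holomorphic_intros hol)
next
  fix x assume x: "x \<in> S"
  obtain d M where d: "d > 0" "summable M" "\<And>n y. y \<in> ball x d \<inter> S \<Longrightarrow> norm (f n y) \<le> M n"
    using bound[OF x] by blast
  obtain e where e: "e > 0" "cball x e \<subseteq> S"
    using S x open_contains_cball by blast
  define r where "r = min e (d / 2)"
  have r: "r > 0" "cball x r \<subseteq> S" "cball x r \<subseteq> ball x d"
    using d e by (auto simp: r_def)
  have "uniform_limit (cball x r) (\<lambda>n y. \<Sum>i<n. f i y) (\<lambda>y. \<Sum>i. f i y) sequentially"
    by (rule Weierstrass_m_test[of _ _ M]) (use r d in blast)+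
  with r show "\<exists>d>0. cball x d \<subseteq> S \<and>
      uniform_limit (cball x d) (\<lambda>n y. \<Sum>i<n. f i y) (\<lambda>y. \<Sum>i. f i y) sequentially"
    by blast
qed

text \<open>Only the kernel itself is assumed to be dominated. Cauchy's inequality turns this into a
  bound for its derivative on a smaller disc, hence for the difference quotients, and dominated
  convergence applies to them.\<close>

lemma has_field_derivative_integral_param:
  fixes k :: "complex \<Rightarrow> 'a \<Rightarrow> complex"
  assumes U: "open U" "c \<in> U"
    and hol: "\<And>t. t \<in> space M \<Longrightarrow> (\<lambda>x. k x t) holomorphic_on U"
    and meas: "\<And>x. x \<in> U \<Longrightarrow> k x \<in> borel_measurable M"
    and r: "r > 0" and B: "integrable M B"
    and bound: "\<And>x t. x \<in> ball c r \<inter> U \<Longrightarrow> t \<in> space M \<Longrightarrow> norm (k x t) \<le> B t"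
  shows "((\<lambda>x. \<integral>t. k x t \<partial>M) has_field_derivative (\<integral>t. deriv (\<lambda>x. k x t) c \<partial>M)) (at c)"
proof -
  obtain e where e: "e > 0" "ball c e \<subseteq> U"
    using U openE by blast
  \<comment> \<open>Half the admissible radius: closed discs of radius \<open>q\<close> around
    points of \<open>ball c q\<close> stay inside \<open>ball c (2*q)\<close>, where the bound
    holds.\<close>
  define q where "q = min e r / 2"
  have q: "q > 0" "ball c (2*q) \<subseteq> U" "ball c (2*q) \<subseteq> ball c r"
    using e r by (auto simp: q_def)
  have int: "integrable M (k x)" if "x \<in> ball c (2*q)" for x
  proof (rule Bochner_Integration.integrable_bound[OF B meas])
    show "x \<in> U" using that q by blast
    have "norm (k x t) \<le> norm (B t)" if "t \<in> space M" for t
      using bound[of x t] \<open>x \<in> ball c (2*q)\<close> q that by force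
    then show "AE t in M. norm (k x t) \<le> norm (B t)" by (rule AE_I2)
  qed
  have diffb: "norm (k x t - k c t) \<le> B t / q * norm (x - c)"
    if x: "x \<in> ball c q" and t: "t \<in> space M" for x t
  proof (rule field_differentiable_bound[of "ball c q" _ "\<lambda>x. deriv (\<lambda>x. k x t) x"])
    fix z assume z: "z \<in> ball c q"
    have sub: "cball z q \<subseteq> ball c (2*q)"
    proof
      fix w assume "w \<in> cball z q"
      then show "w \<in> ball c (2*q)"
        using z dist_triangle[of c w z] by auto
    qed
    have "(\<lambda>x. k x t) holomorphic_on ball c (2*q)"
      using hol[OF t] q holomorphic_on_subset by blast
    then show "((\<lambda>x. k x t) has_field_derivative deriv (\<lambda>x. k x t) z) (at z within ball c q)"
      using q z by (intro has_field_derivative_at_within[OF holomorphic_derivI[of _ "ball c (2*q)"]]) auto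
    have h: "(\<lambda>x. k x t) holomorphic_on cball z q"
      using hol[OF t] q sub holomorphic_on_subset by blast
    have "norm ((deriv ^^ 1) (\<lambda>x. k x t) z) \<le> fact 1 * B t / q ^ 1"
    proof (rule Cauchy_inequality)
      show "(\<lambda>x. k x t) holomorphic_on ball z q"
        using h holomorphic_on_subset ball_subset_cball by blast
      show "continuous_on (cball z q) (\<lambda>x. k x t)"
        using h holomorphic_on_imp_continuous_on by blast
      show "cmod (k x t) \<le> B t" if "cmod (z - x) = q" for x
        using that sub q by (intro bound t) (auto simp: dist_norm subset_iff)
    qed (use q in auto)
    then show "norm (deriv (\<lambda>x. k x t) z) \<le> B t / q" by simp
  qed (use x q in auto)
  have "((\<lambda>h. ((\<integral>t. k (c+h) t \<partial>M) - (\<integral>t. k c t \<partial>M)) / h) \<longlongrightarrow> (\<integral>t. deriv (\<lambda>x. k x t) c \<partial>M)) (at 0)"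
    unfolding tendsto_at_iff_sequentially
  proof safe
    fix X :: "nat \<Rightarrow> complex"
    assume X0: "\<forall>i. X i \<in> UNIV - {0}" and X: "X \<longlonglongrightarrow> 0"
    from X q(1) obtain N where N: "\<And>n. n \<ge> N \<Longrightarrow> norm (X n) < q"
      by (auto simp: LIMSEQ_iff)
    \<comment> \<open>A tail of \<open>X\<close> on which all arguments lie in
      \<open>ball c q\<close>; \<open>LIMSEQ_offset\<close> undoes the shift at the end.\<close>
    define Y where "Y = (\<lambda>n. X (n + N))"
    have Y: "Y \<longlonglongrightarrow> 0" "\<And>n. Y n \<noteq> 0" "\<And>n. norm (Y n) < q"
      using X X0 N by (auto simp: Y_def LIMSEQ_ignore_initial_segment)
    have cY: "c + Y n \<in> ball c q" "c + Y n \<in> ball c (2*q)" for n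
      using Y(3)[of n] q by (auto simp: dist_norm)
    have measY: "(\<lambda>t. (k (c + Y n) t - k c t) / Y n) \<in> borel_measurable M" for n
      using subsetD[OF q(2) cY(2)] U by (intro borel_measurable_divide borel_measurable_diff meas) auto
    have lim: "(\<lambda>n. (k (c + Y n) t - k c t) / Y n) \<longlonglongrightarrow> deriv (\<lambda>x. k x t) c" if t: "t \<in> space M" for t
    proof -
      have "((\<lambda>x. k x t) has_field_derivative deriv (\<lambda>x. k x t) c) (at c)"
        using U by (intro holomorphic_derivI[OF hol[OF t]])
      then have "((\<lambda>h. (k (c+h) t - k c t) / h) \<longlongrightarrow> deriv (\<lambda>x. k x t) c) (at 0)"
        by (simp add: DERIV_def)
      then have "((\<lambda>h. (k (c+h) t - k c t) / h) \<circ> Y) \<longlonglongrightarrow> deriv (\<lambda>x. k x t) c"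
        using Y unfolding tendsto_at_iff_sequentially by blast
      then show ?thesis by (simp add: o_def)
    qed
    have "(\<lambda>n. \<integral>t. (k (c + Y n) t - k c t) / Y n \<partial>M) \<longlonglongrightarrow> (\<integral>t. deriv (\<lambda>x. k x t) c \<partial>M)"
    proof (rule integral_dominated_convergence[where w = "\<lambda>t. B t / q"])
      show "(\<lambda>t. deriv (\<lambda>x. k x t) c) \<in> borel_measurable M"
        by (rule borel_measurable_LIMSEQ_metric[OF measY lim])
      show "integrable M (\<lambda>t. B t / q)" using B by simp
      show "AE x in M. cmod ((k (c + Y i) x - k c x) / Y i) \<le> B x / q" for i
        using diffb[OF cY(1)] Y(2) by (intro AE_I2) (auto simp: norm_divide field_simps)
    qed (use measY lim in auto)
    moreover have "(\<integral>t. (k (c + Y n) t - k c t) / Y n \<partial>M) =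
        ((\<integral>t. k (c+Y n) t \<partial>M) - (\<integral>t. k c t \<partial>M)) / Y n" for n
      using int[OF cY(2)] int[of c] q by (simp add: Bochner_Integration.integral_diff)
    ultimately have "(\<lambda>n. ((\<integral>t. k (c+X (n+N)) t \<partial>M) - (\<integral>t. k c t \<partial>M)) / X (n+N)) 
        \<longlonglongrightarrow> (\<integral>t. deriv (\<lambda>x. k x t) c \<partial>M)" by (simp only: Y_def)
    then show "((\<lambda>h. ((\<integral>t. k (c+h) t \<partial>M) - (\<integral>t. k c t \<partial>M)) / h) \<circ> X) \<longlonglongrightarrow> (\<integral>t. deriv (\<lambda>x. k x t) c \<partial>M)"
      unfolding o_def by (rule LIMSEQ_offset)
  qed
  then show ?thesis by (simp add: DERIV_def)
qed

corollary holomorphic_on_integral_param: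
  fixes k :: "complex \<Rightarrow> 'a \<Rightarrow> complex"
  assumes U: "open U"
    and hol: "\<And>t. t \<in> space M \<Longrightarrow> (\<lambda>x. k x t) holomorphic_on U"
    and meas: "\<And>x. x \<in> U \<Longrightarrow> k x \<in> borel_measurable M"
    and bound: "\<And>c. c \<in> U \<Longrightarrow> \<exists>r>0. \<exists>B. integrable M B \<and>
      (\<forall>x\<in>ball c r \<inter> U. \<forall>t\<in>space M. norm (k x t) \<le> B t)"
  shows "(\<lambda>x. \<integral>t. k x t \<partial>M) holomorphic_on U"
proof (rule holomorphic_onI)
  fix c assume c: "c \<in> U"
  from bound[OF c] obtain r B where "r > 0" "integrable M B"
    "\<And>x t. x \<in> ball c r \<inter> U \<Longrightarrow> t \<in> space M \<Longrightarrow> norm (k x t) \<le> B t" by blast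
  from has_field_derivative_integral_param[OF U c hol meas this]
  show "(\<lambda>x. \<integral>t. k x t \<partial>M) field_differentiable at c within U"
    by (meson field_differentiable_at_within field_differentiable_def)
qed

text \<open>The quotient (1 + c t) / (1 + t) moves on the segment from 1 to c, which avoids 0
  because c is off the nonpositive axis. Half of the distance from 0 to this segment also covers all
  x close to c, as locally uniform domination requires.\<close>

lemma norm_one_plus_mult_bound:
  fixes c :: complex
  assumes "c \<notin> \<real>\<^sub>\<le>\<^sub>0"
  obtains d where "d > 0" "\<And>x t. x \<in> ball c d \<Longrightarrow> t \<ge> 0 \<Longrightarrow> d * (1 + t) \<le> norm (1 + x * of_real t)"
proof -
  have "0 \<notin> closed_segment 1 c"
  proof
    assume "0 \<in> closed_segment 1 c"
    then obtain u where u: "0 \<le> u" "u \<le> 1" "(1 - u) *\<^sub>R 1 + u *\<^sub>R c = 0"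
      by (auto simp: in_segment)
    then have "u \<noteq> 0" by auto
    with u have "c = of_real (-(1-u)/u)"
      by (simp add: scaleR_conv_of_real field_simps eq_neg_iff_add_eq_0)
    moreover have "-(1-u)/u \<le> 0" using u by (simp add: divide_nonpos_nonneg)
    ultimately show False using assms by (metis nonpos_Reals_of_real_iff)
  qed
  then obtain e where e: "e > 0" "\<And>z. z \<in> closed_segment 1 c \<Longrightarrow> e \<le> dist 0 z"
    using separate_point_closed[of "closed_segment 1 c" 0] by auto
  have "e/2 * (1 + t) \<le> norm (1 + x * of_real t)" if x: "x \<in> ball c (e/2)" and t: "t \<ge> 0" for x t
  proof -
    have nz: "1 + complex_of_real t \<noteq> 0"
      using t by (metis add_nonneg_eq_0_iff of_real_1 of_real_add of_real_eq_0_iff zero_le_one zero_neq_one)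
    have "(1 + c * of_real t) / of_real (1 + t) = (1 - t/(1+t)) *\<^sub>R 1 + (t/(1+t)) *\<^sub>R c"
      using nz t by (auto simp: scaleR_conv_of_real divide_simps)
    then have "(1 + c * of_real t) / of_real (1 + t) \<in> closed_segment 1 c"
      using t by (auto simp: in_segment intro!: exI[of _ "t/(1+t)"])
    from e(2)[OF this] have "e \<le> norm (1 + c * of_real t) / (1 + t)"
      using t by (simp add: norm_divide del: of_real_add)
    then have 1: "e * (1 + t) \<le> norm (1 + c * of_real t)"
      using t by (simp add: field_simps)
    have "norm (c * of_real t - x * of_real t) = dist c x * t"
      using t by (simp add: dist_norm norm_mult flip: left_diff_distrib)
    also have "\<dots> \<le> e/2 * t" using x t by (intro mult_right_mono) auto
    finally have "norm (c * of_real t - x * of_real t) \<le> e/2 * t" .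
    moreover have "norm (1 + c * of_real t) \<le> norm (1 + x * of_real t) + norm (c * of_real t - x * of_real t)"
      using norm_triangle_ineq[of "1 + x * of_real t" "c * of_real t - x * of_real t"] by simp
    moreover have "e/2 * t \<le> e/2 * (1+t)" using e t by simp
    ultimately show ?thesis using 1 e by (simp add: field_simps) 
  qed
  with e show ?thesis by (intro that[of "e/2"]) auto
qed

text \<open>A measure whose space is the open half-line, rather than set integrals over it:
  conditions quantified over \<open>space M\<close> then concern t > 0 only, where complex powers of
  t are continuous.\<close>

definition pos_lborel :: "real measure" where
  "pos_lborel = restrict_space lborel {0<..}"

lemma space_pos_lborel [simp]: "space pos_lborel = {0<..}"
  by (simp add: pos_lborel_def space_restrict_space)

lemma borel_measurable_pos_lborel:
  fixes f :: "real \<Rightarrow> 'a :: {banach, second_countable_topology}"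
  assumes "continuous_on {0<..} f"
  shows "f \<in> borel_measurable pos_lborel"
proof -
  have "sets pos_lborel = sets (restrict_space borel {0<..})"
    unfolding pos_lborel_def by (intro sets_restrict_space_cong) simp
  then show ?thesis
    using borel_measurable_continuous_on_restrict[OF assms] measurable_cong_sets by blast
qed

lemma integrable_pos_lborel_bound:
  fixes f :: "real \<Rightarrow> 'a :: {banach, second_countable_topology}"
  assumes "integrable pos_lborel B" "continuous_on {0<..} f" "\<And>t. t > 0 \<Longrightarrow> norm (f t) \<le> B t"
  shows "integrable pos_lborel f"
  by (rule Bochner_Integration.integrable_bound[OF assms(1) borel_measurable_pos_lborel[OF assms(2)]])
     (use assms(3) in \<open>force intro: AE_I2\<close>)

lemma integral_pos_lborel_scale:
  fixes f :: "real \<Rightarrow> 'a :: {banach, second_countable_topology}"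
  assumes c: "c > 0"
  shows "(\<integral>t. f t \<partial>pos_lborel) = c *\<^sub>R (\<integral>t. f (c * t) \<partial>pos_lborel)"
proof -
  have "(\<integral>t. f t \<partial>pos_lborel) = (\<integral>t. indicator {0<..} t *\<^sub>R f t \<partial>lborel)"
    by (simp add: pos_lborel_def integral_restrict_space)
  also have "\<dots> = c *\<^sub>R (\<integral>t. indicator {0<..} (c * t) *\<^sub>R f (c * t) \<partial>lborel)"
    using lborel_integral_real_affine[of c "\<lambda>t. indicator {0<..} t *\<^sub>R f t" 0] c by simp
  also have "(\<lambda>t. indicator {0<..} (c * t) *\<^sub>R f (c * t)) = (\<lambda>t. indicator {0<..} t *\<^sub>R f (c * t))"
    using c by (auto simp: indicator_def zero_less_mult_iff)
  also have "(\<integral>t. indicator {0<..} t *\<^sub>R f (c * t) \<partial>lborel) = (\<integral>t. f (c * t) \<partial>pos_lborel)"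
    by (simp add: pos_lborel_def integral_restrict_space)
  finally show ?thesis .
qed

text \<open>Imports gauge-integral facts, namely the Gamma integral. Continuity gives Borel
  measurability, under which integrals over \<open>lebesgue\<close> and \<open>lborel\<close>
  agree.\<close>

lemma integral_pos_lborel_lebesgue:
  fixes f :: "real \<Rightarrow> 'a :: euclidean_space"
  assumes "f absolutely_integrable_on {0<..}" "continuous_on {0<..} f" "(f has_integral I) {0<..}"
  shows "integrable pos_lborel f" "(\<integral>t. f t \<partial>pos_lborel) = I"
proof -
  have m: "(\<lambda>t. indicator {0<..} t *\<^sub>R f t) \<in> borel_measurable lborel"
    using borel_measurable_continuous_on_indicator[OF _ assms(2)] by simp
  have "integrable lebesgue (\<lambda>t. indicator {0<..} t *\<^sub>R f t)"
    using assms(1) by (simp add: set_integrable_def)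
  with m have "integrable lborel (\<lambda>t. indicator {0<..} t *\<^sub>R f t)"
    by (simp add: integrable_completion)
  then show "integrable pos_lborel f"
    by (simp add: pos_lborel_def integrable_restrict_space)
  have "(\<integral>t. f t \<partial>pos_lborel) = (\<integral>t. indicator {0<..} t *\<^sub>R f t \<partial>lborel)"
    by (simp add: pos_lborel_def integral_restrict_space)
  also have "\<dots> = (\<integral>t. indicator {0<..} t *\<^sub>R f t \<partial>lebesgue)"
    using m by (simp add: integral_completion)
  also have "\<dots> = I"
    using set_lebesgue_integral_eq_integral(2)[OF assms(1)] assms(3)
    by (simp add: set_lebesgue_integral_def integral_unique)
  finally show "(\<integral>t. f t \<partial>pos_lborel) = I" .
qed

section \<open>Complex powers, Gamma integrals and Euler's integral on the half-line\<close>

lemma continuous_on_cpow [continuous_intros]: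
  "continuous_on {0<..} (\<lambda>t::real. complex_of_real t powr s)"
  by (intro continuous_intros) auto

lemma norm_cpow: "t > 0 \<Longrightarrow> norm (complex_of_real t powr s) = t powr Re s"
  by (simp add: norm_powr_real_powr)

lemma cpow_mult: "a > 0 \<Longrightarrow> b > 0 \<Longrightarrow>
    complex_of_real (a * b) powr s = of_real a powr s * of_real b powr s"
  by (simp add: powr_times_real)

lemma Gamma_integral_pos:
  assumes s: "Re s > 0" and c: "c > 0"
  shows "integrable pos_lborel (\<lambda>t. of_real t powr (s - 1) * exp (- of_real (c * t)))"
        "(\<integral>t. of_real t powr (s - 1) * exp (- of_real (c * t)) \<partial>pos_lborel) = Gamma s * of_real c powr (- s)"
proof -
  have cont: "continuous_on {0<..} (\<lambda>t. complex_of_real t powr (s - 1) * exp (- of_real (c * t)))" for c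
    by (intro continuous_intros) auto
  have eq: "(\<lambda>t. of_real t powr (s - 1) / complex_of_real (exp (c * t))) =
      (\<lambda>t. of_real t powr (s - 1) * exp (- of_real (c * t)))" for c
    by (simp add: exp_minus field_simps flip: exp_of_real)
  have a: "(\<lambda>t. complex_of_real t powr (s - 1) * exp (- of_real (c * t))) absolutely_integrable_on {0<..}"
    if "c > 0" for c
    using absolutely_integrable_Gamma_integral[OF s that] by (simp only: eq)
  show "integrable pos_lborel (\<lambda>t. of_real t powr (s - 1) * exp (- of_real (c * t)))"
  proof (rule integral_pos_lborel_lebesgue(1)[OF a[OF c] cont])
    show "((\<lambda>t. complex_of_real t powr (s - 1) * exp (- of_real (c * t))) has_integral
       integral {0<..} (\<lambda>t. complex_of_real t powr (s - 1) * exp (- of_real (c * t)))) {0<..}"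
      using a[OF c] set_lebesgue_integral_eq_integral(1) integrable_integral by blast
  qed
  have "((\<lambda>t. of_real t powr (s - 1) * exp (- of_real (1 * t))) has_integral Gamma s) {0<..}"
    using Gamma_integral_complex'[OF s] eq[of 1] by (simp only: mult_1)
  from integral_pos_lborel_lebesgue(2)[OF a cont this]
  have G: "(\<integral>t. of_real t powr (s - 1) * exp (- of_real t) \<partial>pos_lborel) = Gamma s" by simp
  have "Gamma s = of_real c * (\<integral>t. of_real (c * t) powr (s - 1) * exp (- of_real (c * t)) \<partial>pos_lborel)"
    using integral_pos_lborel_scale[OF c, of "\<lambda>t. of_real t powr (s - 1) * exp (- complex_of_real t)"]
    by (simp add: G scaleR_conv_of_real)
  also have "(\<integral>t. of_real (c * t) powr (s - 1) * exp (- complex_of_real (c * t)) \<partial>pos_lborel) =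
      (\<integral>t. of_real c powr (s - 1) * (of_real t powr (s - 1) * exp (- complex_of_real (c * t))) \<partial>pos_lborel)"
    by (intro Bochner_Integration.integral_cong refl) (use c cpow_mult in auto)
  also have "\<dots> = of_real c powr (s - 1) *
      (\<integral>t. of_real t powr (s - 1) * exp (- complex_of_real (c * t)) \<partial>pos_lborel)" by simp
  finally have "Gamma s = of_real c powr s * (\<integral>t. of_real t powr (s - 1) * exp (- complex_of_real (c * t)) \<partial>pos_lborel)"
    using c by (simp add: powr_diff)
  then show "(\<integral>t. of_real t powr (s - 1) * exp (- of_real (c * t)) \<partial>pos_lborel) = Gamma s * of_real c powr (- s)"
    using c by (simp add: powr_minus field_simps)
qed

lemma Gamma_integral_pos_real:
  assumes s: "s > 0" and c: "c > 0"
  shows "integrable pos_lborel (\<lambda>t. t powr (s - 1) * exp (- (c * t)))"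
        "(\<integral>t. t powr (s - 1) * exp (- (c * t)) \<partial>pos_lborel) = Gamma s * c powr (- s)"
proof -
  have eq: "of_real t powr (of_real s - 1) * exp (- complex_of_real (c * t)) =
      of_real (t powr (s - 1) * exp (- (c * t)))" if "t \<in> space pos_lborel" for t
    using that powr_of_real[of t "s - 1"] exp_of_real[of "- (c * t)"] by simp
  have "integrable pos_lborel (\<lambda>t. complex_of_real (t powr (s - 1) * exp (- (c * t))))"
    using Gamma_integral_pos(1)[of "of_real s" c] s c
    by (subst (asm) Bochner_Integration.integrable_cong[OF refl eq]) auto
  from integrable_Re[OF this] show "integrable pos_lborel (\<lambda>t. t powr (s - 1) * exp (- (c * t)))"
    by simp
  have "complex_of_real (\<integral>t. t powr (s - 1) * exp (- (c * t)) \<partial>pos_lborel) =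
     (\<integral>t. complex_of_real (t powr (s - 1) * exp (- (c * t))) \<partial>pos_lborel)"
    by (simp only: integral_complex_of_real)
  also have "\<dots> = Gamma (of_real s) * of_real c powr (- of_real s)"
    using Gamma_integral_pos(2)[of "of_real s" c] s c
    by (subst Bochner_Integration.integral_cong[OF refl eq[symmetric]]) auto
  also have "\<dots> = of_real (Gamma s * c powr (- s))"
    using c s powr_of_real[of c "- s"] by (simp add: Gamma_complex_of_real)
  finally show "(\<integral>t. t powr (s - 1) * exp (- (c * t)) \<partial>pos_lborel) = Gamma s * c powr (- s)"
    by (simp only: of_real_eq_iff)
qed

lemma nn_integral_Gamma_pos:
  assumes "s > 0" "c > 0"
  shows "(\<integral>\<^sup>+t. ennreal (t powr (s - 1) * exp (- (c * t))) * indicator {0<..} t \<partial>lborel) = ennreal (Gamma s * c powr (- s))"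
proof -
  have "(\<integral>\<^sup>+t. ennreal (t powr (s - 1) * exp (- (c * t))) \<partial>pos_lborel) = ennreal (Gamma s * c powr (- s))"
    using Gamma_integral_pos_real[OF assms] by (subst nn_integral_eq_integral) (auto intro!: AE_I2)
  then show ?thesis
    by (simp add: pos_lborel_def nn_integral_restrict_space)
qed

text \<open>Write 1 / (1 + t) as the integral of exp(-(1 + t) v) over v > 0 and exchange the order.
  The t-integral gives Gamma(s) v^(-s), the v-integral Gamma(1 - s), and the reflection formula
  finishes. With nonnegative extended integrals the exchange is free and integrability comes out as
  well.\<close>

lemma Euler_integral_real:
  fixes s :: real
  assumes s: "0 < s" "s < 1"
  shows "integrable pos_lborel (\<lambda>t. t powr (s - 1) / (1 + t))"
        "(\<integral>t. t powr (s - 1) / (1 + t) \<partial>pos_lborel) = pi / sin (pi * s)"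
proof -
  let ?I = "indicator {0<..} :: real \<Rightarrow> ennreal"
  have "(\<integral>\<^sup>+t. ennreal (t powr (s - 1) / (1 + t)) * ?I t \<partial>lborel) =
      (\<integral>\<^sup>+t. (\<integral>\<^sup>+v. ennreal (t powr (s - 1) * exp (- (v * t)) * exp (- v)) * ?I v * ?I t \<partial>lborel) \<partial>lborel)"
  proof (rule nn_integral_cong)
    fix t :: real
    show "ennreal (t powr (s - 1) / (1 + t)) * ?I t =
       (\<integral>\<^sup>+v. ennreal (t powr (s - 1) * exp (- (v * t)) * exp (- v)) * ?I v * ?I t \<partial>lborel)"
    proof (cases "t > 0")
      case True
      \<comment> \<open>The factor \<open>v powr (1 - 1)\<close> is 1 and brings the integral into
        the shape of \<open>nn_integral_Gamma_pos\<close> with exponent 1; the exponent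
        \<open>(1 - s) - 1\<close> further down has the same purpose.\<close>
      have "(\<integral>\<^sup>+v. ennreal (t powr (s - 1) * exp (- (v * t)) * exp (- v)) * ?I v \<partial>lborel) =
          (\<integral>\<^sup>+v. ennreal (t powr (s - 1)) * (ennreal (v powr (1 - 1) * exp (- ((1 + t) * v))) * ?I v) \<partial>lborel)"
      proof (rule nn_integral_cong)
        fix v :: real
        have eq: "t powr (s - 1) * exp (- (v * t)) * exp (- v) = t powr (s - 1) * exp (- ((1 + t) * v))"
          by (simp add: algebra_simps exp_diff exp_minus divide_inverse)
        show "ennreal (t powr (s - 1) * exp (- (v * t)) * exp (- v)) * ?I v =
            ennreal (t powr (s - 1)) * (ennreal (v powr (1 - 1) * exp (- ((1 + t) * v))) * ?I v)"
          by (subst eq) (auto simp: indicator_def ennreal_mult')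
      qed
      also have "\<dots> = ennreal (t powr (s - 1)) * (\<integral>\<^sup>+v. ennreal (v powr (1 - 1) * exp (- ((1 + t) * v))) * ?I v \<partial>lborel)"
        by (intro nn_integral_cmult) measurable
      also have "\<dots> = ennreal (t powr (s - 1) / (1 + t))"
        using True by (subst nn_integral_Gamma_pos) (auto simp: powr_minus divide_inverse ennreal_mult')
      finally show ?thesis using True by simp
    qed auto
  qed
  also have "\<dots> = (\<integral>\<^sup>+v. (\<integral>\<^sup>+t. ennreal (t powr (s - 1) * exp (- (v * t)) * exp (- v)) * ?I v * ?I t \<partial>lborel) \<partial>lborel)"
    by (rule lborel_pair.Fubini') measurable
  also have "\<dots> = (\<integral>\<^sup>+v. ennreal (Gamma s) * (ennreal (v powr ((1 - s) - 1) * exp (- (1 * v))) * ?I v) \<partial>lborel)"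
  proof (rule nn_integral_cong)
    fix v :: real
    show "(\<integral>\<^sup>+t. ennreal (t powr (s - 1) * exp (- (v * t)) * exp (- v)) * ?I v * ?I t \<partial>lborel) =
       ennreal (Gamma s) * (ennreal (v powr ((1 - s) - 1) * exp (- (1 * v))) * ?I v)"
    proof (cases "v > 0")
      case True
      have "(\<integral>\<^sup>+t. ennreal (t powr (s - 1) * exp (- (v * t)) * exp (- v)) * ?I v * ?I t \<partial>lborel) =
          (\<integral>\<^sup>+t. ennreal (exp (- v)) * (ennreal (t powr (s - 1) * exp (- (v * t))) * ?I t) \<partial>lborel)"
        using True by (intro nn_integral_cong) (auto simp: indicator_def ennreal_mult' mult_ac)
      also have "\<dots> = ennreal (exp (- v)) * (\<integral>\<^sup>+t. ennreal (t powr (s - 1) * exp (- (v * t))) * ?I t \<partial>lborel)"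
        by (intro nn_integral_cmult) measurable
      also have "\<dots> = ennreal (exp (- v)) * ennreal (Gamma s * v powr (- s))"
        using True s by (subst nn_integral_Gamma_pos) auto
      also have "\<dots> = ennreal (Gamma s) * ennreal (v powr (- s) * exp (- v))"
        using s by (simp add: ennreal_mult' Gamma_real_pos less_imp_le mult_ac)
      finally show ?thesis using True by simp
    qed auto
  qed
  also have "\<dots> = ennreal (Gamma s) * (\<integral>\<^sup>+v. ennreal (v powr ((1 - s) - 1) * exp (- (1 * v))) * ?I v \<partial>lborel)"
    by (intro nn_integral_cmult) measurable
  also have "\<dots> = ennreal (Gamma s * Gamma (1 - s))"
    using s by (subst nn_integral_Gamma_pos) (auto simp: ennreal_mult' Gamma_real_pos less_imp_le)
  also have "Gamma s * Gamma (1 - s) = pi / sin (pi * s)"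
  proof -
    have "complex_of_real (Gamma s * Gamma (1 - s)) = of_real (pi / sin (pi * s))"
      using Gamma_reflection_complex[of "of_real s"] s
      by (simp flip: Gamma_complex_of_real sin_of_real)
    then show ?thesis by (simp only: of_real_eq_iff)
  qed
  finally have *: "(\<integral>\<^sup>+t. ennreal (t powr (s - 1) / (1 + t)) \<partial>pos_lborel) = ennreal (pi / sin (pi * s))"
    by (simp add: pos_lborel_def nn_integral_restrict_space)
  have m: "(\<lambda>t. t powr (s - 1) / (1 + t)) \<in> borel_measurable pos_lborel"
    by (intro borel_measurable_pos_lborel continuous_intros) auto
  show "integrable pos_lborel (\<lambda>t. t powr (s - 1) / (1 + t))"
    using m * by (intro integrableI_nonneg) (auto intro!: AE_I2)
  have "sin (pi * s) > 0" using s by (intro sin_gt_zero) (auto simp: field_simps)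
  then show "(\<integral>t. t powr (s - 1) / (1 + t) \<partial>pos_lborel) = pi / sin (pi * s)"
    using m * by (intro integral_eq_nn_integral[THEN trans]) (auto intro!: AE_I2)
qed

text \<open>The identity theorem in the form used throughout: a formula checked for real parameters
  in an interval spreads to a connected open set, with the midpoint as limit point.\<close>

lemma holomorphic_eq_on_real_segment:
  assumes "f holomorphic_on S" "g holomorphic_on S" "open S" "connected S" "a < b"
    and "\<And>x. a < x \<Longrightarrow> x < b \<Longrightarrow> complex_of_real x \<in> S \<and> f (of_real x) = g (of_real x)"
    and "w \<in> S"
  shows "f w = g w"
proof -
  have lim: "complex_of_real ((a+b)/2) islimpt of_real ` {a<..<b}"
    unfolding islimpt_approachable
  proof (intro allI impI)
    fix e :: real assume "e > 0"
    define x where "x = (a+b)/2 + min e ((b-a)/2) / 2"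
    have "a < x" "x < b" "x \<noteq> (a+b)/2" "dist x ((a+b)/2) < e"
      using \<open>e > 0\<close> \<open>a < b\<close> by (auto simp: x_def dist_real_def min_def field_simps)
    then show "\<exists>x'\<in>complex_of_real ` {a<..<b}. x' \<noteq> of_real ((a+b)/2) \<and> dist x' (of_real ((a+b)/2)) < e"
      by (intro bexI[of _ "of_real x"]) (auto simp: dist_of_real simp del: of_real_divide of_real_add)
  qed
  have "f w - g w = 0"
  proof (rule analytic_continuation[of "\<lambda>z. f z - g z" S "of_real ` {a<..<b}" "of_real ((a+b)/2)"])
    show "complex_of_real ((a+b)/2) \<in> S" using assms(5,6) by (intro conjunct1[OF assms(6)]) auto
  qed (use assms lim in \<open>auto intro!: holomorphic_intros\<close>)
  then show ?thesis by simp
qed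

text \<open>A majorant of t^x that is uniform for exponents between a and b: the first term serves t
  <= 1, the second t > 1. It dominates integrands whose exponent varies in a disc.\<close>

lemma powr_le_powr_add:
  fixes t :: real
  assumes "t > 0" "a \<le> x" "x \<le> b"
  shows "t powr x \<le> t powr a + t powr b"
proof (cases "t \<le> 1")
  case True
  then have "t powr x \<le> t powr a" using assms by (intro powr_mono') auto
  then show ?thesis by (simp add: add_increasing2)
next
  case False
  then have "t powr x \<le> t powr b" using assms by (intro powr_mono) auto
  then show ?thesis by (simp add: add_increasing)
qed

lemma open_Re_gt: "open {z. a < Re z}" and open_Re_lt: "open {z. Re z < a}"
  by (auto intro: open_halfspace_Re_gt open_halfspace_Re_lt)

lemma convex_Re_gt: "convex {z. a < Re z}" and convex_Re_lt: "convex {z. Re z < a}"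
  by (auto intro: convex_halfspace_Re_gt convex_halfspace_Re_lt)

lemma Re_dist_less: "x \<in> ball c r \<Longrightarrow> \<bar>Re x - Re c\<bar> < r"
  using abs_Re_le_cmod[of "x - c"] by (auto simp: dist_norm norm_minus_commute)

text \<open>Both sides are holomorphic in z on the right half-plane, so the real scales between 0
  and 1 determine them.\<close>

lemma Gamma_integral_complex_scale:
  assumes s: "Re s > 0" and z: "Re z > 0"
  shows "integrable pos_lborel (\<lambda>t. of_real t powr (s - 1) * exp (- z * of_real t))"
        "(\<integral>t. of_real t powr (s - 1) * exp (- z * of_real t) \<partial>pos_lborel) = Gamma s * z powr (- s)"
proof -
  let ?k = "\<lambda>z t. complex_of_real t powr (s - 1) * exp (- z * of_real t)"
  let ?U = "{z. 0 < Re z}"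
  have cont: "continuous_on {0<..} (?k z)" for z
    by (intro continuous_intros)
  have nk: "norm (?k z t) = t powr (Re s - 1) * exp (- (Re z * t))" if "t > 0" for z t
    using that by (simp add: norm_mult norm_cpow)
  show "integrable pos_lborel (?k z)"
    using nk by (intro integrable_pos_lborel_bound[OF Gamma_integral_pos_real(1)[OF s z] cont]) auto
  have "(\<lambda>z. \<integral>t. ?k z t \<partial>pos_lborel) holomorphic_on ?U"
  proof (rule holomorphic_on_integral_param)
    fix c assume c: "c \<in> ?U"
    have "norm (?k x t) \<le> t powr (Re s - 1) * exp (- (Re c / 2 * t))"
      if "x \<in> ball c (Re c / 2)" "t > 0" for x t
    proof -
      have "Re x \<ge> Re c / 2" using Re_dist_less[OF that(1)] by (auto simp: abs_if split: if_splits)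
      then have "Re c / 2 * t \<le> Re x * t" using that by (intro mult_right_mono) auto
      then show ?thesis using that by (subst nk) (auto intro!: mult_left_mono)
    qed
    moreover have "integrable pos_lborel (\<lambda>t. t powr (Re s - 1) * exp (- (Re c / 2 * t)))"
      using c s by (intro Gamma_integral_pos_real) auto
    ultimately show "\<exists>r>0. \<exists>B. integrable pos_lborel B \<and> (\<forall>x\<in>ball c r \<inter> ?U. \<forall>t\<in>space pos_lborel. norm (?k x t) \<le> B t)"
      using c by (intro exI[of _ "Re c / 2"] conjI exI[of _ "\<lambda>t. t powr (Re s - 1) * exp (- (Re c / 2 * t))"]) auto
    show "?k z \<in> borel_measurable pos_lborel" for z by (intro borel_measurable_pos_lborel cont)
  qed (auto intro!: holomorphic_intros open_Re_gt)
  then show "(\<integral>t. ?k z t \<partial>pos_lborel) = Gamma s * z powr (- s)"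
  proof (rule holomorphic_eq_on_real_segment[where a = 0 and b = 1])
    show "(\<lambda>z. Gamma s * z powr - s) holomorphic_on ?U"
      by (intro holomorphic_intros) (auto simp: complex_nonpos_Reals_iff)
    show "connected ?U" by (intro convex_connected convex_Re_gt)
    fix x :: real assume "0 < x" "x < 1"
    then show "of_real x \<in> ?U \<and> (\<integral>t. ?k (of_real x) t \<partial>pos_lborel) = Gamma s * of_real x powr (- s)"
      using Gamma_integral_pos(2)[OF s, of x] by simp
  qed (use z in \<open>auto intro: open_Re_gt\<close>)
qed

text \<open>By rGamma(b + n) = (b + n) rGamma(b + n + 1), every step with large n divides by at
  least (n + 1) / 2, whence 2^n / n!. The finitely many small n are covered by compactness of the
  disc, and \<open>C\<close> collects their constants.\<close>

lemma rGamma_shift_bound: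
  fixes R :: real
  shows "\<exists>C\<ge>0. \<forall>n. \<forall>b\<in>cball (0::complex) R. norm (rGamma (b + of_nat n)) \<le> C * 2 ^ n / fact n"
proof -
  have "\<exists>B\<ge>0. \<forall>b\<in>cball (0::complex) R. norm (rGamma (b + of_nat n)) \<le> B" for n
  proof -
    have "compact ((\<lambda>b. rGamma (b + of_nat n)) ` cball (0::complex) R)"
      by (intro compact_continuous_image holomorphic_on_imp_continuous_on holomorphic_intros compact_cball)
    then have "bounded ((\<lambda>b. rGamma (b + of_nat n)) ` cball (0::complex) R)"
      by (rule compact_imp_bounded)
    then obtain B where "\<forall>b\<in>cball (0::complex) R. norm (rGamma (b + of_nat n)) \<le> B"
      unfolding bounded_iff by auto
    then show ?thesis by (intro exI[of _ "max B 0"]) (auto intro: order_trans)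
  qed
  then obtain B where B: "\<And>n. B n \<ge> 0" "\<And>n b::complex. b \<in> cball 0 R \<Longrightarrow> norm (rGamma (b + of_nat n)) \<le> B n"
    by metis
  \<comment> \<open>For n >= 2 R + 1 and norm b <= R the triangle inequality gives norm (b + n) >= n
    - R >= (n + 1) / 2.\<close>
  define N where "N = nat \<lceil>2 * R + 1\<rceil>"
  define C where "C = (\<Sum>n\<le>N. B n * fact n / 2 ^ n)"
  have "norm (rGamma (b + of_nat n)) \<le> C * 2 ^ n / fact n" if b: "b \<in> cball 0 R" for n and b :: complex
  proof (induction n)
    case 0
    have "B 0 * fact 0 / 2 ^ 0 \<le> C"
      unfolding C_def by (rule member_le_sum) (use B in auto)
    then show ?case using B(2)[OF b, of 0] by simp
  next
    case (Suc n)
    show ?case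
    proof (cases "Suc n \<le> N")
      case True
      have "B (Suc n) * fact (Suc n) / 2 ^ Suc n \<le> C"
        unfolding C_def by (rule member_le_sum) (use B True in auto)
      then have "B (Suc n) \<le> C * 2 ^ Suc n / fact (Suc n)"
        by (simp add: pos_le_divide_eq pos_divide_le_eq del: fact_Suc power_Suc)
      then show ?thesis using B(2)[OF b, of "Suc n"] by linarith
    next
      case False
      have "2 * R + 1 \<le> real N" unfolding N_def by linarith
      with False have n: "2 * R + 1 \<le> real n" by linarith
      have "norm (of_nat n :: complex) \<le> norm (b + of_nat n) + norm b"
        using norm_triangle_ineq4[of "b + of_nat n" b] by simp
      then have ge: "norm (b + of_nat n) \<ge> (real n + 1) / 2"
        using b n by simp
      have "norm (rGamma (b + of_nat (Suc n))) * ((real n + 1) / 2) \<le> norm (rGamma (b + of_nat (Suc n))) * norm (b + of_nat n)"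
        using ge by (intro mult_left_mono) auto
      also have "\<dots> = norm (rGamma (b + of_nat n))"
        using rGamma_plus1[of "b + of_nat n"] by (simp add: add_ac mult_ac flip: norm_mult)
      also have "\<dots> \<le> C * 2 ^ n / fact n" by (rule Suc.IH)
      finally have "norm (rGamma (b + of_nat (Suc n))) \<le> C * 2 ^ n / fact n / ((real n + 1) / 2)"
        by (subst pos_le_divide_eq) auto
      also have "\<dots> = C * 2 ^ Suc n / fact (Suc n)"
        by (simp add: divide_simps)
      finally show ?thesis .
    qed
  qed
  moreover have "C \<ge> 0" unfolding C_def by (intro sum_nonneg) (use B in auto)
  ultimately show ?thesis by blast
qed

section \<open>The Laplace transform of the Cauchy kernel\<close>

text \<open>The Mittag-Leffler function E_(1,b). Reciprocal Gammas keep it defined, and entire in b,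
  at nonpositive integers b too.\<close>

definition rGamma_series :: "complex \<Rightarrow> complex \<Rightarrow> complex" where
  "rGamma_series b x = (\<Sum>k. rGamma (b + of_nat k) * x ^ k)"

lemma summable_rGamma_series: "summable (\<lambda>k. rGamma (b + of_nat k) * (x :: complex) ^ k)"
proof -
  obtain C where C': "\<forall>n. \<forall>b\<in>cball (0::complex) (norm b). norm (rGamma (b + of_nat n)) \<le> C * 2 ^ n / fact n"
    using rGamma_shift_bound by blast
  have C: "norm (rGamma (b + of_nat n)) \<le> C * 2 ^ n / fact n" for n
    using C' by simp
  have "summable (\<lambda>k. C * ((2 * norm x) ^ k / fact k))"
    using summable_exp[of "2 * norm x"] by (intro summable_mult) (simp add: divide_inverse mult_ac)
  then show ?thesis
  proof (rule summable_comparison_test')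
    fix k :: nat
    have "norm (rGamma (b + of_nat k) * x ^ k) \<le> C * 2 ^ k / fact k * norm x ^ k"
      unfolding norm_mult norm_power by (intro mult_right_mono C) auto
    then show "norm (rGamma (b + of_nat k) * x ^ k) \<le> C * ((2 * norm x) ^ k / fact k)"
      by (simp add: power_mult_distrib)
  qed
qed

lemma rGamma_series_has_derivative:
  "(rGamma_series b has_field_derivative (\<Sum>n. diffs (\<lambda>k. rGamma (b + of_nat k)) n * x ^ n)) (at x)"
  unfolding rGamma_series_def
  by (rule termdiffs_strong_converges_everywhere[OF summable_rGamma_series])

lemma rGamma_series_rec: "rGamma_series (b - 1) x = rGamma (b - 1) + x * rGamma_series b x"
proof -
  have "rGamma_series (b - 1) x = rGamma (b - 1) + (\<Sum>k. x * (rGamma (b + of_nat k) * x ^ k))"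
    unfolding rGamma_series_def
    using suminf_split_head[OF summable_rGamma_series[of "b - 1" x]] by (simp add: mult_ac)
  then show ?thesis
    unfolding rGamma_series_def by (simp add: suminf_mult summable_rGamma_series)
qed

text \<open>Coefficientwise this is (b - 1 + n) rGamma(b + n) = rGamma(b - 1 + n). Together with
  \<open>rGamma_series_rec\<close> it is the first-order differential equation that identifies the
  Laplace integral of the Cauchy kernel.\<close>

lemma rGamma_series_deriv_eq:
  "x * (\<Sum>n. diffs (\<lambda>k. rGamma (b + of_nat k)) n * x ^ n) + (b - 1) * rGamma_series b x = rGamma_series (b - 1) x"
proof -
  have s: "summable (\<lambda>n. diffs (\<lambda>k. rGamma (b + of_nat k)) n * x ^ n)"
    by (rule termdiff_converges_all[OF summable_rGamma_series])
  have "(\<lambda>n. of_nat n * rGamma (b + of_nat n) * x ^ n) sums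
      (x * (\<Sum>n. diffs (\<lambda>k. rGamma (b + of_nat k)) n * x ^ n))"
  proof (rule sums_Suc_imp)
    have "(\<lambda>n. x * (diffs (\<lambda>k. rGamma (b + of_nat k)) n * x ^ n)) sums
      (x * (\<Sum>n. diffs (\<lambda>k. rGamma (b + of_nat k)) n * x ^ n))"
      by (intro sums_mult summable_sums s)
    then show "(\<lambda>n. of_nat (Suc n) * rGamma (b + of_nat (Suc n)) * x ^ Suc n) sums
        (x * (\<Sum>n. diffs (\<lambda>k. rGamma (b + of_nat k)) n * x ^ n))"
      by (simp add: diffs_def mult_ac)
  qed simp
  moreover have "(\<lambda>n. (b - 1) * (rGamma (b + of_nat n) * x ^ n)) sums ((b - 1) * rGamma_series b x)"
    unfolding rGamma_series_def by (intro sums_mult summable_sums summable_rGamma_series)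
  ultimately have "(\<lambda>n. of_nat n * rGamma (b + of_nat n) * x ^ n + (b - 1) * (rGamma (b + of_nat n) * x ^ n)) sums
     (x * (\<Sum>n. diffs (\<lambda>k. rGamma (b + of_nat k)) n * x ^ n) + (b - 1) * rGamma_series b x)"
    by (rule sums_add)
  moreover have "of_nat n * rGamma (b + of_nat n) * x ^ n + (b - 1) * (rGamma (b + of_nat n) * x ^ n) =
      rGamma (b - 1 + of_nat n) * x ^ n" for n
  proof -
    have "of_nat n * rGamma (b + of_nat n) * x ^ n + (b - 1) * (rGamma (b + of_nat n) * x ^ n) =
        ((b - 1 + of_nat n) * rGamma (b - 1 + of_nat n + 1)) * x ^ n"
      by (simp add: algebra_simps)
    then show ?thesis by (simp only: rGamma_plus1)
  qed
  ultimately show ?thesis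
    unfolding rGamma_series_def[of "b - 1"] using sums_unique by simp
qed

lemma add_one_mult_neq_0:
  assumes "c \<notin> \<real>\<^sub>\<le>\<^sub>0" "t > 0" shows "1 + c * complex_of_real t \<noteq> 0"
proof -
  obtain d where "d > 0" "\<And>x t. x \<in> ball c d \<Longrightarrow> t \<ge> 0 \<Longrightarrow> d * (1 + t) \<le> norm (1 + x * of_real t)"
    using norm_one_plus_mult_bound[OF assms(1)] by metis
  then have "d * (1 + t) \<le> norm (1 + c * of_real t)" "0 < d * (1 + t)"
    using assms(2) by auto
  then have "0 < norm (1 + c * of_real t)" by linarith
  then show ?thesis by auto
qed

lemma continuous_on_cauchy_kernel:
  assumes "c \<notin> \<real>\<^sub>\<le>\<^sub>0"
  shows "continuous_on {0<..} (\<lambda>t. complex_of_real t powr (s - 1) / (1 + c * of_real t))"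
  using add_one_mult_neq_0[OF assms] by (intro continuous_intros) auto

text \<open>Both sides are holomorphic in c on the slit plane, and for 0 < c < 1 the substitution of
  c t for t reduces to c = 1.\<close>

lemma Euler_integral_slit:
  fixes s :: real and c :: complex
  assumes s: "0 < s" "s < 1" and c: "c \<notin> \<real>\<^sub>\<le>\<^sub>0"
  shows "integrable pos_lborel (\<lambda>t. of_real t powr (of_real s - 1) / (1 + c * of_real t))"
        "(\<integral>t. of_real t powr (of_real s - 1) / (1 + c * of_real t) \<partial>pos_lborel) =
           c powr (- of_real s) * of_real (pi / sin (pi * s))"
proof -
  let ?k = "\<lambda>c t. complex_of_real t powr (of_real s - 1) / (1 + c * of_real t)"
  let ?U = "- \<real>\<^sub>\<le>\<^sub>0 :: complex set"
  have nk: "norm (?k c t) = t powr (s - 1) / norm (1 + c * of_real t)" if "t > 0" for c t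
    using that by (simp add: norm_divide norm_cpow)
  have bound: "\<exists>d>0. \<exists>B. integrable pos_lborel B \<and> (\<forall>x\<in>ball c d \<inter> ?U. \<forall>t\<in>space pos_lborel. norm (?k x t) \<le> B t)"
    if c: "c \<in> ?U" for c
  proof -
    obtain d where d: "d > 0" "\<And>x t. x \<in> ball c d \<Longrightarrow> t \<ge> 0 \<Longrightarrow> d * (1 + t) \<le> norm (1 + x * of_real t)"
      using norm_one_plus_mult_bound c by (metis ComplD)
    have "norm (?k x t) \<le> t powr (s - 1) / (1 + t) / d" if "x \<in> ball c d" "t > 0" for x t
    proof -
      have "norm (?k x t) \<le> t powr (s - 1) / (d * (1 + t))"
        using that d by (subst nk) (auto intro!: divide_left_mono mult_pos_pos less_le_trans[OF _ d(2)])
      then show ?thesis by (simp add: mult.commute)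
    qed
    moreover have "integrable pos_lborel (\<lambda>t. t powr (s - 1) / (1 + t) / d)"
      by (intro integrable_divide Euler_integral_real(1) s)
    ultimately show ?thesis
      using d(1) by (intro exI[of _ d] conjI exI[of _ "\<lambda>t. t powr (s - 1) / (1 + t) / d"]) auto
  qed
  have opn: "open ?U" by (simp add: open_Compl closed_nonpos_Reals_complex)
  have int: "integrable pos_lborel (?k c)" if c: "c \<in> ?U" for c
  proof -
    obtain d B where d: "d > 0" "integrable pos_lborel B"
      "\<forall>x\<in>ball c d \<inter> ?U. \<forall>t\<in>space pos_lborel. norm (?k x t) \<le> B t"
      using bound[OF c] by blast
    show ?thesis
      by (rule integrable_pos_lborel_bound[OF d(2) continuous_on_cauchy_kernel]) (use d c in auto)
  qed
  show "integrable pos_lborel (?k c)" using int c by simp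
  have "(\<lambda>c. \<integral>t. ?k c t \<partial>pos_lborel) holomorphic_on ?U"
  proof (rule holomorphic_on_integral_param[OF opn _ _ bound])
    show "(\<lambda>c. ?k c t) holomorphic_on ?U" if "t \<in> space pos_lborel" for t
      using that add_one_mult_neq_0 by (intro holomorphic_intros) auto
    show "?k c \<in> borel_measurable pos_lborel" if "c \<in> ?U" for c
      using that by (intro borel_measurable_pos_lborel continuous_on_cauchy_kernel) auto
  qed
  then show "(\<integral>t. ?k c t \<partial>pos_lborel) = c powr (- of_real s) * of_real (pi / sin (pi * s))"
  proof (rule holomorphic_eq_on_real_segment[where a = 0 and b = 1])
    show "(\<lambda>c. c powr (- of_real s) * of_real (pi / sin (pi * s))) holomorphic_on ?U"
      by (intro holomorphic_intros) auto
    show "connected ?U"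
    proof -
      have "\<real>\<^sub>\<le>\<^sub>0 = complex_of_real ` {..0}" by (auto simp: nonpos_Reals_def)
      then show ?thesis using starlike_slotted_complex_plane_left[of 0] starlike_imp_connected by simp
    qed
    fix c :: real assume c: "0 < c" "c < 1"
    have "(\<integral>t. complex_of_real (t powr (s - 1) / (1 + t)) \<partial>pos_lborel) = of_real (pi / sin (pi * s))"
      by (simp only: integral_complex_of_real Euler_integral_real(2)[OF s])
    also have "(\<integral>t. complex_of_real (t powr (s - 1) / (1 + t)) \<partial>pos_lborel) = (\<integral>t. ?k 1 t \<partial>pos_lborel)"
    proof (rule Bochner_Integration.integral_cong[OF refl])
      fix t assume "t \<in> space pos_lborel"
      then show "complex_of_real (t powr (s - 1) / (1 + t)) = ?k 1 t"
        using powr_of_real[of t "s - 1"] by simp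
    qed
    also have "\<dots> = c *\<^sub>R (\<integral>t. ?k 1 (c * t) \<partial>pos_lborel)"
      by (rule integral_pos_lborel_scale[OF c(1)])
    also have "(\<integral>t. ?k 1 (c * t) \<partial>pos_lborel) = (\<integral>t. of_real c powr (of_real s - 1) * ?k (of_real c) t \<partial>pos_lborel)"
      by (intro Bochner_Integration.integral_cong refl) (use c cpow_mult in auto)
    also have "\<dots> = of_real c powr (of_real s - 1) * (\<integral>t. ?k (of_real c) t \<partial>pos_lborel)"
      by (simp only: integral_mult_right_zero)
    finally have "of_real c powr of_real s * (\<integral>t. ?k (of_real c) t \<partial>pos_lborel) = of_real (pi / sin (pi * s))"
      using c by (simp add: powr_diff scaleR_conv_of_real)
    moreover have "complex_of_real c powr of_real s \<noteq> 0" using c by simp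
    ultimately have "(\<integral>t. ?k (of_real c) t \<partial>pos_lborel) = of_real (pi / sin (pi * s)) / of_real c powr of_real s"
      by (metis nonzero_mult_div_cancel_left)
    then show "of_real c \<in> ?U \<and>
        (\<integral>t. ?k (of_real c) t \<partial>pos_lborel) = of_real c powr (- of_real s) * of_real (pi / sin (pi * s))"
      using c by (simp only: powr_minus divide_inverse mult.commute) auto
  qed (use c opn in auto)
qed

lemma cauchy_laplace_kernel:
  assumes s: "Re s > 0" and c: "c \<notin> \<real>\<^sub>\<le>\<^sub>0" and z: "Re z > 0"
  shows "integrable pos_lborel (\<lambda>t. of_real t powr (s - 1) * exp (- z * of_real t) / (1 + c * of_real t))"
proof -
  obtain d where d: "d > 0" "\<And>x t. x \<in> ball c d \<Longrightarrow> t \<ge> 0 \<Longrightarrow> d * (1 + t) \<le> norm (1 + x * of_real t)"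
    using norm_one_plus_mult_bound[OF c] by metis
  have "integrable pos_lborel (\<lambda>t. t powr (Re s - 1) * exp (- (Re z * t)) / d)"
    using Gamma_integral_pos_real(1)[OF s z] by simp
  then show ?thesis
  proof (rule integrable_pos_lborel_bound)
    show "continuous_on {0<..} (\<lambda>t. complex_of_real t powr (s - 1) * exp (- z * of_real t) / (1 + c * of_real t))"
      using add_one_mult_neq_0[OF c] by (intro continuous_intros) auto
    fix t :: real assume t: "t > 0"
    have "d \<le> d * (1 + t)" using t d(1) by simp
    also have "\<dots> \<le> norm (1 + c * of_real t)" using d(2)[of c t] t d(1) by simp
    finally have "d \<le> norm (1 + c * of_real t)" .
    then show "norm (of_real t powr (s - 1) * exp (- z * of_real t) / (1 + c * of_real t)) \<le> t powr (Re s - 1) * exp (- (Re z * t)) / d"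
      using t d by (auto simp: norm_mult norm_divide norm_cpow intro!: divide_left_mono mult_pos_pos)
  qed
qed

text \<open>Multiplied by exp(-z / c), the integral can be differentiated in z explicitly: the
  factor t + 1 / c = (1 + c t) / c cancels the denominator and leaves a Gamma integral. The
  right-hand side has the same derivative by the differential equation of
  \<open>rGamma_series\<close>, and Euler's integral fixes the constant at z = 0.\<close>

lemma cauchy_laplace_integral:
  fixes s :: real and c :: complex
  assumes s: "0 < s" "s < 1" and c: "c \<notin> \<real>\<^sub>\<le>\<^sub>0" and z: "Re z > 0"
  shows "(\<integral>t. of_real t powr (of_real s - 1) * exp (- z * of_real t) / (1 + c * of_real t) \<partial>pos_lborel) =
     of_real (pi / sin (pi * s)) * (c powr (- of_real s) * exp (z / c) - z powr (1 - of_real s) / c * rGamma_series (2 - of_real s) (z / c))"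
proof -
  let ?U = "{z. 0 < Re z}"
  let ?s = "complex_of_real s"
  let ?P = "complex_of_real (pi / sin (pi * s))"
  have c0: "c \<noteq> 0" using c by auto
  obtain d where d: "d > 0" "\<And>x t. x \<in> ball c d \<Longrightarrow> t \<ge> 0 \<Longrightarrow> d * (1 + t) \<le> norm (1 + x * of_real t)"
    using norm_one_plus_mult_bound[OF c] by metis
  have dc: "d * (1 + t) \<le> norm (1 + c * of_real t)" if "t \<ge> 0" for t
    using d(2)[of c t] d(1) that by simp
  let ?k = "\<lambda>z t. complex_of_real t powr (?s - 1) * exp (- z * (of_real t + 1 / c)) / (1 + c * of_real t)"
  define Q where "Q = (\<lambda>z. \<integral>t. ?k z t \<partial>pos_lborel)"
  have contk: "continuous_on {0<..} (?k z)" for z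
    using add_one_mult_neq_0[OF c] by (intro continuous_intros) auto
  have Q_eq: "Q z = exp (- z / c) * (\<integral>t. of_real t powr (?s - 1) * exp (- z * of_real t) / (1 + c * of_real t) \<partial>pos_lborel)" for z
  proof -
    have "Q z = (\<integral>t. exp (- z / c) * (of_real t powr (?s - 1) * exp (- z * of_real t) / (1 + c * of_real t)) \<partial>pos_lborel)"
      unfolding Q_def by (intro Bochner_Integration.integral_cong refl) (simp add: exp_diff exp_minus field_simps flip: exp_add)
    then show ?thesis by (simp only: integral_mult_right_zero)
  qed
  define R where "R = (\<lambda>z. ?P * (c powr (- ?s) - exp (- z / c) * z powr (1 - ?s) / c * rGamma_series (2 - ?s) (z / c)))"
  have P: "?P = Gamma ?s * Gamma (1 - ?s)"
    using Gamma_reflection_complex[of ?s] by (simp flip: sin_of_real)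
  have dQ: "(Q has_field_derivative - (1 / c) * exp (- z / c) * (Gamma ?s * z powr (- ?s))) (at z)"
    if z: "z \<in> ?U" for z
  proof -
    let ?r = "Re z / 2"
    define E where "E = exp ((norm z + ?r) / norm c) / d"
    have "((\<lambda>x. \<integral>t. ?k x t \<partial>pos_lborel) has_field_derivative (\<integral>t. deriv (\<lambda>x. ?k x t) z \<partial>pos_lborel)) (at z)"
    proof (rule has_field_derivative_integral_param[where U = ?U and r = ?r and B = "\<lambda>t. t powr (s - 1) * exp (- (?r * t)) * E"])
      show "integrable pos_lborel (\<lambda>t. t powr (s - 1) * exp (- (?r * t)) * E)"
        using z s by (intro integrable_mult_left Gamma_integral_pos_real) auto
      fix x t assume x: "x \<in> ball z ?r \<inter> ?U" and "t \<in> space pos_lborel"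
      then have t: "t > 0" by simp
      have rx: "Re x \<ge> ?r" using Re_dist_less[of x z ?r] x by (auto simp: abs_if split: if_splits)
      have "norm (?k x t) = t powr (s - 1) * (exp (- (Re x * t)) * norm (exp (- x / c))) / norm (1 + c * of_real t)"
      proof -
        have "- x * (of_real t + 1 / c) = - x * of_real t + - x / c" by (simp add: algebra_simps)
        then have "exp (- x * (of_real t + 1 / c)) = exp (- x * of_real t) * exp (- x / c)"
          by (simp only: exp_add)
        moreover have "norm (exp (- x * of_real t)) = exp (- (Re x * t))"
          by (simp add: norm_exp_eq_Re)
        ultimately show ?thesis using t by (simp only: norm_mult norm_divide norm_cpow) simp
      qed
      also have "\<dots> \<le> t powr (s - 1) * (exp (- (?r * t)) * exp ((norm z + ?r) / norm c)) / d"
      proof (intro frac_le mult_left_mono mult_mono)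
        show "exp (- (Re x * t)) \<le> exp (- (?r * t))" using rx t by (auto intro: mult_right_mono)
        have "norm (exp (- x / c)) \<le> exp (norm (- x / c))" by (rule norm_exp)
        also have "\<dots> \<le> exp ((norm z + ?r) / norm c)"
          using x norm_triangle_ineq3[of x z] by (auto simp: norm_divide dist_norm norm_minus_commute intro!: divide_right_mono)
        finally show "norm (exp (- x / c)) \<le> exp ((norm z + ?r) / norm c)" .
        have "d \<le> d * (1 + t)" using t d(1) by simp
        also have "\<dots> \<le> norm (1 + c * of_real t)" using dc[of t] t by simp
        finally show "d \<le> norm (1 + c * of_real t)" .
      qed (use d in auto)
      finally show "norm (?k x t) \<le> t powr (s - 1) * exp (- (?r * t)) * E" by (simp add: E_def)
    next
      show "?k x \<in> borel_measurable pos_lborel" for x by (intro borel_measurable_pos_lborel contk)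
      show "(\<lambda>x. ?k x t) holomorphic_on ?U" if "t \<in> space pos_lborel" for t
        using that add_one_mult_neq_0[OF c] by (intro holomorphic_intros) auto
    qed (use z in \<open>auto intro: open_Re_gt\<close>)
    also have "(\<integral>t. deriv (\<lambda>x. ?k x t) z \<partial>pos_lborel) =
        (\<integral>t. (- (1 / c) * exp (- z / c)) * (of_real t powr (?s - 1) * exp (- z * of_real t)) \<partial>pos_lborel)"
    proof (intro Bochner_Integration.integral_cong refl)
      fix t assume "t \<in> space pos_lborel"
      then have nz: "1 + c * of_real t \<noteq> 0" using add_one_mult_neq_0[OF c] by simp
      have e: "exp (- z * (of_real t + 1 / c)) = exp (- z / c) * exp (- z * of_real t)"
        by (simp add: algebra_simps flip: exp_add)
      have "deriv (\<lambda>x. ?k x t) z = of_real t powr (?s - 1) * (- (of_real t + 1 / c) * exp (- z * (of_real t + 1 / c))) / (1 + c * of_real t)"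
        using nz by (intro DERIV_imp_deriv) (auto intro!: derivative_eq_intros)
      also have "\<dots> = (- (1 / c) * exp (- z / c)) * (of_real t powr (?s - 1) * exp (- z * of_real t))"
      proof -
        have tc: "of_real t + 1 / c = (1 + c * of_real t) / c" using c0 by (simp add: field_simps)
        show ?thesis unfolding e unfolding tc using nz c0 by simp
      qed
      finally show "deriv (\<lambda>x. ?k x t) z = (- (1 / c) * exp (- z / c)) * (of_real t powr (?s - 1) * exp (- z * of_real t))" .
    qed
    also have "\<dots> = - (1 / c) * exp (- z / c) * (\<integral>t. of_real t powr (?s - 1) * exp (- z * of_real t) \<partial>pos_lborel)"
      by (rule Bochner_Integration.integral_mult_right_zero)
    also have "(\<integral>t. of_real t powr (?s - 1) * exp (- z * of_real t) \<partial>pos_lborel) = Gamma ?s * z powr (- ?s)"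
      using z s by (intro Gamma_integral_complex_scale) auto
    finally show ?thesis unfolding Q_def .
  qed
  have dR: "(R has_field_derivative - (1 / c) * exp (- z / c) * (Gamma ?s * z powr (- ?s))) (at z)"
    if z: "z \<in> ?U" for z
  proof -
    have z': "z \<notin> \<real>\<^sub>\<le>\<^sub>0" "z \<noteq> 0" using z by (auto simp: complex_nonpos_Reals_iff)
    define D where "D = (\<Sum>n. diffs (\<lambda>k. rGamma ((2 - ?s) + of_nat k)) n * (z / c) ^ n)"
    have dE: "((\<lambda>z. rGamma_series (2 - ?s) (z / c)) has_field_derivative D * (1 / c)) (at z)"
      unfolding D_def by (rule DERIV_chain2[OF rGamma_series_has_derivative]) (use c0 in \<open>auto intro!: derivative_eq_intros\<close>)
    have dP: "((\<lambda>z. z powr (1 - ?s)) has_field_derivative (1 - ?s) * z powr (- ?s)) (at z)"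
      using z' has_field_derivative_powr[OF z'(1), of "1 - ?s"] by simp
    have id: "(z / c) * D + (1 - ?s) * rGamma_series (2 - ?s) (z / c) - (z / c) * rGamma_series (2 - ?s) (z / c) = rGamma (1 - ?s)"
      using rGamma_series_deriv_eq[of "z / c" "2 - ?s"] rGamma_series_rec[of "2 - ?s" "z / c"]
      unfolding D_def[symmetric] by simp
    have zp: "z powr (1 - ?s) = z * z powr (- ?s)"
      using z' by (simp add: powr_diff powr_minus divide_inverse)
    have dX: "((\<lambda>z. exp (- z / c)) has_field_derivative - (1 / c) * exp (- z / c)) (at z)"
      using c0 by (auto intro!: derivative_eq_intros)
    have "(R has_field_derivative - ?P * exp (- z / c) * z powr (- ?s) / c *
       ((z / c) * D + (1 - ?s) * rGamma_series (2 - ?s) (z / c) - (z / c) * rGamma_series (2 - ?s) (z / c))) (at z)"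
      unfolding R_def
      by (rule DERIV_cong[OF DERIV_cmult[OF DERIV_diff[OF DERIV_const DERIV_mult[OF DERIV_cdivide[OF DERIV_mult[OF dX dP]] dE]]]])
         (use c0 in \<open>simp add: zp divide_inverse algebra_simps\<close>)
    also have "- ?P * exp (- z / c) * z powr (- ?s) / c *
       ((z / c) * D + (1 - ?s) * rGamma_series (2 - ?s) (z / c) - (z / c) * rGamma_series (2 - ?s) (z / c)) =
        - (1 / c) * exp (- z / c) * (Gamma ?s * z powr (- ?s))"
    proof -
      have "Gamma (1 - ?s) * rGamma (1 - ?s) = 1"
      proof -
        have "Gamma (1 - ?s) = of_real (Gamma (1 - s))"
          using Gamma_complex_of_real[of "1 - s"] by simp
        moreover have "Gamma (1 - s) > 0" using s by (intro Gamma_real_pos) auto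
        ultimately have "Gamma (1 - ?s) \<noteq> 0" by simp
        then show ?thesis by (simp add: rGamma_inverse_Gamma)
      qed
      then show ?thesis unfolding id P by (simp add: field_simps)
    qed
    finally show ?thesis .
  qed
  have "((\<lambda>z. Q z - R z) has_field_derivative 0) (at z within ?U)" if "z \<in> ?U" for z
    using DERIV_diff[OF dQ[OF that] dR[OF that]] has_field_derivative_at_within by simp
  from has_field_derivative_zero_constant[OF convex_Re_gt this]
  obtain C where C: "\<And>z. z \<in> ?U \<Longrightarrow> Q z - R z = C" by blast
  \<comment> \<open>The constant is read off as z tends to 0 through these positive reals, where
    z^(1 - s) vanishes in the limit because s < 1.\<close>
  define X where "X = (\<lambda>n. complex_of_real (inverse (real (Suc n))))"
  have X: "X \<longlonglongrightarrow> 0" unfolding X_def using tendsto_of_real[OF LIMSEQ_inverse_real_of_nat] by (simp only: of_real_0)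
  have XU: "X n \<in> ?U" for n by (simp add: X_def)
  have Q0: "(\<lambda>n. Q (X n)) \<longlonglongrightarrow> c powr (- ?s) * ?P"
  proof -
    have "(\<lambda>n. \<integral>t. of_real t powr (?s - 1) * exp (- X n * of_real t) / (1 + c * of_real t) \<partial>pos_lborel) \<longlonglongrightarrow>
        (\<integral>t. of_real t powr (?s - 1) / (1 + c * of_real t) \<partial>pos_lborel)"
    proof (rule integral_dominated_convergence[where w = "\<lambda>t. t powr (s - 1) / (1 + t) / d"])
      show "integrable pos_lborel (\<lambda>t. t powr (s - 1) / (1 + t) / d)" by (intro integrable_divide Euler_integral_real(1) s)
      show "(\<lambda>t. of_real t powr (?s - 1) / (1 + c * of_real t)) \<in> borel_measurable pos_lborel"
        by (intro borel_measurable_pos_lborel continuous_on_cauchy_kernel c)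
      show "(\<lambda>t. of_real t powr (?s - 1) * exp (- X n * of_real t) / (1 + c * of_real t)) \<in> borel_measurable pos_lborel" for n
        using add_one_mult_neq_0[OF c] by (intro borel_measurable_pos_lborel continuous_intros) auto
      show "AE t in pos_lborel. (\<lambda>n. of_real t powr (?s - 1) * exp (- X n * of_real t) / (1 + c * of_real t)) \<longlonglongrightarrow> of_real t powr (?s - 1) / (1 + c * of_real t)"
      proof (rule AE_I2)
        fix t
        have "(\<lambda>n. of_real t powr (?s - 1) * exp (- X n * of_real t) / (1 + c * of_real t)) \<longlonglongrightarrow> of_real t powr (?s - 1) * exp (- 0 * of_real t) / (1 + c * of_real t)"
          unfolding divide_inverse by (intro tendsto_intros X)
        then show "(\<lambda>n. of_real t powr (?s - 1) * exp (- X n * of_real t) / (1 + c * of_real t)) \<longlonglongrightarrow> of_real t powr (?s - 1) / (1 + c * of_real t)" by simp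
      qed
      show "AE t in pos_lborel. norm (of_real t powr (?s - 1) * exp (- X n * of_real t) / (1 + c * of_real t)) \<le> t powr (s - 1) / (1 + t) / d" for n
      proof (rule AE_I2)
        fix t assume "t \<in> space pos_lborel"
        then have t: "t > 0" by simp
        have "norm (exp (- X n * of_real t)) \<le> 1" using t by (simp add: X_def)
        then have "norm (of_real t powr (?s - 1) * exp (- X n * of_real t) / (1 + c * of_real t)) \<le> t powr (s - 1) * 1 / (d * (1 + t))"
          unfolding norm_divide norm_mult using t d dc[of t] by (intro frac_le mult_mono) (auto simp: norm_cpow)
        then show "norm (of_real t powr (?s - 1) * exp (- X n * of_real t) / (1 + c * of_real t)) \<le> t powr (s - 1) / (1 + t) / d"
          by (simp add: mult.commute)
      qed
    qed
    moreover have "(\<lambda>n. exp (- X n / c)) \<longlonglongrightarrow> exp (- 0 / c)"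
      using c0 by (intro tendsto_intros X)
    ultimately show ?thesis unfolding Q_eq Euler_integral_slit(2)[OF s c] by (auto dest: tendsto_mult)
  qed
  have R0: "(\<lambda>n. R (X n)) \<longlonglongrightarrow> ?P * (c powr (- ?s) - exp (- 0 / c) * 0 / c * rGamma_series (2 - ?s) (0 / c))"
    unfolding R_def
  proof (intro tendsto_intros X c0 isCont_tendsto_compose[OF DERIV_isCont[OF rGamma_series_has_derivative]])
    have "(\<lambda>n. norm (X n powr (1 - ?s))) = (\<lambda>n. inverse (real (Suc n)) powr (1 - s))"
      unfolding X_def by (subst norm_cpow) auto
    also have "\<dots> \<longlonglongrightarrow> 0"
    proof -
      have "(\<lambda>n. inverse (real (Suc n)) powr (1 - s)) \<longlonglongrightarrow> 0 powr (1 - s)"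
        using s by (intro tendsto_powr2 LIMSEQ_inverse_real_of_nat tendsto_const) auto
      then show ?thesis by simp
    qed
    finally show "(\<lambda>n. X n powr (1 - ?s)) \<longlonglongrightarrow> 0" by (rule tendsto_norm_zero_cancel)
  qed
  have "(\<lambda>n. Q (X n) - R (X n)) \<longlonglongrightarrow> 0"
    using tendsto_diff[OF Q0 R0] by (simp add: mult.commute)
  then have "C = 0" unfolding C[OF XU] by (simp add: LIMSEQ_const_iff)
  then have "Q z = R z" using C[of z] z by simp
  then have "(\<integral>t. of_real t powr (?s - 1) * exp (- z * of_real t) / (1 + c * of_real t) \<partial>pos_lborel) = exp (z / c) * R z"
    unfolding Q_eq by (simp add: exp_minus field_simps)
  also have "exp (z / c) * R z = ?P * (c powr (- ?s) * exp (z / c) - (exp (z / c) * exp (- z / c)) * z powr (1 - ?s) / c * rGamma_series (2 - ?s) (z / c))"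
    unfolding R_def by (simp add: algebra_simps)
  also have "exp (z / c) * exp (- z / c) = 1" by (simp flip: exp_add)
  finally show ?thesis by simp
qed

section \<open>Integrals along tilted rays\<close>

lemma Im_Ln_right_half: "Re b > 0 \<Longrightarrow> \<bar>Im (Ln b)\<bar> < pi / 2"
  using Re_Ln_pos_lt[of b] by (metis less_irrefl zero_complex.sel(1))

lemma powr_ii: "\<i> powr s = exp (s * (\<i> * of_real pi / 2))"
  and powr_minus_ii: "(- \<i>) powr s = exp (- (s * (\<i> * of_real pi / 2)))"
  by (simp_all add: powr_def)

lemma ii_powr_add: "\<i> powr s + (- \<i>) powr s = 2 * cos (of_real pi * s / 2)"
  unfolding powr_ii powr_minus_ii cos_exp_eq by (simp add: mult_ac)

lemma ii_powr_mult:
  assumes "Re b > 0"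
  shows "(\<i> * b) powr s = \<i> powr s * b powr s" "(- \<i> * b) powr s = (- \<i>) powr s * b powr s"
proof -
  have b: "b \<noteq> 0" using assms by auto
  have "Ln (\<i> * b) = Ln \<i> + Ln b"
    using Im_Ln_right_half[OF assms] b by (intro Ln_times_simple) auto
  then show "(\<i> * b) powr s = \<i> powr s * b powr s"
    using b by (simp add: powr_def distrib_left exp_add)
  have L: "Ln (- \<i> * b) = Ln (- \<i>) + Ln b"
    using Im_Ln_right_half[OF assms] b by (intro Ln_times_simple) auto
  show "(- \<i> * b) powr s = (- \<i>) powr s * b powr s"
    using b unfolding powr_def L by (simp add: distrib_left exp_add del: Ln_minus_ii)
qed

text \<open>The three logarithms add up to an imaginary part below 3 pi / 2 in modulus. A product
  with positive real part has positive cosine there, which excludes the range from pi on; the sum is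
  thus the principal logarithm of the product.\<close>

lemma ii_powr_mult3:
  assumes e: "e = \<i> \<or> e = - \<i>" and "Re z > 0" "Re b > 0" and pos: "Re (e * z * b) > 0"
  shows "(e * z * b) powr s = e powr s * z powr s * b powr s"
proof -
  have nz: "z \<noteq> 0" "b \<noteq> 0" "e \<noteq> 0" using assms by auto
  let ?L = "Ln e + Ln z + Ln b"
  have ex: "exp ?L = e * z * b" using nz by (simp add: exp_add)
  have "\<bar>Im ?L\<bar> < 3 * pi / 2"
    using Im_Ln_right_half[OF assms(2)] Im_Ln_right_half[OF assms(3)] e
    by (elim disjE) (simp_all add: abs_if split: if_splits)
  moreover have c: "cos (Im ?L) > 0"
    using pos unfolding ex[symmetric] Re_exp by (simp add: zero_less_mult_iff)
  ultimately have "\<bar>Im ?L\<bar> < pi"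
  proof -
    assume a: "\<bar>Im ?L\<bar> < 3 * pi / 2"
    show ?thesis
    proof (rule ccontr)
      assume "\<not> ?thesis"
      then have "cos (\<bar>Im ?L\<bar> - pi) > 0" using a by (intro cos_gt_zero_pi) auto
      then have "cos \<bar>Im ?L\<bar> < 0" by (simp add: cos_diff)
      with c show False by (simp del: plus_complex.sel)
    qed
  qed
  then have "Ln (e * z * b) = ?L"
    by (intro Ln_unique ex) auto
  then show ?thesis
    using nz by (simp add: powr_def distrib_left exp_add)
qed

lemma power2_not_nonpos_Reals: "Re b > 0 \<Longrightarrow> b\<^sup>2 \<notin> \<real>\<^sub>\<le>\<^sub>0"
  by (auto simp: complex_nonpos_Reals_iff power2_eq_square mult_le_0_iff)

text \<open>Since b^2 is off the nonpositive axis, the linear bound applies to (t / k)^2.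
  Homogeneity makes the constant independent of k, which the later summation over k relies
  on.\<close>

lemma square_sum_bound:
  assumes "Re b > 0"
  obtains d where "d > 0"
    "\<And>k t. k > 0 \<Longrightarrow> d * (k\<^sup>2 + t\<^sup>2) \<le> norm ((complex_of_real k)\<^sup>2 + b\<^sup>2 * (of_real t)\<^sup>2)"
proof -
  obtain d where d: "d > 0" "\<And>x t. x \<in> ball (b\<^sup>2) d \<Longrightarrow> t \<ge> 0 \<Longrightarrow> d * (1 + t) \<le> norm (1 + x * of_real t)"
    using norm_one_plus_mult_bound[OF power2_not_nonpos_Reals[OF assms]] by metis
  have "d * (k\<^sup>2 + t\<^sup>2) \<le> norm ((complex_of_real k)\<^sup>2 + b\<^sup>2 * (of_real t)\<^sup>2)" if k: "k > 0" for k t :: real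
  proof -
    have "d * (k\<^sup>2 + t\<^sup>2) = k\<^sup>2 * (d * (1 + (t / k)\<^sup>2))"
      using k by (simp add: power_divide field_simps)
    also have "\<dots> \<le> k\<^sup>2 * norm (1 + b\<^sup>2 * of_real ((t / k)\<^sup>2))"
      using d(1) by (intro mult_left_mono d(2)) auto
    also have "\<dots> = norm ((of_real k)\<^sup>2 * (1 + b\<^sup>2 * of_real ((t / k)\<^sup>2)))"
      unfolding norm_mult norm_power norm_of_real by simp
    also have "(of_real k)\<^sup>2 * (1 + b\<^sup>2 * of_real ((t / k)\<^sup>2)) = (of_real k)\<^sup>2 + b\<^sup>2 * (of_real t)\<^sup>2"
      using k by (simp add: power_divide field_simps)
    finally show ?thesis .
  qed
  with d(1) show ?thesis by (rule that)
qed

lemma add_one_square_bound: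
  assumes "Re b > 0"
  obtains d where "d > 0" "\<And>t. d * (1 + t\<^sup>2) \<le> norm (1 + b\<^sup>2 * (of_real t)\<^sup>2)"
proof -
  obtain d where "d > 0" "\<And>k t. k > 0 \<Longrightarrow> d * (k\<^sup>2 + t\<^sup>2) \<le> norm ((complex_of_real k)\<^sup>2 + b\<^sup>2 * (of_real t)\<^sup>2)"
    using square_sum_bound[OF assms] by metis
  from this(1) this(2)[of 1] show ?thesis by (intro that[of d]) auto
qed

lemma add_one_square_neq_0:
  assumes "Re b > 0" shows "1 + b\<^sup>2 * (complex_of_real t)\<^sup>2 \<noteq> 0"
proof -
  obtain d where d: "d > 0" "\<And>t. d * (1 + t\<^sup>2) \<le> norm (1 + b\<^sup>2 * (of_real t)\<^sup>2)"
    using add_one_square_bound[OF assms] by metis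
  have "0 < d * (1 + t\<^sup>2)" using d(1) by (intro mult_pos_pos add_pos_nonneg) auto
  with d(2)[of t] show ?thesis by auto
qed

text \<open>With u = b t, the product of b^s and this integral is the Laplace integral of u^(s-1) /
  (1 + u^2) along the ray through b, taken at x / b.\<close>

definition ray_integral :: "complex \<Rightarrow> complex \<Rightarrow> complex \<Rightarrow> complex" where
  "ray_integral s b x =
     (\<integral>t. of_real t powr (s - 1) * exp (- x * of_real t) / (1 + b\<^sup>2 * (of_real t)\<^sup>2) \<partial>pos_lborel)"

lemma continuous_ray_kernel:
  assumes "Re b > 0"
  shows "continuous_on {0<..} (\<lambda>t. complex_of_real t powr (s - 1) * exp (- x * of_real t) / (1 + b\<^sup>2 * (of_real t)\<^sup>2))"
  using add_one_square_neq_0[OF assms] by (intro continuous_intros) auto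

lemma norm_ray_kernel_le:
  assumes d: "d > 0" "\<And>t. d * (1 + t\<^sup>2) \<le> norm (1 + b\<^sup>2 * (of_real t)\<^sup>2)" and t: "t > 0"
  shows "norm (complex_of_real t powr (s - 1) * exp (- x * of_real t) / (1 + b\<^sup>2 * (of_real t)\<^sup>2))
           \<le> t powr (Re s - 1) * exp (- (Re x * t)) / d"
    and "norm (complex_of_real t powr (s - 1) / (1 + b\<^sup>2 * (of_real t)\<^sup>2)) \<le> t powr (Re s - 1) / (1 + t\<^sup>2) / d"
proof -
  have p: "0 < d * (1 + t\<^sup>2)" using d(1) by (intro mult_pos_pos add_pos_nonneg) auto
  have "d \<le> d * (1 + t\<^sup>2)" using d(1) by simp
  also have "\<dots> \<le> norm (1 + b\<^sup>2 * (of_real t)\<^sup>2)" by (rule d)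
  finally have "d \<le> norm (1 + b\<^sup>2 * (of_real t)\<^sup>2)" .
  moreover have "norm (exp (- x * of_real t)) = exp (- (Re x * t))" by (simp add: norm_exp_eq_Re)
  ultimately show "norm (complex_of_real t powr (s - 1) * exp (- x * of_real t) / (1 + b\<^sup>2 * (of_real t)\<^sup>2))
           \<le> t powr (Re s - 1) * exp (- (Re x * t)) / d"
    unfolding norm_divide norm_mult using t d(1) by (intro frac_le) (auto simp: norm_cpow)
  have "norm (complex_of_real t powr (s - 1) / (1 + b\<^sup>2 * (of_real t)\<^sup>2)) \<le> t powr (Re s - 1) / (d * (1 + t\<^sup>2))"
    unfolding norm_divide using t p d(2) by (intro frac_le) (auto simp: norm_cpow)
  then show "norm (complex_of_real t powr (s - 1) / (1 + b\<^sup>2 * (of_real t)\<^sup>2)) \<le> t powr (Re s - 1) / (1 + t\<^sup>2) / d"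
    by (simp add: mult.commute)
qed

lemma integrable_ray_kernel:
  assumes "Re s > 0" "Re b > 0" "Re x > 0"
  shows "integrable pos_lborel (\<lambda>t. complex_of_real t powr (s - 1) * exp (- x * of_real t) / (1 + b\<^sup>2 * (of_real t)\<^sup>2))"
proof -
  obtain d where d: "d > 0" "\<And>t. d * (1 + t\<^sup>2) \<le> norm (1 + b\<^sup>2 * (of_real t)\<^sup>2)"
    using add_one_square_bound[OF assms(2)] by metis
  show ?thesis
    by (rule integrable_pos_lborel_bound[OF integrable_divide[OF Gamma_integral_pos_real(1)[OF assms(1,3)], of d]
          continuous_ray_kernel[OF assms(2)] norm_ray_kernel_le(1)[OF d]])
qed

lemma ray_integral_bound:
  assumes b: "Re b > 0"
  obtains d where "d > 0" "\<And>s x. Re s > 0 \<Longrightarrow> Re x > 0 \<Longrightarrow>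
     norm (ray_integral s b x) \<le> Gamma (Re s) * Re x powr (- Re s) / d"
proof -
  obtain d where d: "d > 0" "\<And>t. d * (1 + t\<^sup>2) \<le> norm (1 + b\<^sup>2 * (of_real t)\<^sup>2)"
    using add_one_square_bound[OF b] by metis
  have "norm (ray_integral s b x) \<le> Gamma (Re s) * Re x powr (- Re s) / d" if "Re s > 0" "Re x > 0" for s x
  proof -
    have i: "integrable pos_lborel (\<lambda>t. t powr (Re s - 1) * exp (- (Re x * t)) / d)"
      by (intro integrable_divide Gamma_integral_pos_real that)
    have "norm (ray_integral s b x) \<le> (\<integral>t. t powr (Re s - 1) * exp (- (Re x * t)) / d \<partial>pos_lborel)"
      unfolding ray_integral_def
      by (rule order_trans[OF integral_norm_bound
            Bochner_Integration.integral_mono[OF integrable_norm[OF integrable_ray_kernel[OF that(1) b that(2)]] i]])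
         (use norm_ray_kernel_le(1)[OF d] in auto)
    also have "\<dots> = Gamma (Re s) * Re x powr (- Re s) / d"
      using Gamma_integral_pos_real(2)[OF that] by simp
    finally show ?thesis .
  qed
  with d(1) that show ?thesis by metis
qed

lemma holomorphic_ray_integral:
  assumes b: "Re b > 0" and x: "Re x > 0"
  shows "(\<lambda>s. ray_integral s b x) holomorphic_on {s. 0 < Re s}"
  unfolding ray_integral_def
proof (rule holomorphic_on_integral_param[OF open_Re_gt])
  obtain d where d: "d > 0" "\<And>t. d * (1 + t\<^sup>2) \<le> norm (1 + b\<^sup>2 * (of_real t)\<^sup>2)"
    using add_one_square_bound[OF b] by metis
  fix s assume s: "s \<in> {s. 0 < Re s}"
  \<comment> \<open>With Re s = 2 r, the disc of radius r keeps all real parts between r and 3 r,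
    the two exponents in \<open>B\<close>.\<close>
  define r where "r = Re s / 2"
  define B where "B = (\<lambda>t. (t powr (r - 1) * exp (- (Re x * t)) + t powr (3 * r - 1) * exp (- (Re x * t))) / d)"
  have r: "r > 0" "Re s = 2 * r" using s by (auto simp: r_def)
  have "integrable pos_lborel B"
    unfolding B_def using r x
    by (intro integrable_divide Bochner_Integration.integrable_add Gamma_integral_pos_real) auto
  moreover have "norm (complex_of_real t powr (u - 1) * exp (- x * of_real t) / (1 + b\<^sup>2 * (of_real t)\<^sup>2)) \<le> B t"
    if "u \<in> ball s r" "t > 0" for u t
  proof -
    have "t powr (Re u - 1) \<le> t powr (r - 1) + t powr (3 * r - 1)"
      using Re_dist_less[OF that(1)] r that(2) by (intro powr_le_powr_add) (auto simp: abs_if split: if_splits)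
    then have "t powr (Re u - 1) * exp (- (Re x * t)) \<le> (t powr (r - 1) + t powr (3 * r - 1)) * exp (- (Re x * t))"
      by (intro mult_right_mono) auto
    then have "t powr (Re u - 1) * exp (- (Re x * t)) / d \<le> B t"
      unfolding B_def using d(1) by (intro divide_right_mono) (auto simp: distrib_right)
    with norm_ray_kernel_le(1)[OF d that(2), of u x] show ?thesis by linarith
  qed
  ultimately show "\<exists>r>0. \<exists>B. integrable pos_lborel B \<and>
      (\<forall>u\<in>ball s r \<inter> {s. 0 < Re s}. \<forall>t\<in>space pos_lborel.
         norm (complex_of_real t powr (u - 1) * exp (- x * of_real t) / (1 + b\<^sup>2 * (of_real t)\<^sup>2)) \<le> B t)"
    using r(1) by (intro exI[of _ r] conjI exI[of _ B]) auto
next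
  fix t assume "t \<in> space pos_lborel"
  then show "(\<lambda>s. complex_of_real t powr (s - 1) * exp (- x * of_real t) / (1 + b\<^sup>2 * (of_real t)\<^sup>2)) holomorphic_on {s. 0 < Re s}"
    using add_one_square_neq_0[OF b] by (intro holomorphic_intros) auto
next
  show "(\<lambda>t. complex_of_real t powr (s - 1) * exp (- x * of_real t) / (1 + b\<^sup>2 * (of_real t)\<^sup>2)) \<in> borel_measurable pos_lborel" for s
    by (intro borel_measurable_pos_lborel continuous_ray_kernel b)
qed

section \<open>The Beta integral with a tilted quadratic kernel\<close>

lemma integrable_Beta_real:
  fixes s :: real
  assumes s: "0 < s" "s < 2"
  shows "integrable pos_lborel (\<lambda>t. t powr (s - 1) / (1 + t\<^sup>2))"
proof -
  \<comment> \<open>Two exponents in (0, 1) for Euler's integrand: a <= s serves t <= 1, and b >= s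
    - 1 serves t > 1, where 1 + t^2 >= t (1 + t) / 2.\<close>
  define a where "a = min s 1 / 2"
  define b where "b = s / 2"
  have a: "0 < a" "a < 1" "0 < b" "b < 1" "a \<le> s" "b \<ge> s - 1" using s by (auto simp: a_def b_def)
  have "integrable pos_lborel (\<lambda>t. 2 * (t powr (a - 1) / (1 + t)) + 2 * (t powr (b - 1) / (1 + t)))"
    by (intro Bochner_Integration.integrable_add integrable_mult_right Euler_integral_real a)
  then show ?thesis
  proof (rule integrable_pos_lborel_bound)
    show "continuous_on {0<..} (\<lambda>t. t powr (s - 1) / (1 + t\<^sup>2))"
      by (intro continuous_intros) (auto simp: add_nonneg_eq_0_iff)
    fix t :: real assume t: "t > 0"
    have "t powr (s - 1) / (1 + t\<^sup>2) \<le> 2 * (t powr (a - 1) / (1 + t)) + 2 * (t powr (b - 1) / (1 + t))"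
    proof (cases "t \<le> 1")
      case True
      have "t powr (s - 1) / (1 + t\<^sup>2) \<le> t powr (a - 1) / ((1 + t) / 2)"
        using True t a zero_le_power2[of t] by (intro frac_le powr_mono') (auto intro: order_trans[of _ 1])
      also have "\<dots> = 2 * (t powr (a - 1) / (1 + t))" by simp
      also have "\<dots> \<le> 2 * (t powr (a - 1) / (1 + t)) + 2 * (t powr (b - 1) / (1 + t))" using t by simp
      finally show ?thesis .
    next
      case False
      have "t powr (s - 1) / (1 + t\<^sup>2) \<le> t powr b / (t * (1 + t) / 2)"
      proof (rule frac_le)
        show "0 < t * (1 + t) / 2" using t by simp
        have "t * 1 \<le> t * t" using False t by (intro mult_left_mono) auto
        then show "t * (1 + t) / 2 \<le> 1 + t\<^sup>2" by (simp add: power2_eq_square algebra_simps)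
      qed (use False a in \<open>auto intro!: powr_mono\<close>)
      also have "\<dots> = 2 * (t powr (b - 1) / (1 + t))"
        using t by (simp add: powr_diff)
      finally show ?thesis using t by (simp add: add_increasing)
    qed
    then show "norm (t powr (s - 1) / (1 + t\<^sup>2)) \<le> 2 * (t powr (a - 1) / (1 + t)) + 2 * (t powr (b - 1) / (1 + t))"
      using t by simp
  qed
qed

lemma continuous_Beta_kernel:
  assumes "Re b > 0"
  shows "continuous_on {0<..} (\<lambda>t. complex_of_real t powr (s - 1) / (1 + b\<^sup>2 * (of_real t)\<^sup>2))"
  using add_one_square_neq_0[OF assms] by (intro continuous_intros) auto

lemma partial_fraction_ii:
  fixes b :: complex
  assumes "1 + b\<^sup>2 * t\<^sup>2 \<noteq> 0"
  shows "1 / (1 + b\<^sup>2 * t\<^sup>2) = (1 / (1 + (\<i> * b) * t) + 1 / (1 + (- \<i> * b) * t)) / 2"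
proof -
  have f: "1 + b\<^sup>2 * t\<^sup>2 = (1 + (\<i> * b) * t) * (1 + (- \<i> * b) * t)"
    by (simp add: algebra_simps power2_eq_square)
  with assms have "1 + (\<i> * b) * t \<noteq> 0" "1 + (- \<i> * b) * t \<noteq> 0" by auto
  then have "1 / (1 + (\<i> * b) * t) + 1 / (1 + (- \<i> * b) * t) =
      ((1 + (\<i> * b) * t) + (1 + (- \<i> * b) * t)) / ((1 + (\<i> * b) * t) * (1 + (- \<i> * b) * t))"
    by (simp add: add_frac_eq add_ac)
  also have "(1 + (\<i> * b) * t) + (1 + (- \<i> * b) * t) = 2" by simp
  finally show ?thesis unfolding f by simp
qed

lemma ii_mult_not_nonpos_Reals:
  "Re b > 0 \<Longrightarrow> \<i> * b \<notin> \<real>\<^sub>\<le>\<^sub>0" "Re b > 0 \<Longrightarrow> - \<i> * b \<notin> \<real>\<^sub>\<le>\<^sub>0"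
  by (auto simp: complex_nonpos_Reals_iff)

lemma pi_over_sin_mult_cos:
  fixes s :: real assumes "0 < s" "s < 1"
  shows "of_real (pi / sin (pi * s)) * cos (complex_of_real pi * of_real s / 2) =
     of_real pi / (2 * sin (complex_of_real pi * of_real s / 2))"
proof -
  have "sin (pi * s / 2) > 0" "cos (pi * s / 2) > 0"
    using assms by (intro sin_gt_zero cos_gt_zero; auto simp: field_simps)+
  moreover have "sin (pi * s) = 2 * sin (pi * s / 2) * cos (pi * s / 2)"
    using sin_double[of "pi * s / 2"] by simp
  ultimately have "pi / sin (pi * s) * cos (pi * s / 2) = pi / (2 * sin (pi * s / 2))"
    by simp
  then have "complex_of_real (pi / sin (pi * s) * cos (pi * s / 2)) = of_real (pi / (2 * sin (pi * s / 2)))"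
    by simp
  then show ?thesis by (simp flip: sin_of_real cos_of_real)
qed

lemma complex_sin_half_neq_0:
  assumes "0 < Re s" "Re s < 2" shows "sin (of_real pi * s / 2) \<noteq> 0"
proof
  assume "sin (of_real pi * s / 2) = 0"
  then obtain n :: int where n: "of_real pi * s / 2 = of_real (n * pi)" by (auto simp: sin_eq_0)
  then have "s = of_real (2 * of_int n)" by (simp add: field_simps)
  then have "Re s = 2 * of_int n" by simp
  with assms have "0 < n" "n < 1" by auto
  then show False by linarith
qed

text \<open>For real s in (0, 1), partial fractions reduce to Euler's integral at c = i b and c = -i
  b. The two pieces diverge separately once Re s >= 1, so the rest of the strip is reached by
  holomorphy in s.\<close>

lemma Beta_integral_right_half:
  assumes s: "0 < Re s" "Re s < 2" and b: "Re b > 0"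
  shows "integrable pos_lborel (\<lambda>t. of_real t powr (s - 1) / (1 + b\<^sup>2 * (of_real t)\<^sup>2))"
    and "(\<integral>t. of_real t powr (s - 1) / (1 + b\<^sup>2 * (of_real t)\<^sup>2) \<partial>pos_lborel) =
           b powr (- s) * (of_real pi / (2 * sin (of_real pi * s / 2)))"
proof -
  let ?k = "\<lambda>s t. of_real t powr (s - 1) / (1 + b\<^sup>2 * (of_real t)\<^sup>2) :: complex"
  let ?U = "{s. 0 < Re s} \<inter> {s. Re s < 2}"
  obtain d where d: "d > 0" "\<And>t. d * (1 + t\<^sup>2) \<le> norm (1 + b\<^sup>2 * (of_real t)\<^sup>2)"
    using add_one_square_bound[OF b] by metis
  show "integrable pos_lborel (?k s)"
    by (rule integrable_pos_lborel_bound[OF integrable_divide[OF integrable_Beta_real[OF s], of d]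
          continuous_Beta_kernel[OF b] norm_ray_kernel_le(2)[OF d]])
  have opn: "open ?U" by (intro open_Int open_Re_gt open_Re_lt)
  have "(\<lambda>s. \<integral>t. ?k s t \<partial>pos_lborel) holomorphic_on ?U"
  proof (rule holomorphic_on_integral_param[OF opn])
    fix s assume s: "s \<in> ?U"
    define r where "r = min (Re s) (2 - Re s) / 2"
    define B where "B = (\<lambda>t. (t powr ((Re s - r) - 1) / (1 + t\<^sup>2) + t powr ((Re s + r) - 1) / (1 + t\<^sup>2)) / d)"
    have r: "r > 0" "Re s - r > 0" "Re s + r < 2" "Re s - r < 2" "Re s + r > 0"
    proof -
      have "r \<le> Re s / 2" "r \<le> (2 - Re s) / 2" "0 < r" using s by (auto simp: r_def)
      with s show "r > 0" "Re s - r > 0" "Re s + r < 2" "Re s - r < 2" "Re s + r > 0" by auto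
    qed
    have "integrable pos_lborel B"
      unfolding B_def using r
      by (intro integrable_divide Bochner_Integration.integrable_add integrable_Beta_real) auto
    moreover have "norm (?k u t) \<le> B t" if "u \<in> ball s r" "t > 0" for u t
    proof -
      have "t powr (Re u - 1) \<le> t powr ((Re s - r) - 1) + t powr ((Re s + r) - 1)"
        using Re_dist_less[OF that(1)] r that(2) by (intro powr_le_powr_add) (auto simp: abs_if split: if_splits)
      then have "t powr (Re u - 1) / (1 + t\<^sup>2) \<le> (t powr ((Re s - r) - 1) + t powr ((Re s + r) - 1)) / (1 + t\<^sup>2)"
        by (intro divide_right_mono) auto
      then have "t powr (Re u - 1) / (1 + t\<^sup>2) / d \<le> B t"
        unfolding B_def using d(1) by (intro divide_right_mono) (auto simp: add_divide_distrib)
      with norm_ray_kernel_le(2)[OF d that(2), of u] show ?thesis by linarith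
    qed
    ultimately show "\<exists>r>0. \<exists>B. integrable pos_lborel B \<and>
        (\<forall>u\<in>ball s r \<inter> ?U. \<forall>t\<in>space pos_lborel. norm (?k u t) \<le> B t)"
      using r(1) by (intro exI[of _ r] conjI exI[of _ B]) auto
  next
    fix t assume "t \<in> space pos_lborel"
    then show "(\<lambda>s. ?k s t) holomorphic_on ?U"
      using add_one_square_neq_0[OF b] by (intro holomorphic_intros) auto
  next
    show "?k s \<in> borel_measurable pos_lborel" for s
      by (intro borel_measurable_pos_lborel continuous_Beta_kernel b)
  qed
  then show "(\<integral>t. ?k s t \<partial>pos_lborel) = b powr (- s) * (of_real pi / (2 * sin (of_real pi * s / 2)))"
  proof (rule holomorphic_eq_on_real_segment[where a = 0 and b = 1])
    show "(\<lambda>s. b powr - s * (of_real pi / (2 * sin (of_real pi * s / 2)))) holomorphic_on ?U"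
      using complex_sin_half_neq_0 b by (intro holomorphic_intros) auto
    show "connected ?U" by (intro convex_connected convex_Int convex_Re_gt convex_Re_lt)
    fix q :: real assume q: "0 < q" "q < 1"
    let ?q = "complex_of_real q"
    let ?f = "\<lambda>c t. of_real t powr (?q - 1) / (1 + c * of_real t) :: complex"
    note nz = ii_mult_not_nonpos_Reals[OF b]
    have "(\<integral>t. ?k ?q t \<partial>pos_lborel) = (\<integral>t. (?f (\<i> * b) t + ?f (- \<i> * b) t) / 2 \<partial>pos_lborel)"
    proof (intro Bochner_Integration.integral_cong refl)
      fix t :: real
      have "?k ?q t = of_real t powr (?q - 1) * (1 / (1 + b\<^sup>2 * (of_real t)\<^sup>2))" by simp
      also have "\<dots> = (?f (\<i> * b) t + ?f (- \<i> * b) t) / 2"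
        unfolding partial_fraction_ii[OF add_one_square_neq_0[OF b]] by (simp add: add_divide_distrib distrib_left)
      finally show "?k ?q t = (?f (\<i> * b) t + ?f (- \<i> * b) t) / 2" .
    qed
    also have "\<dots> = ((\<integral>t. ?f (\<i> * b) t \<partial>pos_lborel) + (\<integral>t. ?f (- \<i> * b) t \<partial>pos_lborel)) / 2"
      by (simp only: integral_divide_zero Bochner_Integration.integral_add[OF Euler_integral_slit(1)[OF q nz(1)] Euler_integral_slit(1)[OF q nz(2)]])
    also have "\<dots> = b powr (- ?q) * (of_real (pi / sin (pi * q)) * ((\<i> powr (- ?q) + (- \<i>) powr (- ?q)) / 2))"
      unfolding Euler_integral_slit(2)[OF q nz(1)] Euler_integral_slit(2)[OF q nz(2)] ii_powr_mult[OF b]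
      by (simp add: algebra_simps add_divide_distrib)
    also have "\<dots> = b powr (- ?q) * (of_real pi / (2 * sin (of_real pi * ?q / 2)))"
      unfolding ii_powr_add pi_over_sin_mult_cos[OF q, symmetric] by simp
    finally show "?q \<in> ?U \<and> (\<integral>t. ?k ?q t \<partial>pos_lborel) = b powr (- ?q) * (of_real pi / (2 * sin (of_real pi * ?q / 2)))"
      using q by simp
  qed (use s opn in auto)
qed

text \<open>The sign of e tells the upper ray from the lower one. With Laplace variable x = -e z b
  the arguments x / (e b) and x / (-e b) are -z and z, so b drops out of the result: this is the
  invariance under rotation of the ray, obtained by evaluation.\<close>

lemma ray_integral_eq_real:
  fixes q :: real
  assumes q: "0 < q" "q < 1" and e: "e = \<i> \<or> e = - \<i>" and z: "Re z > 0" and b: "Re b > 0"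
    and pos: "Re (- e * z * b) > 0"
  defines "s \<equiv> complex_of_real q"
  shows "b powr s * ray_integral s b (- e * z * b) = of_real (pi / sin (pi * q)) *
     ((e powr s * exp z + e powr (- s) * exp (- z)) / 2 -
      e powr s * z powr (1 - s) * (rGamma_series (2 - s) z - rGamma_series (2 - s) (- z)) / 2)"
proof -
  define x where "x = - e * z * b"
  have nz: "z \<noteq> 0" "b \<noteq> 0" "e \<noteq> 0" "x \<noteq> 0" using z b e pos by (auto simp: x_def)
  have e': "- e = \<i> \<or> - e = - \<i>" using e by auto
  let ?P = "complex_of_real (pi / sin (pi * q))"
  let ?K = "\<lambda>c t. of_real t powr (s - 1) * exp (- x * of_real t) / (1 + c * of_real t) :: complex"
  have c1: "e * b \<notin> \<real>\<^sub>\<le>\<^sub>0" and c2: "- e * b \<notin> \<real>\<^sub>\<le>\<^sub>0"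
    using e ii_mult_not_nonpos_Reals[OF b] by auto
  have x: "Re x > 0" using pos by (simp only: x_def)
  have pw: "(e * b) powr u = e powr u * b powr u" "(- e * b) powr u = (- e) powr u * b powr u" for u
    using e ii_powr_mult[OF b, of u] by auto
  have neg: "(- e) powr u = e powr (- u)" for u
    using e by (auto simp: powr_ii powr_minus_ii)
  have "ray_integral s b x = (\<integral>t. (?K (e * b) t + ?K (- e * b) t) / 2 \<partial>pos_lborel)"
    unfolding ray_integral_def
  proof (intro Bochner_Integration.integral_cong refl)
    fix t :: real
    have eq: "1 / (1 + b\<^sup>2 * (of_real t)\<^sup>2) = (1 / (1 + (e * b) * of_real t) + 1 / (1 + (- e * b) * of_real t)) / 2"
      using e partial_fraction_ii[OF add_one_square_neq_0[OF b, of t]] by (elim disjE) (simp_all add: add.commute)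
    have "of_real t powr (s - 1) * exp (- x * of_real t) * (1 / (1 + b\<^sup>2 * (of_real t)\<^sup>2)) =
        of_real t powr (s - 1) * exp (- x * of_real t) * ((1 / (1 + (e * b) * of_real t) + 1 / (1 + (- e * b) * of_real t)) / 2)"
      by (simp only: eq)
    moreover have "A * ((1 / u + 1 / v) / 2) = (A / u + A / v) / 2" for A u v :: complex
      by (simp add: distrib_left add_divide_distrib)
    ultimately show "of_real t powr (s - 1) * exp (- x * of_real t) / (1 + b\<^sup>2 * (of_real t)\<^sup>2) = (?K (e * b) t + ?K (- e * b) t) / 2"
      by (simp only: times_divide_eq_right mult_1_right)
  qed
  also have "\<dots> = ((\<integral>t. ?K (e * b) t \<partial>pos_lborel) + (\<integral>t. ?K (- e * b) t \<partial>pos_lborel)) / 2"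
  proof -
    have "Re s > 0" using q by (simp add: s_def)
    then show ?thesis
      by (simp only: integral_divide_zero Bochner_Integration.integral_add[OF cauchy_laplace_kernel[OF _ c1 x] cauchy_laplace_kernel[OF _ c2 x]])
  qed
  also have "(\<integral>t. ?K (e * b) t \<partial>pos_lborel) =
      ?P * ((e * b) powr (- s) * exp (x / (e * b)) - x powr (1 - s) / (e * b) * rGamma_series (2 - s) (x / (e * b)))"
    unfolding s_def by (rule cauchy_laplace_integral[OF q c1 x])
  also have "x / (e * b) = - z" using nz by (simp add: x_def)
  also have "(\<integral>t. ?K (- e * b) t \<partial>pos_lborel) =
      ?P * ((- e * b) powr (- s) * exp (x / (- e * b)) - x powr (1 - s) / (- e * b) * rGamma_series (2 - s) (x / (- e * b)))"
    unfolding s_def by (rule cauchy_laplace_integral[OF q c2 x])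
  also have "x / (- e * b) = z" using nz by (simp add: x_def)
  also have "(e * b) powr (- s) = e powr (- s) * b powr (- s)" by (rule pw)
  also have "(- e * b) powr (- s) = e powr s * b powr (- s)" using pw(2)[of "- s"] neg[of "- s"] by simp
  also have "x powr (1 - s) / (e * b) = - (e powr s * z powr (1 - s) * b powr (- s))"
  proof -
    have "x powr (1 - s) = x * x powr (- s)" using nz by (simp add: powr_diff powr_minus divide_inverse)
    also have "x powr (- s) = e powr s * z powr (- s) * b powr (- s)"
      unfolding x_def using ii_powr_mult3[OF e' z b pos, of "- s"] neg[of "- s"] by simp
    finally show ?thesis using nz by (simp add: x_def powr_diff powr_minus field_simps)
  qed
  also have "x powr (1 - s) / (- e * b) = e powr s * z powr (1 - s) * b powr (- s)"
  proof -
    have "x powr (1 - s) = x * x powr (- s)" using nz by (simp add: powr_diff powr_minus divide_inverse)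
    also have "x powr (- s) = e powr s * z powr (- s) * b powr (- s)"
      unfolding x_def using ii_powr_mult3[OF e' z b pos, of "- s"] neg[of "- s"] by simp
    finally show ?thesis using nz by (simp add: x_def powr_diff powr_minus field_simps)
  qed
  finally have "ray_integral s b x = b powr (- s) * (?P * ((e powr s * exp z + e powr (- s) * exp (- z)) / 2 -
      e powr s * z powr (1 - s) * (rGamma_series (2 - s) z - rGamma_series (2 - s) (- z)) / 2))"
    by (simp add: algebra_simps add_divide_distrib diff_divide_distrib)
  moreover have "b powr s * b powr (- s) = 1" using nz by (simp add: powr_minus)
  ultimately show ?thesis unfolding x_def[symmetric] by (metis mult.assoc mult_1)
qed

text \<open>The path of integration of the Laplace integral is tilted by \<open>\<epsilon>\<close> away from
  the imaginary axis in both directions: this avoids the poles \<open>\<plusminus>\<i>\<close> of the kernel, and on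
  \<open>wedge \<epsilon>\<close> below both exponentials still decay.\<close>

definition wedge_integral :: "real \<Rightarrow> complex \<Rightarrow> complex \<Rightarrow> complex" where
  "wedge_integral \<epsilon> s z =
     ((of_real \<epsilon> + \<i>) powr s * ray_integral s (of_real \<epsilon> + \<i>) (z * (1 - \<i> * of_real \<epsilon>)) +
      (of_real \<epsilon> - \<i>) powr s * ray_integral s (of_real \<epsilon> - \<i>) (z * (1 + \<i> * of_real \<epsilon>))) / of_real pi"

definition wedge :: "real \<Rightarrow> complex set" where
  "wedge \<epsilon> = {z. 0 < Re (z * (1 - \<i> * of_real \<epsilon>)) \<and> 0 < Re (z * (1 + \<i> * of_real \<epsilon>))}"

lemma wedge_Re_pos: "z \<in> wedge \<epsilon> \<Longrightarrow> Re z > 0"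
  by (auto simp: wedge_def)

lemma wedge_exists:
  assumes "Re z > 0" obtains \<epsilon> where "\<epsilon> > 0" "z \<in> wedge \<epsilon>"
proof -
  \<comment> \<open>The two real parts in \<open>wedge\<close> are Re z + e Im z and Re z - e Im z,
    and this choice gives e |Im z| < Re z / 2.\<close>
  define e where "e = Re z / (2 * (1 + \<bar>Im z\<bar>))"
  have e: "e > 0" using assms by (simp add: e_def add_pos_nonneg)
  have "e * (2 * (1 + \<bar>Im z\<bar>)) = Re z" unfolding e_def by (simp add: add_pos_nonneg less_imp_neq[symmetric])
  then have "2 * (e * \<bar>Im z\<bar>) + 2 * e = Re z" by (simp add: algebra_simps)
  then have "2 * \<bar>e * Im z\<bar> < Re z" using e by (simp add: abs_mult)
  then have "z \<in> wedge e" using assms by (auto simp: wedge_def abs_le_iff mult.commute)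
  with e show ?thesis by (rule that)
qed

lemma wedge_scale: "z \<in> wedge \<epsilon> \<Longrightarrow> r > 0 \<Longrightarrow> of_real r * z \<in> wedge \<epsilon>"
proof -
  have "Re (of_real r * z * w) = r * Re (z * w)" for w
    by (simp add: algebra_simps)
  then show "z \<in> wedge \<epsilon> \<Longrightarrow> r > 0 \<Longrightarrow> of_real r * z \<in> wedge \<epsilon>"
    unfolding wedge_def by (simp del: times_complex.sel)
qed

lemma holomorphic_wedge_integral:
  assumes "\<epsilon> > 0" "z \<in> wedge \<epsilon>"
  shows "(\<lambda>s. wedge_integral \<epsilon> s z) holomorphic_on {s. 0 < Re s}"
proof -
  have "of_real \<epsilon> + \<i> \<noteq> 0" "of_real \<epsilon> - \<i> \<noteq> 0" using assms(1) by (auto simp: complex_eq_iff)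
  then show ?thesis
    unfolding wedge_integral_def
    using assms by (intro holomorphic_intros holomorphic_ray_integral) (auto simp: wedge_def)
qed

lemma holomorphic_rGamma_series: "(\<lambda>b. rGamma_series b x) holomorphic_on UNIV"
  unfolding rGamma_series_def
proof (rule holomorphic_on_suminf)
  fix b :: complex
  obtain C where C: "\<forall>n. \<forall>c\<in>cball (0::complex) (norm b + 1). norm (rGamma (c + of_nat n)) \<le> C * 2 ^ n / fact n"
    using rGamma_shift_bound by blast
  have s: "summable (\<lambda>k. C * ((2 * norm x) ^ k / fact k))"
    using summable_exp[of "2 * norm x"] by (intro summable_mult) (simp add: divide_inverse mult_ac)
  have "norm (rGamma (c + of_nat k) * x ^ k) \<le> C * ((2 * norm x) ^ k / fact k)" if "c \<in> ball b 1" for c k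
  proof -
    have "norm c \<le> norm b + 1" using that norm_triangle_ineq2[of c b] by (auto simp: dist_norm norm_minus_commute)
    then have "norm (rGamma (c + of_nat k)) \<le> C * 2 ^ k / fact k" using C by auto
    then have "norm (rGamma (c + of_nat k) * x ^ k) \<le> C * 2 ^ k / fact k * norm x ^ k"
      unfolding norm_mult norm_power by (intro mult_right_mono) auto
    then show ?thesis by (simp add: power_mult_distrib)
  qed
  with s show "\<exists>d>0. \<exists>M. summable M \<and> (\<forall>n. \<forall>c\<in>ball b d \<inter> UNIV. norm (rGamma (c + of_nat n) * x ^ n) \<le> M n)"
    by (intro exI[of _ 1] conjI exI[of _ "\<lambda>k. C * ((2 * norm x) ^ k / fact k)"]) auto
qed (auto intro!: holomorphic_intros)

text \<open>The difference of \<open>z powr (2 - s)\<close> times the even series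
  \<open>\<Sum>j. rGamma (2 * j + 3 - s) * z ^ (2 * j)\<close> and \<open>cosh z\<close>, which is
  what the two \<open>1F2\<close> functions of the Bessel kernel become for \<open>\<mu> = 1/2\<close> and
  \<open>w = 0\<close>.\<close>

definition even_remainder :: "complex \<Rightarrow> complex \<Rightarrow> complex" where
  "even_remainder s z = z powr (1 - s) * (rGamma_series (2 - s) z - rGamma_series (2 - s) (- z)) / 2 - cosh z"

text \<open>For real s in (0, 1) the evaluations along both rays are added; their weights i^s and
  (-i)^s assemble exp z and exp(-z) into cosh z. Everything is holomorphic for Re s > 0. An
  exponentially large difference is thereby replaced by a decaying integral, with an explicit sine
  factor.\<close>

lemma even_remainder_eq_wedge_integral:
  assumes \<epsilon>: "\<epsilon> > 0" and z: "z \<in> wedge \<epsilon>" and s: "Re s > 0"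
  shows "even_remainder s z = - sin (of_real pi * s / 2) * wedge_integral \<epsilon> s z"
proof (rule holomorphic_eq_on_real_segment[where a = 0 and b = 1 and S = "{s. 0 < Re s}" and w = s and
      f = "\<lambda>s. even_remainder s z" and g = "\<lambda>s. - sin (of_real pi * s / 2) * wedge_integral \<epsilon> s z"])
  have z0: "z \<noteq> 0" using wedge_Re_pos[OF z] by auto
  have "(\<lambda>s. rGamma_series (2 - s) x) holomorphic_on {s. 0 < Re s}" for x
    by (rule holomorphic_on_compose_gen[OF _ holomorphic_rGamma_series, of "\<lambda>s. 2 - s", unfolded o_def])
       (auto intro!: holomorphic_intros)
  then show "(\<lambda>s. even_remainder s z) holomorphic_on {s. 0 < Re s}"
    unfolding even_remainder_def using z0 by (intro holomorphic_intros) auto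
  show "(\<lambda>s. - sin (of_real pi * s / 2) * wedge_integral \<epsilon> s z) holomorphic_on {s. 0 < Re s}"
    by (intro holomorphic_intros holomorphic_wedge_integral \<epsilon> z) auto
  fix q :: real assume q: "0 < q" "q < 1"
  let ?s = "complex_of_real q"
  let ?P = "complex_of_real (pi / sin (pi * q))"
  let ?D = "z powr (1 - ?s) * (rGamma_series (2 - ?s) z - rGamma_series (2 - ?s) (- z)) / 2"
  have b: "Re (of_real \<epsilon> + \<i>) > 0" "Re (of_real \<epsilon> - \<i>) > 0" using \<epsilon> by auto
  have x: "- \<i> * z * (of_real \<epsilon> + \<i>) = z * (1 - \<i> * of_real \<epsilon>)" "- (- \<i>) * z * (of_real \<epsilon> - \<i>) = z * (1 + \<i> * of_real \<epsilon>)"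
    by (simp_all add: algebra_simps)
  \<comment> \<open>The powers add up to 2 cos(pi s / 2), which turns pi / sin(pi s) into pi /
    sin(pi s / 2); the sine and the division by pi in \<open>wedge_integral\<close> then leave
    -1.\<close>
  have m: "- sin (of_real pi * ?s / 2) * (1 / of_real pi * ?P * (\<i> powr ?s + (- \<i>) powr ?s)) = - 1"
  proof -
    have "sin (of_real pi * ?s / 2) \<noteq> 0" using q by (intro complex_sin_half_neq_0) auto
    moreover have "- S * (1 / p * P * (2 * C)) = - (2 * S / p) * (P * C)" for S p P C :: complex
      by simp
    ultimately show ?thesis
      unfolding ii_powr_add by (simp only: pi_over_sin_mult_cos[OF q]) simp
  qed
  have "wedge_integral \<epsilon> ?s z = (?P * ((\<i> powr ?s * exp z + \<i> powr (- ?s) * exp (- z)) / 2 - \<i> powr ?s * z powr (1 - ?s) * (rGamma_series (2 - ?s) z - rGamma_series (2 - ?s) (- z)) / 2)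
     + ?P * (((- \<i>) powr ?s * exp z + (- \<i>) powr (- ?s) * exp (- z)) / 2 - (- \<i>) powr ?s * z powr (1 - ?s) * (rGamma_series (2 - ?s) z - rGamma_series (2 - ?s) (- z)) / 2)) / of_real pi"
    unfolding wedge_integral_def x[symmetric]
    using ray_integral_eq_real[OF q, of "\<i>" z "of_real \<epsilon> + \<i>"] ray_integral_eq_real[OF q, of "- \<i>" z "of_real \<epsilon> - \<i>"]
      z b wedge_Re_pos[OF z] unfolding x wedge_def by auto
  also have "\<i> powr (- ?s) = (- \<i>) powr ?s" by (simp only: powr_ii powr_minus_ii mult_minus_left)
  also have "(- \<i>) powr (- ?s) = \<i> powr ?s" by (simp only: powr_ii powr_minus_ii mult_minus_left minus_minus)
  finally have W: "wedge_integral \<epsilon> ?s z = 1 / of_real pi * ?P * (\<i> powr ?s + (- \<i>) powr ?s) * (cosh z - ?D)"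
    by (simp add: cosh_field_def algebra_simps add_divide_distrib diff_divide_distrib)
  have "- sin (of_real pi * ?s / 2) * wedge_integral \<epsilon> ?s z =
      (- sin (of_real pi * ?s / 2) * (1 / of_real pi * ?P * (\<i> powr ?s + (- \<i>) powr ?s))) * (cosh z - ?D)"
    unfolding W by (simp only: mult.assoc)
  also have "\<dots> = even_remainder ?s z" unfolding m even_remainder_def by simp
  finally show "?s \<in> {s. 0 < Re s} \<and> even_remainder ?s z = - sin (of_real pi * ?s / 2) * wedge_integral \<epsilon> ?s z"
    using q by simp
next
  show "connected {s. 0 < Re s}" by (intro convex_connected convex_Re_gt)
qed (use s in \<open>auto intro: open_Re_gt\<close>)

text \<open>The odd part of \<open>rGamma_series\<close> at parameter -s has exactly one term more,
  at the front, than at 2 - s. Such terms are what the sum A_m removes from the Bessel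
  kernel.\<close>

lemma even_remainder_rec:
  assumes "z \<noteq> 0"
  shows "even_remainder (s + 2) z = even_remainder s z + z powr (- s) * rGamma (1 - s)"
proof -
  have E: "rGamma_series (- s) x = rGamma (- s) + x * (rGamma (1 - s) + x * rGamma_series (2 - s) x)" for x
    using rGamma_series_rec[of "1 - s" x] rGamma_series_rec[of "2 - s" x] by simp
  have p: "z powr (1 - (s + 2)) = z powr (- s) / z" "z powr (1 - s) = z * z powr (- s)"
    using assms by (simp_all add: powr_diff powr_add powr_minus field_simps power2_eq_square)
  have "2 - (s + 2) = - s" by simp
  then show ?thesis
    unfolding even_remainder_def by (simp only: p E) (use assms in \<open>simp add: field_simps power2_eq_square\<close>)
qed

lemma even_remainder_shift:
  assumes "z \<noteq> 0"
  shows "even_remainder (s + 2 * of_nat M) z = even_remainder s z + (\<Sum>k<M. z powr (- s - 2 * of_nat k) * rGamma (1 - s - 2 * of_nat k))"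
proof (induction M)
  case (Suc M)
  have "even_remainder (s + 2 * of_nat (Suc M)) z = even_remainder ((s + 2 * of_nat M) + 2) z"
    by (simp add: algebra_simps)
  then show ?case
    unfolding even_remainder_rec[OF assms] Suc.IH by (simp add: algebra_simps)
qed simp

text \<open>In the difference of \<open>rGamma_series (- a)\<close> at z and -z the even powers
  cancel; dividing the odd part by z leaves an even series.\<close>

lemma even_remainder_series:
  assumes "z \<noteq> 0"
  shows "(\<lambda>j. rGamma (1 - a + of_nat (2 * j)) * z ^ (2 * j)) sums (z powr a * (even_remainder (a + 2) z + cosh z))"
proof -
  have "(\<lambda>k. (rGamma (- a + of_nat k) * z ^ k - rGamma (- a + of_nat k) * (- z) ^ k) * (1 / 2)) sums
     ((rGamma_series (- a) z - rGamma_series (- a) (- z)) * (1 / 2))"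
    unfolding rGamma_series_def by (intro sums_mult2 sums_diff summable_sums summable_rGamma_series)
  then have "(\<lambda>j. (rGamma (- a + of_nat (2 * j + 1)) * z ^ (2 * j + 1) - rGamma (- a + of_nat (2 * j + 1)) * (- z) ^ (2 * j + 1)) * (1 / 2)) sums
     ((rGamma_series (- a) z - rGamma_series (- a) (- z)) * (1 / 2))"
  proof (rule sums_mono_reindex[THEN iffD2, rotated 2])
    show "strict_mono (\<lambda>j::nat. 2 * j + 1)" by (simp add: strict_mono_def)
    fix n assume "n \<notin> range (\<lambda>j::nat. 2 * j + 1)"
    then have "even n" by (metis oddE rangeI)
    then show "(rGamma (- a + of_nat n) * z ^ n - rGamma (- a + of_nat n) * (- z) ^ n) * (1 / 2) = 0" by simp
  qed
  then have "(\<lambda>j. (rGamma (- a + of_nat (2 * j + 1)) * z ^ (2 * j + 1) - rGamma (- a + of_nat (2 * j + 1)) * (- z) ^ (2 * j + 1)) * (1 / 2) / z) sums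
     ((rGamma_series (- a) z - rGamma_series (- a) (- z)) * (1 / 2) / z)"
    by (rule sums_divide)
  also have "(\<lambda>j. (rGamma (- a + of_nat (2 * j + 1)) * z ^ (2 * j + 1) - rGamma (- a + of_nat (2 * j + 1)) * (- z) ^ (2 * j + 1)) * (1 / 2) / z)
     = (\<lambda>j. rGamma (1 - a + of_nat (2 * j)) * z ^ (2 * j))"
    using assms by (auto simp: algebra_simps)
  also have "(rGamma_series (- a) z - rGamma_series (- a) (- z)) * (1 / 2) / z = z powr a * (even_remainder (a + 2) z + cosh z)"
  proof -
    have e: "2 - (a + 2) = - a" by simp
    have "z powr a * z powr (1 - (a + 2)) = 1 / z"
      using assms by (simp add: powr_minus field_simps flip: powr_add)
    then have "z powr a * (z powr (1 - (a + 2)) * X / 2) = X * (1 / 2) / z" for X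
      by (simp add: mult.assoc[symmetric])
    then show ?thesis unfolding even_remainder_def e by simp
  qed
  finally show ?thesis .
qed

section \<open>The Bessel kernel\<close>

lemma notin_Ints_double:
  fixes w :: complex
  assumes "2 * w \<notin> \<int>" shows "w \<notin> \<int>\<^sub>\<le>\<^sub>0" "w + 1/2 \<notin> \<int>\<^sub>\<le>\<^sub>0"
proof -
  show "w \<notin> \<int>\<^sub>\<le>\<^sub>0" using assms nonpos_Ints_Int by fastforce
  show "w + 1/2 \<notin> \<int>\<^sub>\<le>\<^sub>0"
  proof
    assume "w + 1/2 \<in> \<int>\<^sub>\<le>\<^sub>0"
    then have "2 * (w + 1/2) - 1 \<in> \<int>" using nonpos_Ints_Int by (intro Ints_diff Ints_mult) auto
    with assms show False by (simp add: algebra_simps)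
  qed
qed

text \<open>Merges the Gamma pairs with arguments 1/2 apart, in the Bessel kernel and in
  \<open>A_sum\<close>, into one reciprocal Gamma; non-integrality keeps Legendre's formula away
  from the poles.\<close>

lemma inverse_Gamma_duplication:
  fixes w :: complex
  assumes "2 * w \<notin> \<int>"
  shows "1 / (Gamma w * Gamma (w + 1/2)) = rGamma (2 * w) * 2 powr (2 * w - 1) / of_real (sqrt pi)"
proof -
  have e: "exp ((1 - 2 * w) * of_real (ln 2)) = 1 / 2 powr (2 * w - 1)"
  proof -
    have L: "Ln (2::complex) = of_real (ln 2)" using Ln_of_real[of 2] by simp
    have m: "(1 - 2 * w) * of_real (ln 2) = - ((2 * w - 1) * of_real (ln 2))"
      by (simp only: minus_mult_left minus_diff_eq)
    show ?thesis unfolding m exp_minus powr_def by (simp add: L inverse_eq_divide)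
  qed
  show ?thesis
    unfolding Gamma_legendre_duplication[OF notin_Ints_double[OF assms]] e
    by (simp add: rGamma_inverse_Gamma field_simps)
qed

lemma half_powr:
  "(z / 2) powr (u :: complex) = z powr u * 2 powr (- u)"
proof -
  have "(of_real (1/2) * z) powr u = of_real (1/2) powr u * z powr u"
    by (intro powr_times_real_left) auto
  moreover have "complex_of_real (1/2) powr u = 2 powr (- u)"
    using cpow_mult[of "1/2" 2 u] by (simp add: powr_minus field_simps)
  ultimately show ?thesis by (simp add: mult.commute)
qed

lemma two_powr_minus_half: "(2::complex) powr (- 1 / 2) = of_real (1 / sqrt 2)"
proof -
  have "(2::complex) powr (- 1 / 2) = of_real (2 powr (- 1 / 2))"
    using powr_of_real[of 2 "- 1 / 2"] by simp
  also have "(2::real) powr (- 1 / 2) = inverse (2 powr (1 / 2))"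
    using powr_minus[of "2::real" "1 / 2"] by simp
  also have "\<dots> = 1 / sqrt 2" by (subst powr_half_sqrt) (simp_all add: inverse_eq_divide)
  finally show ?thesis .
qed

lemma power_int_neg_even: "(x :: complex) powi (- 2 * int k) = inverse (x ^ (2 * k))"
proof -
  have "- 2 * int k = - int (2 * k)" by simp
  then show ?thesis by (simp only: power_int_minus power_int_of_nat)
qed

text \<open>The parameter c cancels, and (2n)! = 4^n (1/2)_n n! turns the remaining terms into those
  of cosh.\<close>

lemma hyp1F2_cosh:
  assumes "\<And>n. pochhammer c n \<noteq> 0"
  shows "hyp1F2 c (1/2) c (z\<^sup>2 / 4) = cosh z"
proof -
  have "(\<lambda>n. if even n then z ^ n /\<^sub>R fact n else 0) sums cosh z" by (rule cosh_converges)
  then have "(\<lambda>n. z ^ (2 * n) /\<^sub>R fact (2 * n)) sums cosh z"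
    by (subst (asm) sums_mono_reindex[of "\<lambda>n. 2 * n", symmetric]) (auto simp: strict_mono_def elim!: evenE)
  also have "(\<lambda>n. z ^ (2 * n) /\<^sub>R fact (2 * n)) =
      (\<lambda>n. pochhammer c n / (pochhammer (1/2) n * pochhammer c n) * (z\<^sup>2 / 4) ^ n / fact n)"
  proof
    fix n
    have "pochhammer (2 * (1/2)) (2 * n) = of_nat (2 ^ (2 * n)) * pochhammer (1/2) n * pochhammer (1/2 + 1/2 :: complex) n"
      by (rule pochhammer_double)
    then have f: "fact (2 * n) = 4 ^ n * (pochhammer (1/2) n * fact n :: complex)"
      by (simp add: pochhammer_fact[symmetric] power_mult)
    have "z ^ (2 * n) /\<^sub>R fact (2 * n) = (z\<^sup>2) ^ n / fact (2 * n)"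
      by (simp add: scaleR_conv_of_real divide_inverse power_mult)
    also have "\<dots> = pochhammer c n / (pochhammer (1/2) n * pochhammer c n) * (z\<^sup>2 / 4) ^ n / fact n"
      unfolding f using assms[of n] by (simp add: power_divide)
    finally show "z ^ (2 * n) /\<^sub>R fact (2 * n) = pochhammer c n / (pochhammer (1/2) n * pochhammer c n) * (z\<^sup>2 / 4) ^ n / fact n" .
  qed
  finally show ?thesis unfolding hyp1F2_def by (simp add: sums_iff)
qed

text \<open>The lower parameters (1 - a) / 2 and 1 - a / 2 differ by 1/2, so their Pochhammer
  symbols merge into that of 1 - a at index 2n, while the upper parameter 1 cancels n!.\<close>

lemma hyp1F2_even_series:
  assumes "a \<notin> \<int>" and z: "z \<noteq> 0"
  shows "rGamma (1 - a) * hyp1F2 1 (1/2 - a / 2) (1 - a / 2) (z\<^sup>2 / 4) = z powr a * (even_remainder (a + 2) z + cosh z)"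
proof -
  have "rGamma (1 - a) * (pochhammer 1 n / (pochhammer (1/2 - a / 2) n * pochhammer (1 - a / 2) n) * (z\<^sup>2 / 4) ^ n / fact n)
     = rGamma (1 - a + of_nat (2 * n)) * z ^ (2 * n)" for n
  proof -
    have d: "pochhammer (1 - a) (2 * n) = 4 ^ n * (pochhammer (1/2 - a / 2) n * pochhammer (1 - a / 2) n)"
      using pochhammer_double[of "1/2 - a / 2" n] by (simp add: power_mult right_diff_distrib)
    have nz: "pochhammer (1 - a) (2 * n) \<noteq> 0"
    proof
      assume "pochhammer (1 - a) (2 * n) = 0"
      then obtain k where "1 - a = - of_nat k" unfolding pochhammer_eq_0_iff by auto
      then have "a = of_nat (Suc k)" by (simp add: algebra_simps eq_neg_iff_add_eq_0)
      with assms(1) show False by auto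
    qed
    have "rGamma (1 - a) = pochhammer (1 - a) (2 * n) * rGamma (1 - a + of_nat (2 * n))" by (rule pochhammer_rGamma)
    moreover have "pochhammer (1::complex) n = fact n" by (simp add: pochhammer_fact)
    ultimately show ?thesis using nz unfolding d
      by (simp add: power_mult power_divide)
  qed
  then have S: "(\<lambda>n. rGamma (1 - a) * (pochhammer 1 n / (pochhammer (1/2 - a / 2) n * pochhammer (1 - a / 2) n) * (z\<^sup>2 / 4) ^ n / fact n)) sums
      (z powr a * (even_remainder (a + 2) z + cosh z))"
    using even_remainder_series[OF z, of a] by simp
  have nz: "rGamma (1 - a) \<noteq> 0"
  proof
    assume "rGamma (1 - a) = 0"
    then have "1 - a \<in> \<int>\<^sub>\<le>\<^sub>0" by (simp add: rGamma_eq_zero_iff)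
    then have "1 - a \<in> \<int>" by (rule nonpos_Ints_Int)
    from Ints_diff[OF Ints_1 this] have "1 - (1 - a) \<in> \<int>" .
    with assms(1) show False by simp
  qed
  then have "(\<lambda>n. pochhammer 1 n / (pochhammer (1/2 - a / 2) n * pochhammer (1 - a / 2) n) * (z\<^sup>2 / 4) ^ n / fact n) sums
      ((z powr a * (even_remainder (a + 2) z + cosh z)) / rGamma (1 - a))"
    using sums_divide[OF S, of "rGamma (1 - a)"] by simp
  then show ?thesis unfolding hyp1F2_def using nz by (simp add: sums_iff)
qed

text \<open>At mu = 1/2 and w = 0 the second 1F2 is cosh z and the first is the even series, which
  contains cosh z with the same weight; both copies cancel.\<close>

lemma gen_bessel_K_even_remainder:
  assumes a: "a \<notin> \<int>" and z: "z \<noteq> 0"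
  shows "gen_bessel_K (1/2) (a / 2) z 0 =
     of_real (sqrt (pi / 2)) / sin (of_real pi * a / 2) * z powr (a / 2) * even_remainder (a + 2) z"
proof -
  have a2: "2 * (1/2 - a / 2) \<notin> \<int>"
  proof
    assume "2 * (1/2 - a / 2) \<in> \<int>"
    then have "1 - 2 * (1/2 - a / 2) \<in> \<int>" by (intro Ints_diff) auto
    with a show False by (simp add: algebra_simps)
  qed
  have ah: "1 + a / 2 \<notin> \<int>\<^sub>\<le>\<^sub>0"
  proof
    assume "1 + a / 2 \<in> \<int>\<^sub>\<le>\<^sub>0"
    then have "2 * (1 + a / 2) - 2 \<in> \<int>" using nonpos_Ints_Int by (intro Ints_diff Ints_mult) auto
    with a show False by (simp add: algebra_simps)
  qed
  then have G: "Gamma (1 + a / 2) \<noteq> 0" by (simp add: Gamma_eq_zero_iff)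
  have P: "\<forall>n. pochhammer (1 + a / 2) n \<noteq> 0"
  proof (intro allI notI)
    fix n assume "pochhammer (1 + a / 2) n = 0"
    then obtain k where "1 + a / 2 = - of_nat k" unfolding pochhammer_eq_0_iff by auto
    with ah show False by (metis nonpos_Ints_of_int of_int_minus of_int_of_nat_eq of_nat_0_le_iff neg_le_0_iff_le)
  qed
  let ?pi = "complex_of_real pi" and ?sp = "complex_of_real (sqrt pi)"
  have sp: "?sp \<noteq> 0" "?sp * ?sp = ?pi" by (simp_all flip: of_real_mult)
  have dup: "1 / (Gamma (1 - a / 2) * Gamma (1/2 - a / 2)) = rGamma (1 - a) * 2 powr (- a) / ?sp"
    using inverse_Gamma_duplication[OF a2] by (simp add: right_diff_distrib mult.commute)
  have "gen_bessel_K (1/2) (a / 2) z 0 = ?pi * 2 powr (1/2 + a / 2 - 1) / sin (?pi * a / 2) *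
     ((z / 2) powr (- (a / 2)) * (1 / (Gamma (1 - a / 2) * Gamma (1/2 - a / 2))) * hyp1F2 1 (1/2 - a / 2) (1 - a / 2) (z\<^sup>2 / 4)
      - (z / 2) powr (a / 2) * (Gamma (1 + a / 2) / (Gamma (1 + a / 2) * Gamma (1/2))) * hyp1F2 (1 + a / 2) (1/2) (1 + a / 2) (z\<^sup>2 / 4))"
    unfolding gen_bessel_K_def using z by (simp add: mult.commute add.commute)
  also have "hyp1F2 (1 + a / 2) (1/2) (1 + a / 2) (z\<^sup>2 / 4) = cosh z"
    by (rule hyp1F2_cosh) (use P in blast)
  also have "Gamma (1 + a / 2) / (Gamma (1 + a / 2) * Gamma (1/2)) = 1 / ?sp"
    using G by (simp add: Gamma_one_half_complex)
  also have "(z / 2) powr (- (a / 2)) * (1 / (Gamma (1 - a / 2) * Gamma (1/2 - a / 2))) * hyp1F2 1 (1/2 - a / 2) (1 - a / 2) (z\<^sup>2 / 4) =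
      (z / 2) powr (- (a / 2)) * 2 powr (- a) / ?sp * (rGamma (1 - a) * hyp1F2 1 (1/2 - a / 2) (1 - a / 2) (z\<^sup>2 / 4))"
    unfolding dup by simp
  also have "rGamma (1 - a) * hyp1F2 1 (1/2 - a / 2) (1 - a / 2) (z\<^sup>2 / 4) = z powr a * (even_remainder (a + 2) z + cosh z)"
    by (rule hyp1F2_even_series[OF a z])
  also have "(z / 2) powr (- (a / 2)) = z powr (- (a / 2)) * 2 powr (a / 2)" by (simp add: half_powr)
  also have "(z / 2) powr (a / 2) = z powr (a / 2) * 2 powr (- (a / 2))" by (simp add: half_powr)
  also have "z powr (- (a / 2)) * 2 powr (a / 2) * 2 powr (- a) / ?sp * (z powr a * (even_remainder (a + 2) z + cosh z)) =
     (z powr (- (a / 2)) * z powr a) * (2 powr (a / 2) * 2 powr (- a)) / ?sp * (even_remainder (a + 2) z + cosh z)"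
    by simp
  also have "z powr (- (a / 2)) * z powr a = z powr (a / 2)" by (simp flip: powr_add)
  also have "2 powr (a / 2) * 2 powr (- a) = (2::complex) powr (- (a / 2))" by (simp flip: powr_add)
  also have "?pi * 2 powr (1/2 + a / 2 - 1) / sin (?pi * a / 2) *
     (z powr (a / 2) * 2 powr (- (a / 2)) / ?sp * (even_remainder (a + 2) z + cosh z) - z powr (a / 2) * 2 powr (- (a / 2)) * (1 / ?sp) * cosh z) =
     (?pi / ?sp * (2 powr (1/2 + a / 2 - 1) * 2 powr (- (a / 2)))) / sin (?pi * a / 2) * z powr (a / 2) * even_remainder (a + 2) z"
    by (simp add: algebra_simps add_divide_distrib diff_divide_distrib)
  also have "2 powr (1/2 + a / 2 - 1) * 2 powr (- (a / 2)) = (2::complex) powr (- 1 / 2)" by (simp flip: powr_add)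
  also have "(2::complex) powr (- 1 / 2) = of_real (1 / sqrt 2)"
    by (rule two_powr_minus_half)
  also have "?pi / ?sp = ?sp" using sp by (simp add: field_simps)
  also have "?sp * of_real (1 / sqrt 2) = of_real (sqrt (pi / 2))" by (simp add: real_sqrt_divide)
  finally show ?thesis .
qed

lemma A_sum_eq:
  assumes a: "a \<notin> \<int>" and z: "z \<noteq> 0"
  shows "A_sum m (1/2) (a / 2) 0 z =
    - (2 powr (- a - 2) / of_real (sqrt pi)) * (\<Sum>k\<le>m. z powi (- 2 * int k) * rGamma (- a - 1 - 2 * of_nat k))"
proof -
  have t: "(-1) powr (- (1/2) - 0 - 1/2) * Gamma (1/2 + 0 + 1/2 + of_nat k) /
        (fact k * Gamma (- (a / 2) - 1/2 - of_nat k) * Gamma (1/2 - a / 2 - 1/2 - 0 - of_nat k)) * (z / 2) powi (- 2 * int k)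
     = - (2 powr (- a - 2) / of_real (sqrt pi)) * (z powi (- 2 * int k) * rGamma (- a - 1 - 2 * of_nat k))" for k
  proof -
    \<comment> \<open>The two Gammas in the denominator have the arguments w and w + 1/2, so
      duplication produces a single reciprocal Gamma at 2 w.\<close>
    define w where "w = - (a / 2) - 1/2 - of_nat k"
    have w2: "2 * w = - a - 1 - 2 * of_nat k" by (simp add: w_def algebra_simps)
    have "2 * w \<notin> \<int>"
    proof
      assume "2 * w \<in> \<int>"
      then have "- (2 * w) - 1 - 2 * of_nat k \<in> \<int>" by (intro Ints_diff Ints_minus) auto
      with a show False by (simp add: w_def algebra_simps)
    qed
    note dup = inverse_Gamma_duplication[OF this]
    have g: "Gamma (1/2 + 0 + 1/2 + of_nat k :: complex) = fact k"
      using Gamma_fact[of k, where 'a = complex] by (simp add: add.commute)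
    \<comment> \<open>At these parameters the power of -1 in \<open>A_sum\<close> has exponent -1,
      so its value is -1 on every branch.\<close>
    have m: "(-1 :: complex) powr (- (1/2) - 0 - 1/2) = - 1"
    proof -
      have "- (1/2) - 0 - 1/2 = (- 1 :: complex)" by simp
      moreover have "(-1 :: complex) powr (- 1) = - 1" using powr_minus[of "-1 :: complex" 1] by simp
      ultimately show ?thesis by (simp only:)
    qed
    have zz: "(z / 2) powi (- 2 * int k) = 4 ^ k * z powi (- 2 * int k)"
    proof -
      have "(z / 2) ^ (2 * k) = z ^ (2 * k) * inverse (4 ^ k)"
        unfolding power_divide by (simp add: power_mult divide_inverse)
      then show ?thesis unfolding power_int_neg_even by (simp only: inverse_mult_distrib inverse_inverse_eq mult.commute)
    qed
    have "(2::complex) powr (2 * w - 1) = 2 powr (- a - 2) * 2 powr (- of_nat (2 * k))"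
      unfolding w2 by (simp add: algebra_simps flip: powr_add)
    also have "(2::complex) powr (- of_nat (2 * k)) = 1 / 4 ^ k"
      unfolding powr_minus by (subst powr_complexpow) (simp_all add: power_mult inverse_eq_divide)
    finally have tw: "(2::complex) powr (2 * w - 1) * 4 ^ k = 2 powr (- a - 2)" by simp
    have "(-1) powr (- (1/2) - 0 - 1/2) * Gamma (1/2 + 0 + 1/2 + of_nat k) /
        (fact k * Gamma w * Gamma (w + 1/2)) * (z / 2) powi (- 2 * int k) =
      - (1 / (Gamma w * Gamma (w + 1/2))) * (4 ^ k * z powi (- 2 * int k))"
      unfolding g m zz by simp
    also have "\<dots> = - ((2 powr (2 * w - 1) * 4 ^ k) / of_real (sqrt pi)) * (z powi (- 2 * int k) * rGamma (2 * w))"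
      unfolding dup by simp
    finally have F: "(-1) powr (- (1/2) - 0 - 1/2) * Gamma (1/2 + 0 + 1/2 + of_nat k) /
        (fact k * Gamma w * Gamma (w + 1/2)) * (z / 2) powi (- 2 * int k) =
        - (2 powr (- a - 2) / of_real (sqrt pi)) * (z powi (- 2 * int k) * rGamma (2 * w))"
      by (simp only: tw)
    have "1/2 - a / 2 - 1/2 - 0 - of_nat k = w + 1/2" by (simp add: w_def)
    then show ?thesis using F by (simp only: w_def[symmetric] w2)
  qed
  show ?thesis unfolding A_sum_def t sum_distrib_left[symmetric] by (simp add: atLeast0AtMost)
qed

text \<open>Subtracting the terms of \<open>A_sum\<close> is the same as raising the parameter of
  \<open>even_remainder\<close> by 2 once for each of them.\<close>

lemma bessel_part_eq:
  assumes a: "a \<notin> \<int>" and y: "Re y > 0" and n: "n > 0"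
  defines "z \<equiv> 4 * (of_real pi)\<^sup>2 * of_nat n / y"
  shows "bessel_part m y n a =
     of_real (sqrt (pi / 2)) / sin (of_real pi * a / 2) * z powr (a / 2) * even_remainder (a + 2 * of_nat m + 4) z"
proof -
  let ?pi = "complex_of_real pi" and ?sp = "complex_of_real (sqrt pi)"
  have sp: "?sp \<noteq> 0" "?sp * ?sp = ?pi" by (simp_all flip: of_real_mult)
  have z: "z \<noteq> 0" using y n by (auto simp: z_def)
  have pw: "z powr (- a / 2 - 2) * z powi (- 2 * int k) = z powr (a / 2) * z powr (- (a + 2) - 2 * of_nat k)" for k
  proof -
    have "z powi (- 2 * int k) = z powr (- of_nat (2 * k))"
      unfolding powr_minus power_int_neg_even using z by (subst powr_complexpow) auto
    then show ?thesis by (simp add: algebra_simps flip: powr_add)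
  qed
  let ?S = "\<Sum>k\<le>m. z powr (- (a + 2) - 2 * of_nat k) * rGamma (1 - (a + 2) - 2 * of_nat k)"
  have rg: "1 - (a + 2) - 2 * of_nat k = - a - 1 - 2 * of_nat k" for k :: nat by simp
  have S: "z powr (- a / 2 - 2) * (\<Sum>k\<le>m. z powi (- 2 * int k) * rGamma (- a - 1 - 2 * of_nat k)) = z powr (a / 2) * ?S"
    unfolding sum_distrib_left rg by (intro sum.cong refl) (simp only: mult.assoc[symmetric] pw)
  have "?pi * 2 powr (3/2 + a) / sin (?pi * a / 2) * z powr (- a / 2 - 2) * A_sum m (1/2) (a / 2) 0 z =
     - (?pi * (2 powr (3/2 + a) * 2 powr (- a - 2)) / ?sp / sin (?pi * a / 2)) * (z powr (a / 2) * ?S)"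
  proof -
    have "u * p / sn * zz * (- (q / v) * T) = - (u * (p * q) / v / sn) * (zz * T)" for u p sn zz q v T :: complex
      by (simp add: mult_ac)
    then show ?thesis unfolding A_sum_eq[OF a z] by (simp only: S)
  qed
  also have "(2::complex) powr (3/2 + a) * 2 powr (- a - 2) = 2 powr (- 1 / 2)" by (simp flip: powr_add)
  also have "(2::complex) powr (- 1 / 2) = of_real (1 / sqrt 2)"
    by (rule two_powr_minus_half)
  also have "?pi * of_real (1 / sqrt 2) / ?sp = of_real (sqrt (pi / 2))"
    using sp(1) unfolding sp(2)[symmetric] by (simp add: real_sqrt_divide)
  finally have A: "?pi * 2 powr (3/2 + a) / sin (?pi * a / 2) * z powr (- a / 2 - 2) * A_sum m (1/2) (a / 2) 0 z =
     - (of_real (sqrt (pi / 2)) / sin (?pi * a / 2) * z powr (a / 2) * ?S)" by simp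
  \<comment> \<open>\<open>A_sum\<close> runs over k = 0, ..., m, hence m + 1 shifts, from a + 2 to
    a + 2 m + 4.\<close>
  have er: "even_remainder (a + 2 * of_nat m + 4) z = even_remainder (a + 2) z + ?S"
    using even_remainder_shift[OF z, of "a + 2" "Suc m"] by (simp add: lessThan_Suc_atMost algebra_simps)
  show ?thesis
    unfolding bessel_part_def Let_def z_def[symmetric] A gen_bessel_K_even_remainder[OF a z] er
    by (simp add: algebra_simps add_divide_distrib)
qed

section \<open>Abel--Plana summation\<close>

text \<open>The logarithmic derivative of the reflection formula is pi cot(pi z) = Digamma(1 - z) -
  Digamma(z), and the limit formula for Digamma turns this into the expansion.\<close>

lemma cot_partial_fractions:
  fixes z :: complex
  assumes z: "z \<notin> \<int>"
  shows "(\<lambda>n. 2 * z / (z\<^sup>2 - (of_nat (Suc n))\<^sup>2)) sums (of_real pi * cot (of_real pi * z) - 1 / z)"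
proof -
  have z': "1 - z \<notin> \<int>" using z Ints_diff[OF Ints_1, of "1 - z"] by auto
  have np: "z \<notin> \<int>\<^sub>\<le>\<^sub>0" "1 - z \<notin> \<int>\<^sub>\<le>\<^sub>0" using z z' nonpos_Ints_Int by blast+
  have nz: "z \<noteq> 0" "1 - z \<noteq> 0" using z z' by auto
  have shift: "z + of_int n \<noteq> 0" for n
    using z by (metis Ints_minus Ints_of_int add.commute add_eq_0_iff)
  have sn: "sin (of_real pi * z) \<noteq> 0"
  proof
    assume "sin (of_real pi * z) = 0"
    then obtain n :: int where "of_real pi * z = of_real (n * pi)" by (auto simp: sin_eq_0)
    then have "z = of_int n" by (simp add: field_simps)
    with z show False by simp
  qed
  have "((\<lambda>z. Gamma z * Gamma (1 - z)) has_field_derivative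
      (Gamma z * Digamma z) * Gamma (1 - z) + (Gamma (1 - z) * Digamma (1 - z) * (0 - 1)) * Gamma z) (at z)"
    by (intro DERIV_mult has_field_derivative_Gamma DERIV_chain2[OF has_field_derivative_Gamma] DERIV_diff DERIV_const DERIV_ident np)
  moreover have "((\<lambda>z. of_real pi / sin (of_real pi * z)) has_field_derivative
      (- of_real pi * (cos (of_real pi * z) * of_real pi) / (sin (of_real pi * z))\<^sup>2)) (at z)"
    using sn by (auto intro!: derivative_eq_intros simp: power2_eq_square)
  ultimately have "(Gamma z * Digamma z) * Gamma (1 - z) + (Gamma (1 - z) * Digamma (1 - z) * (0 - 1)) * Gamma z =
      - of_real pi * (cos (of_real pi * z) * of_real pi) / (sin (of_real pi * z))\<^sup>2"
    unfolding Gamma_reflection_complex by (rule DERIV_unique)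
  then have "(Gamma z * Gamma (1 - z)) * (Digamma z - Digamma (1 - z)) =
      - of_real pi * (cos (of_real pi * z) * of_real pi) / (sin (of_real pi * z))\<^sup>2"
    by (simp add: algebra_simps)
  then have "(of_real pi / sin (of_real pi * z)) * (Digamma z - Digamma (1 - z)) =
      (of_real pi / sin (of_real pi * z)) * (- (of_real pi * cot (of_real pi * z)))"
    unfolding Gamma_reflection_complex by (simp add: power2_eq_square cot_def)
  moreover have "of_real pi / sin (of_real pi * z) \<noteq> 0" using sn by simp
  ultimately have "Digamma z - Digamma (1 - z) = - (of_real pi * cot (of_real pi * z))"
    by (metis mult_cancel_left)
  then have D: "Digamma (1 - z) - Digamma z = of_real pi * cot (of_real pi * z)"
    by (simp add: algebra_simps)
  have L1: "(\<lambda>m. (of_real (ln (real m)) - (\<Sum>n<m. inverse ((1 - z) + of_nat n))) - (of_real (ln (real m)) - (\<Sum>n<m. inverse (z + of_nat n))))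
      \<longlonglongrightarrow> Digamma (1 - z) - Digamma z"
    by (intro tendsto_diff Digamma_LIMSEQ nz)
  \<comment> \<open>Taking away 1 / z and adding 1 / (z + m), which tends to 0, lets both sums run
    over 1, ..., m, so that their terms pair up.\<close>
  have L2: "(\<lambda>m. 1 / (z + of_nat m)) \<longlonglongrightarrow> 0"
    by (intro tendsto_divide_0[OF tendsto_const] tendsto_add_filterlim_at_infinity[OF tendsto_const] tendsto_of_nat)
  have "(\<lambda>m. ((of_real (ln (real m)) - (\<Sum>n<m. inverse ((1 - z) + of_nat n))) - (of_real (ln (real m)) - (\<Sum>n<m. inverse (z + of_nat n)))) - 1 / z + 1 / (z + of_nat m))
      \<longlonglongrightarrow> Digamma (1 - z) - Digamma z - 1 / z + 0"
    by (rule tendsto_add[OF tendsto_diff[OF L1 tendsto_const] L2])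
  moreover have "((of_real (ln (real m)) - (\<Sum>n<m. inverse ((1 - z) + of_nat n))) - (of_real (ln (real m)) - (\<Sum>n<m. inverse (z + of_nat n)))) - 1 / z + 1 / (z + of_nat m)
      = (\<Sum>n<m. 2 * z / (z\<^sup>2 - (of_nat (Suc n))\<^sup>2))" for m
  proof (induction m)
    case (Suc m)
    have a: "z + of_nat (Suc m) \<noteq> 0" "z - of_nat (Suc m) \<noteq> 0"
      using shift[of "int (Suc m)"] shift[of "- int (Suc m)"] by auto
    have p: "inverse ((1 - z) + of_nat m) = - (1 / (z - of_nat (Suc m)))"
    proof -
      have "(1 - z) + of_nat m = - (z - of_nat (Suc m))" by simp
      then show ?thesis by (simp only: inverse_eq_divide minus_divide_right)
    qed
    have q: "1 / (z - of_nat (Suc m)) + 1 / (z + of_nat (Suc m)) = 2 * z / (z\<^sup>2 - (of_nat (Suc m))\<^sup>2)"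
    proof -
      have "z\<^sup>2 - (of_nat (Suc m))\<^sup>2 = (z - of_nat (Suc m)) * (z + of_nat (Suc m))"
        by (simp add: power2_eq_square algebra_simps)
      then show ?thesis using a by (simp add: add_frac_eq del: of_nat_Suc)
    qed
    show ?case
      unfolding sum.lessThan_Suc Suc.IH[symmetric] q[symmetric] p
      by (simp add: inverse_eq_divide del: of_nat_Suc)
  qed simp
  ultimately show ?thesis unfolding sums_def D by simp
qed

text \<open>The cotangent expansion at z = u / (2 pi i); Re u > 0 keeps z off the integers.\<close>

lemma Planck_partial_fractions:
  fixes u :: complex
  assumes u: "Re u > 0"
  shows "(\<lambda>k. 2 * u / (u\<^sup>2 + 4 * (of_real pi)\<^sup>2 * (of_nat (Suc k))\<^sup>2)) sums (1 / (exp u - 1) - 1 / u + 1 / 2)"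
proof -
  let ?pi = "complex_of_real pi"
  define z where "z = u / (2 * ?pi * \<i>)"
  have uz: "u = 2 * ?pi * \<i> * z" by (simp add: z_def)
  have "z \<notin> \<int>"
  proof
    assume "z \<in> \<int>"
    then obtain n where "z = of_int n" by (auto elim: Ints_cases)
    then have "Re u = 0" by (simp add: uz)
    with u show False by simp
  qed
  have eu: "exp u - 1 \<noteq> 0"
  proof
    assume "exp u - 1 = 0"
    then have "norm (exp u) = 1" by simp
    then show False using u by simp
  qed
  have c: "?pi * cot (?pi * z) = ?pi * \<i> * (1 + 2 / (exp u - 1))"
  proof -
    have e1: "exp u = exp (\<i> * (?pi * z)) * exp (\<i> * (?pi * z))"
      unfolding uz by (simp add: algebra_simps flip: exp_add)
    define E where "E = exp (\<i> * (?pi * z))"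
    have E: "E \<noteq> 0" "E * E = exp u" by (simp_all add: E_def e1)
    have em: "exp (- (\<i> * (?pi * z))) = 1 / E" by (simp add: E_def exp_minus inverse_eq_divide)
    have "cos (?pi * z) = (exp u + 1) / (2 * E)"
      unfolding cos_exp_eq em E_def[symmetric] using E by (simp add: field_simps)
    moreover have "sin (?pi * z) = (exp u - 1) / (2 * \<i> * E)"
      unfolding sin_exp_eq em E_def[symmetric] using E by (simp add: field_simps)
    ultimately have "cot (?pi * z) = \<i> * ((exp u + 1) / (exp u - 1))"
      using E eu by (simp add: cot_def)
    also have "(exp u + 1) / (exp u - 1) = 1 + 2 / (exp u - 1)" using eu by (simp add: field_simps)
    finally show ?thesis by simp
  qed
  have "(\<lambda>n. 2 * z / (z\<^sup>2 - (of_nat (Suc n))\<^sup>2) / (2 * ?pi * \<i>)) sums ((?pi * cot (?pi * z) - 1 / z) / (2 * ?pi * \<i>))"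
    by (intro sums_divide cot_partial_fractions) fact
  also have "(\<lambda>n. 2 * z / (z\<^sup>2 - (of_nat (Suc n))\<^sup>2) / (2 * ?pi * \<i>)) = (\<lambda>k. 2 * u / (u\<^sup>2 + 4 * ?pi\<^sup>2 * (of_nat (Suc k))\<^sup>2))"
  proof
    fix n
    have A: "u\<^sup>2 + 4 * ?pi\<^sup>2 * (of_nat (Suc n))\<^sup>2 = - (4 * ?pi\<^sup>2) * (z\<^sup>2 - (of_nat (Suc n))\<^sup>2)"
      unfolding uz by (simp add: power_mult_distrib algebra_simps)
    have B: "2 * u = - (4 * ?pi\<^sup>2) * (2 * z / (2 * ?pi * \<i>))"
      unfolding uz by (simp add: power2_eq_square field_simps)
    have C: "- (4 * ?pi\<^sup>2) \<noteq> 0" by simp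
    have "2 * u / (u\<^sup>2 + 4 * ?pi\<^sup>2 * (of_nat (Suc n))\<^sup>2) = (2 * z / (2 * ?pi * \<i>)) / (z\<^sup>2 - (of_nat (Suc n))\<^sup>2)"
      unfolding A B by (rule mult_divide_mult_cancel_left[OF C])
    then show "2 * z / (z\<^sup>2 - (of_nat (Suc n))\<^sup>2) / (2 * ?pi * \<i>) = 2 * u / (u\<^sup>2 + 4 * ?pi\<^sup>2 * (of_nat (Suc n))\<^sup>2)"
      by simp
  qed
  also have "(?pi * cot (?pi * z) - 1 / z) / (2 * ?pi * \<i>) = 1 / (exp u - 1) - 1 / u + 1 / 2"
  proof -
    have "1 / z = 2 * ?pi * \<i> / u" by (simp add: z_def)
    then have "?pi * cot (?pi * z) - 1 / z = (2 * ?pi * \<i>) * (1 / (exp u - 1) - 1 / u + 1 / 2)"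
      unfolding c by (simp add: algebra_simps)
    then show ?thesis by simp
  qed
  finally show ?thesis .
qed

text \<open>Replace the smaller of x and y by the larger one. The product form separates k from t,
  or two summation indices, so that both operations converge.\<close>

lemma Young_powr:
  fixes x y p :: real
  assumes "x > 0" "y > 0" "0 \<le> p" "p \<le> 2"
  shows "x powr p * y powr (2 - p) \<le> x\<^sup>2 + y\<^sup>2"
proof (cases "x \<le> y")
  case True
  have "x powr p * y powr (2 - p) \<le> y powr p * y powr (2 - p)"
    using assms True by (intro mult_right_mono powr_mono2) auto
  also have "\<dots> = y\<^sup>2" using assms by (simp flip: powr_add)
  finally show ?thesis by (simp add: add_increasing)
next
  case False
  have "x powr p * y powr (2 - p) \<le> x powr p * x powr (2 - p)"
    using assms False by (intro mult_left_mono powr_mono2) auto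
  also have "\<dots> = x\<^sup>2" using assms by (simp flip: powr_add)
  finally show ?thesis by (simp add: add_increasing2)
qed

lemma summable_Suc_powr: "p < -1 \<Longrightarrow> summable (\<lambda>n. real (Suc n) powr p)"
  by (subst summable_Suc_iff) (simp add: summable_real_powr_iff)

text \<open>Because omega^2 = -w^2 b^2, the normalised quadratic factors differ by a constant
  multiple of t^2. Partial fractions absorb t^2 and leave two Beta integrals with exponent s -
  1.\<close>

lemma mixed_kernel_integral:
  assumes s: "1 < Re s" "Re s < 2" and b: "Re b > 0" and e: "e = \<i> \<or> e = - \<i>" and w: "Re w > 0" and pos: "Re (- e * w * b) > 0"
    and k: "k > 0"
  defines "\<omega> \<equiv> - e * w * b" and "X \<equiv> of_real pi / (2 * sin (of_real pi * (s - 1) / 2))"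
  shows "(\<integral>t. of_real t powr s / ((1 + b\<^sup>2 * (of_real t)\<^sup>2) * ((of_real k)\<^sup>2 + \<omega>\<^sup>2 * (of_real t)\<^sup>2)) \<partial>pos_lborel) =
     - X / (b\<^sup>2 * (w\<^sup>2 + (of_real k)\<^sup>2)) * (b powr (1 - s) - (\<omega> / of_real k) powr (1 - s))"
    and "integrable pos_lborel (\<lambda>t. of_real t powr s / ((1 + b\<^sup>2 * (of_real t)\<^sup>2) * ((of_real k)\<^sup>2 + \<omega>\<^sup>2 * (of_real t)\<^sup>2)))"
proof -
  let ?c = "\<omega> / of_real k"
  let ?D = "b\<^sup>2 * (w\<^sup>2 + (of_real k)\<^sup>2)"
  have c: "Re ?c > 0" using pos k by (simp add: \<omega>_def Re_divide_of_real divide_neg_pos del: times_complex.sel)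
  have ee: "e\<^sup>2 = - 1" using e by (auto simp: power2_eq_square)
  have wk: "w\<^sup>2 + (of_real k)\<^sup>2 \<noteq> 0"
  proof -
    have "1 + (1 / w)\<^sup>2 * (of_real k)\<^sup>2 \<noteq> 0"
      using w by (intro add_one_square_neq_0) (auto simp: Re_divide intro!: divide_pos_pos add_pos_nonneg)
    moreover have "w\<^sup>2 + (of_real k)\<^sup>2 = w\<^sup>2 * (1 + (1 / w)\<^sup>2 * (of_real k)\<^sup>2)"
      using w by (auto simp: field_simps power2_eq_square)
    ultimately show ?thesis using w by auto
  qed
  have b0: "b \<noteq> 0" using b by auto
  have D: "?D \<noteq> 0" using wk b0 by simp
  let ?f = "\<lambda>b t. of_real t powr ((s - 1) - 1) / (1 + b\<^sup>2 * (of_real t)\<^sup>2) :: complex"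
  have s1: "0 < Re (s - 1)" "Re (s - 1) < 2" using s by auto
  have eq: "of_real t powr s / ((1 + b\<^sup>2 * (of_real t)\<^sup>2) * ((of_real k)\<^sup>2 + \<omega>\<^sup>2 * (of_real t)\<^sup>2)) = - (1 / ?D) * (?f b t - ?f ?c t)"
    if t: "t \<in> space pos_lborel" for t
  proof -
    have t0: "complex_of_real t \<noteq> 0" using t by simp
    define P where "P = 1 + b\<^sup>2 * (complex_of_real t)\<^sup>2"
    define Q where "Q = 1 + ?c\<^sup>2 * (complex_of_real t)\<^sup>2"
    have PQ: "P \<noteq> 0" "Q \<noteq> 0" unfolding P_def Q_def by (intro add_one_square_neq_0 b c)+
    have Qk: "(of_real k)\<^sup>2 + \<omega>\<^sup>2 * (of_real t)\<^sup>2 = (of_real k)\<^sup>2 * Q"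
      using k unfolding Q_def by (simp add: power_divide field_simps)
    have om: "\<omega>\<^sup>2 = - (w\<^sup>2 * b\<^sup>2)" unfolding \<omega>_def by (simp add: power_mult_distrib ee)
    have "(of_real k)\<^sup>2 * (Q - P) = - ((of_real t)\<^sup>2 * ?D)"
      using k unfolding Q_def P_def power_divide om by (simp add: field_simps)
    then have N: "(of_real t)\<^sup>2 = - ((of_real k)\<^sup>2 * (Q - P)) / ?D" using D by (simp add: field_simps)
    have ts: "of_real t powr s = of_real t powr ((s - 1) - 1) * (of_real t)\<^sup>2"
      using t0 by (simp add: powr_diff power2_eq_square)
    have kk: "(complex_of_real k)\<^sup>2 \<noteq> 0" using k by simp
    have "of_real t powr s / (P * ((of_real k)\<^sup>2 * Q)) = of_real t powr ((s - 1) - 1) * (- (1 / ?D) * ((Q - P) / (P * Q)))"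
      unfolding ts N using kk by (simp add: divide_inverse mult_ac)
    also have "(Q - P) / (P * Q) = 1 / P - 1 / Q" using PQ by (simp add: diff_frac_eq)
    finally show ?thesis unfolding Qk P_def[symmetric] Q_def[symmetric] by (simp add: algebra_simps diff_divide_distrib)
  qed
  show "integrable pos_lborel (\<lambda>t. of_real t powr s / ((1 + b\<^sup>2 * (of_real t)\<^sup>2) * ((of_real k)\<^sup>2 + \<omega>\<^sup>2 * (of_real t)\<^sup>2)))"
  proof -
    have "integrable pos_lborel (\<lambda>t. - (1 / ?D) * (?f b t - ?f ?c t))"
      by (intro integrable_mult_right Bochner_Integration.integrable_diff Beta_integral_right_half(1) s1 b c)
    moreover have "integrable pos_lborel (\<lambda>t. of_real t powr s / ((1 + b\<^sup>2 * (of_real t)\<^sup>2) * ((of_real k)\<^sup>2 + \<omega>\<^sup>2 * (of_real t)\<^sup>2)))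
       \<longleftrightarrow> integrable pos_lborel (\<lambda>t. - (1 / ?D) * (?f b t - ?f ?c t))"
      by (rule Bochner_Integration.integrable_cong[OF refl eq])
    ultimately show ?thesis by blast
  qed
  have "(\<integral>t. of_real t powr s / ((1 + b\<^sup>2 * (of_real t)\<^sup>2) * ((of_real k)\<^sup>2 + \<omega>\<^sup>2 * (of_real t)\<^sup>2)) \<partial>pos_lborel) =
      (\<integral>t. - (1 / ?D) * (?f b t - ?f ?c t) \<partial>pos_lborel)"
    by (intro Bochner_Integration.integral_cong refl eq)
  also have "\<dots> = - (1 / ?D) * ((\<integral>t. ?f b t \<partial>pos_lborel) - (\<integral>t. ?f ?c t \<partial>pos_lborel))"
    by (simp only: integral_mult_right_zero Bochner_Integration.integral_diff[OF Beta_integral_right_half(1)[OF s1 b] Beta_integral_right_half(1)[OF s1 c]])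
  also have "\<dots> = - X / ?D * (b powr (1 - s) - ?c powr (1 - s))"
    unfolding Beta_integral_right_half(2)[OF s1 b] Beta_integral_right_half(2)[OF s1 c] X_def[symmetric] minus_diff_eq
    by (simp add: algebra_simps)
  finally show "(\<integral>t. of_real t powr s / ((1 + b\<^sup>2 * (of_real t)\<^sup>2) * ((of_real k)\<^sup>2 + \<omega>\<^sup>2 * (of_real t)\<^sup>2)) \<partial>pos_lborel) =
     - X / ?D * (b powr (1 - s) - ?c powr (1 - s))" .
qed

lemma exp_geometric_sums:
  fixes u :: complex
  assumes "Re u > 0"
  shows "(\<lambda>d. exp (- of_nat (Suc d) * u)) sums (1 / (exp u - 1))"
    and "summable (\<lambda>d. norm (exp (- of_nat (Suc d) * u)))"
proof -
  have n: "norm (exp (- u)) < 1" using assms by (simp add: norm_exp_eq_Re)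
  have e: "exp (- of_nat (Suc d) * u) = exp (- u) * exp (- u) ^ d" for d
  proof -
    have "- of_nat (Suc d) * u = of_nat (Suc d) * (- u)" by (simp only: mult_minus_left mult_minus_right)
    then have "exp (- of_nat (Suc d) * u) = exp (- u) ^ Suc d" by (simp only: exp_of_nat_mult)
    then show ?thesis by simp
  qed
  have "(\<lambda>d. exp (- u) * exp (- u) ^ d) sums (exp (- u) * (1 / (1 - exp (- u))))"
    by (intro sums_mult geometric_sums n)
  also have "exp (- u) * (1 / (1 - exp (- u))) = 1 / (exp u - 1)"
    by (simp add: exp_minus field_simps)
  finally show "(\<lambda>d. exp (- of_nat (Suc d) * u)) sums (1 / (exp u - 1))" unfolding e .
  show "summable (\<lambda>d. norm (exp (- of_nat (Suc d) * u)))"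
    unfolding e norm_mult norm_power using n by (intro summable_mult summable_geometric) auto
qed

text \<open>Summing the exponentials over d gives 1 / (exp u - 1) with u proportional to t. Its
  partial fractions produce the mixed kernels, and the corrections 1 / u and 1 / 2 integrate to the
  Beta values behind \<open>X\<close> and \<open>Y\<close>. The sum over d needs Re s > 1, the
  integrals without exponential decay need Re s < 2.\<close>

lemma ray_integral_sums:
  assumes s: "1 < Re s" "Re s < 2" and b: "Re b > 0" and e: "e = \<i> \<or> e = - \<i>" and w: "Re w > 0" and pos: "Re (- e * w * b) > 0"
  defines "X \<equiv> of_real pi / (2 * sin (of_real pi * (s - 1) / 2))" and "Y \<equiv> of_real pi / (2 * sin (of_real pi * s / 2))"
  obtains I where
    "(\<lambda>d. b powr s * ray_integral s b (2 * of_real pi * of_nat (Suc d) * (- e * w * b))) sums I"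
    "(\<lambda>k. X / (of_real pi * (w\<^sup>2 + (of_nat (Suc k))\<^sup>2)) * (e * w - e powr s * w powr (2 - s) * of_nat (Suc k) powr (s - 1)))
       sums (I - e * X / (2 * of_real pi * w) + Y / 2)"
proof -
  let ?pi = "complex_of_real pi"
  define \<omega> where "\<omega> = - e * w * b"
  have om: "Re \<omega> > 0" using pos by (simp only: \<omega>_def)
  have nz: "w \<noteq> 0" "b \<noteq> 0" "e \<noteq> 0" "\<omega> \<noteq> 0" using w b e om by auto
  have ee: "e * e = -1" using e by auto
  have s0: "0 < Re s" "0 < Re (s - 1)" "Re (s - 1) < 2" using s by auto
  define h where "h = (\<lambda>t. complex_of_real t powr (s - 1) / (1 + b\<^sup>2 * (of_real t)\<^sup>2))"
  define g where "g = (\<lambda>t. complex_of_real t powr ((s - 1) - 1) / (1 + b\<^sup>2 * (of_real t)\<^sup>2))"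
  have ih: "integrable pos_lborel h" and vh: "(\<integral>t. h t \<partial>pos_lborel) = b powr (- s) * Y"
    unfolding h_def Y_def by (intro Beta_integral_right_half s0 s b)+
  have ig: "integrable pos_lborel g" and vg: "(\<integral>t. g t \<partial>pos_lborel) = b powr (- (s - 1)) * X"
    unfolding g_def X_def by (intro Beta_integral_right_half s0 b)+
  define u where "u = (\<lambda>t::real. 2 * ?pi * \<omega> * of_real t)"
  have Ru: "Re (u t) > 0" if "t > 0" for t
    using om that by (simp add: u_def)
  obtain \<delta> where \<delta>: "\<delta> > 0" "\<And>t. \<delta> * (1 + t\<^sup>2) \<le> norm (1 + b\<^sup>2 * (of_real t)\<^sup>2)"
    using add_one_square_bound[OF b] by metis
  obtain \<eta> where \<eta>: "\<eta> > 0" "\<And>k t. k > 0 \<Longrightarrow> \<eta> * (k\<^sup>2 + t\<^sup>2) \<le> norm ((complex_of_real k)\<^sup>2 + \<omega>\<^sup>2 * (of_real t)\<^sup>2)"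
    using square_sum_bound[OF om] by metis
  define f where "f = (\<lambda>(d::nat) t. complex_of_real t powr (s - 1) * exp (- (2 * ?pi * of_nat (Suc d) * \<omega>) * of_real t) / (1 + b\<^sup>2 * (of_real t)\<^sup>2))"
  have Rd: "Re (2 * ?pi * of_nat (Suc d) * \<omega>) > 0" for d using om by simp
  have f_eq: "f d t = h t * exp (- of_nat (Suc d) * u t)" for d t
  proof -
    have "- (2 * ?pi * of_nat (Suc d) * \<omega>) * of_real t = - of_nat (Suc d) * u t"
      unfolding u_def by (simp del: of_nat_Suc)
    then show ?thesis unfolding f_def h_def by simp
  qed
  have if': "integrable pos_lborel (f d)" for d
    unfolding f_def by (intro integrable_ray_kernel s0 b Rd)
  have intf: "(\<integral>t. f d t \<partial>pos_lborel) = ray_integral s b (2 * ?pi * of_nat (Suc d) * \<omega>)" for d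
    unfolding f_def ray_integral_def by simp
  have suf: "AE t in pos_lborel. summable (\<lambda>d. norm (f d t))"
    by (rule AE_I2) (simp only: f_eq norm_mult space_pos_lborel greaterThan_iff, intro summable_mult exp_geometric_sums Ru)
  have sif: "summable (\<lambda>d. \<integral>t. norm (f d t) \<partial>pos_lborel)"
  proof (rule summable_comparison_test')
    show "summable (\<lambda>d. real (Suc d) powr (- Re s) * (Gamma (Re s) * (2 * pi * Re \<omega>) powr (- Re s) / \<delta>))"
      using s by (intro summable_mult2 summable_Suc_powr) auto
    fix d :: nat
    have R: "Re (2 * ?pi * of_nat (Suc d) * \<omega>) = real (Suc d) * (2 * pi * Re \<omega>)" by simp
    have i: "integrable pos_lborel (\<lambda>t. t powr (Re s - 1) * exp (- (Re (2 * ?pi * of_nat (Suc d) * \<omega>) * t)) / \<delta>)"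
      by (intro integrable_divide Gamma_integral_pos_real s0 Rd)
    have "(\<integral>t. norm (f d t) \<partial>pos_lborel) \<le> (\<integral>t. t powr (Re s - 1) * exp (- (Re (2 * ?pi * of_nat (Suc d) * \<omega>) * t)) / \<delta> \<partial>pos_lborel)"
    proof (rule Bochner_Integration.integral_mono[OF integrable_norm[OF if'] i])
      fix t assume "t \<in> space pos_lborel"
      then have "t > 0" by simp
      then show "norm (f d t) \<le> t powr (Re s - 1) * exp (- (Re (2 * ?pi * of_nat (Suc d) * \<omega>) * t)) / \<delta>"
        unfolding f_def by (rule norm_ray_kernel_le(1)[OF \<delta>])
    qed
    also have "\<dots> = Gamma (Re s) * Re (2 * ?pi * of_nat (Suc d) * \<omega>) powr (- Re s) / \<delta>"
      by (simp only: integral_divide_zero Gamma_integral_pos_real(2)[OF s0(1) Rd])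
    also have "\<dots> = real (Suc d) powr (- Re s) * (Gamma (Re s) * (2 * pi * Re \<omega>) powr (- Re s) / \<delta>)"
      unfolding R using om by (subst powr_mult) auto
    finally show "norm (\<integral>t. norm (f d t) \<partial>pos_lborel) \<le> real (Suc d) powr (- Re s) * (Gamma (Re s) * (2 * pi * Re \<omega>) powr (- Re s) / \<delta>)"
      by simp
  qed
  define I0 where "I0 = (\<integral>t. h t * (1 / (exp (u t) - 1)) \<partial>pos_lborel)"
  have sumf: "(\<Sum>d. f d t) = h t * (1 / (exp (u t) - 1))" if "t \<in> space pos_lborel" for t
    unfolding f_eq using that by (intro sums_unique[symmetric] sums_mult exp_geometric_sums Ru) auto
  have iI0: "integrable pos_lborel (\<lambda>t. h t * (1 / (exp (u t) - 1)))"
  proof -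
    have "integrable pos_lborel (\<lambda>t. \<Sum>d. f d t) \<longleftrightarrow> integrable pos_lborel (\<lambda>t. h t * (1 / (exp (u t) - 1)))"
      by (rule Bochner_Integration.integrable_cong[OF refl sumf])
    then show ?thesis using integrable_suminf[OF if' suf sif] by blast
  qed
  have sumsf: "(\<lambda>d. ray_integral s b (2 * ?pi * of_nat (Suc d) * \<omega>)) sums I0"
  proof -
    have "(\<integral>t. (\<Sum>d. f d t) \<partial>pos_lborel) = I0"
      unfolding I0_def by (rule Bochner_Integration.integral_cong[OF refl sumf])
    then show ?thesis using sums_integral[OF if' suf sif] by (simp only: intf)
  qed
  define G where "G = (\<lambda>k t. of_real t powr s / ((1 + b\<^sup>2 * (of_real t)\<^sup>2) * ((of_real (real (Suc k)))\<^sup>2 + \<omega>\<^sup>2 * (of_real t)\<^sup>2)) :: complex)"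
  have G_eq: "h t * (2 * u t / ((u t)\<^sup>2 + 4 * ?pi\<^sup>2 * (of_nat (Suc k))\<^sup>2)) = (\<omega> / ?pi) * G k t" if t: "t > 0" for k t
  proof -
    have "(u t)\<^sup>2 + 4 * ?pi\<^sup>2 * (of_nat (Suc k))\<^sup>2 = (4 * ?pi\<^sup>2) * ((of_nat (Suc k))\<^sup>2 + \<omega>\<^sup>2 * (of_real t)\<^sup>2)"
      unfolding u_def by (simp add: power_mult_distrib algebra_simps)
    moreover have "2 * u t = (4 * ?pi\<^sup>2) * (\<omega> / ?pi * of_real t)"
      unfolding u_def by (simp add: power2_eq_square)
    moreover have "4 * ?pi\<^sup>2 \<noteq> 0" by simp
    ultimately have "2 * u t / ((u t)\<^sup>2 + 4 * ?pi\<^sup>2 * (of_nat (Suc k))\<^sup>2) = (\<omega> / ?pi * of_real t) / ((of_nat (Suc k))\<^sup>2 + \<omega>\<^sup>2 * (of_real t)\<^sup>2)"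
      by (metis mult_divide_mult_cancel_left)
    moreover have "complex_of_real t powr s = of_real t powr (s - 1) * of_real t"
      using t by (simp add: powr_diff)
    ultimately show ?thesis unfolding G_def h_def by (simp add: mult_ac)
  qed
  have iG: "integrable pos_lborel (G k)" for k
    unfolding G_def \<omega>_def by (rule mixed_kernel_integral(2)[OF s b e w pos]) simp
  have vG: "(\<integral>t. G k t \<partial>pos_lborel) = - X / (b\<^sup>2 * (w\<^sup>2 + (of_nat (Suc k))\<^sup>2)) * (b powr (1 - s) - (\<omega> / of_nat (Suc k)) powr (1 - s))" for k
    using mixed_kernel_integral(1)[OF s b e w pos, of "real (Suc k)"] unfolding G_def \<omega>_def X_def by simp
  \<comment> \<open>The sum over k needs p > 1 and the remaining Beta integral needs Re s + p - 1 <
    2; this p is the midpoint between 1 and 3 - Re s.\<close>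
  define p where "p = 2 - Re s / 2"
  have p: "1 < p" "p < 2" "0 < Re s + p - 1" "Re s + p - 1 < 2" using s by (auto simp: p_def)
  have sG: "summable (\<lambda>k. \<integral>t. norm (G k t) \<partial>pos_lborel)"
  proof (rule summable_comparison_test')
    define B where "B = (\<lambda>t. t powr ((Re s + p - 1) - 1) / (1 + t\<^sup>2) / (\<delta> * \<eta>))"
    have iB: "integrable pos_lborel B" unfolding B_def by (intro integrable_divide integrable_Beta_real p)
    show "summable (\<lambda>k. real (Suc k) powr (- p) * (\<integral>t. B t \<partial>pos_lborel))"
      using p by (intro summable_mult2 summable_Suc_powr) auto
    fix k :: nat
    have "norm (G k t) \<le> real (Suc k) powr (- p) * B t" if t: "t \<in> space pos_lborel" for t
    proof -
      have t0: "t > 0" using t by simp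
      define K where "K = real (Suc k)"
      have K: "K > 0" by (simp add: K_def)
      have q: "\<eta> * (K\<^sup>2 + t\<^sup>2) \<le> norm ((of_real K)\<^sup>2 + \<omega>\<^sup>2 * (of_real t)\<^sup>2)" by (rule \<eta>(2)[OF K])
      have "\<eta> * (K powr p * t powr (2 - p)) \<le> \<eta> * (K\<^sup>2 + t\<^sup>2)"
        using K t0 p \<eta> by (intro mult_left_mono Young_powr) auto
      with q have q': "\<eta> * (K powr p * t powr (2 - p)) \<le> norm ((of_real K)\<^sup>2 + \<omega>\<^sup>2 * (of_real t)\<^sup>2)" by linarith
      have pp: "0 < \<delta> * (1 + t\<^sup>2)" "0 < \<eta> * (K powr p * t powr (2 - p))"
        using \<delta> \<eta> K t0 by (auto intro!: mult_pos_pos add_pos_nonneg)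
      have "norm (G k t) = t powr Re s / (norm (1 + b\<^sup>2 * (of_real t)\<^sup>2) * norm ((of_real K)\<^sup>2 + \<omega>\<^sup>2 * (of_real t)\<^sup>2))"
        using t0 unfolding G_def K_def by (simp only: norm_divide norm_mult norm_cpow)
      also have "\<dots> \<le> t powr Re s / ((\<delta> * (1 + t\<^sup>2)) * (\<eta> * (K powr p * t powr (2 - p))))"
        by (intro divide_left_mono mult_mono \<delta> q' mult_pos_pos less_le_trans[OF pp(1) \<delta>(2)] less_le_trans[OF pp(2) q'] pp)
           (use pp in auto)
      also have "\<dots> = K powr (- p) * B t"
      proof -
        have "t powr Re s / t powr (2 - p) = t powr ((Re s + p - 1) - 1)"
          using t0 by (simp add: algebra_simps flip: powr_diff)
        then have "t powr Re s = t powr ((Re s + p - 1) - 1) * t powr (2 - p)"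
          using t0 by (simp add: field_simps)
        then show ?thesis unfolding B_def using t0 by (simp add: powr_minus divide_inverse mult_ac)
      qed
      finally show ?thesis by (simp only: K_def)
    qed
    then have "(\<integral>t. norm (G k t) \<partial>pos_lborel) \<le> (\<integral>t. real (Suc k) powr (- p) * B t \<partial>pos_lborel)"
      by (intro Bochner_Integration.integral_mono integrable_norm iG integrable_mult_right iB)
    then show "norm (\<integral>t. norm (G k t) \<partial>pos_lborel) \<le> real (Suc k) powr (- p) * (\<integral>t. B t \<partial>pos_lborel)"
      by simp
  qed
  have aG: "AE t in pos_lborel. summable (\<lambda>k. norm (G k t))"
  proof (rule AE_I2)
    fix t assume "t \<in> space pos_lborel"
    then have t: "t > 0" by simp
    show "summable (\<lambda>k. norm (G k t))"
    proof (rule summable_comparison_test')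
      show "summable (\<lambda>k. real (Suc k) powr (- 2) * (norm (h t * of_real t) / \<eta>))"
        by (intro summable_mult2 summable_Suc_powr) auto
      fix k :: nat
      define K where "K = real (Suc k)"
      have K: "K > 0" by (simp add: K_def)
      have "\<eta> * K\<^sup>2 \<le> \<eta> * (K\<^sup>2 + t\<^sup>2)" using \<eta>(1) by simp
      then have q: "\<eta> * K\<^sup>2 \<le> norm ((of_real K)\<^sup>2 + \<omega>\<^sup>2 * (of_real t)\<^sup>2)" using \<eta>(2)[OF K, of t] by linarith
      have "G k t = (h t * of_real t) / ((of_real K)\<^sup>2 + \<omega>\<^sup>2 * (of_real t)\<^sup>2)"
        unfolding G_def h_def K_def using t by (simp add: powr_diff)
      then have "norm (G k t) = norm (h t * of_real t) / norm ((of_real K)\<^sup>2 + \<omega>\<^sup>2 * (of_real t)\<^sup>2)"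
        by (simp only: norm_divide)
      also have "\<dots> \<le> norm (h t * of_real t) / (\<eta> * K\<^sup>2)"
        using K \<eta>(1) q by (intro frac_le) auto
      also have "\<dots> = K powr (- 2) * (norm (h t * of_real t) / \<eta>)"
        using K by (simp add: powr_minus divide_inverse mult_ac)
      finally show "norm (norm (G k t)) \<le> real (Suc k) powr (- 2) * (norm (h t * of_real t) / \<eta>)"
        unfolding K_def by simp
    qed
  qed
  have sumG: "(\<Sum>k. G k t) = (?pi / \<omega>) * (h t * (1 / (exp (u t) - 1)) - g t / (2 * ?pi * \<omega>) + h t / 2)"
    if t: "t \<in> space pos_lborel" for t
  proof -
    have t0: "t > 0" using t by simp
    have "(\<lambda>k. h t * (2 * u t / ((u t)\<^sup>2 + 4 * ?pi\<^sup>2 * (of_nat (Suc k))\<^sup>2))) sums (h t * (1 / (exp (u t) - 1) - 1 / u t + 1 / 2))"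
      by (intro sums_mult Planck_partial_fractions Ru t0)
    then have "(\<lambda>k. (?pi / \<omega>) * ((\<omega> / ?pi) * G k t)) sums ((?pi / \<omega>) * (h t * (1 / (exp (u t) - 1) - 1 / u t + 1 / 2)))"
      unfolding G_eq[OF t0] by (rule sums_mult)
    moreover have "(?pi / \<omega>) * ((\<omega> / ?pi) * G k t) = G k t" for k using nz by simp
    moreover have "h t * (1 / u t) = g t / (2 * ?pi * \<omega>)"
      unfolding h_def g_def u_def using t0 by (simp add: powr_diff power2_eq_square)
    moreover have "h t * (1 / (exp (u t) - 1) - 1 / u t + 1 / 2) = h t * (1 / (exp (u t) - 1)) - h t * (1 / u t) + h t / 2"
      by (simp add: algebra_simps)
    ultimately show ?thesis by (simp add: sums_iff)
  qed
  have sumsG: "(\<lambda>k. \<integral>t. G k t \<partial>pos_lborel) sums ((?pi / \<omega>) * (I0 - b powr (- (s - 1)) * X / (2 * ?pi * \<omega>) + b powr (- s) * Y / 2))"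
  proof -
    have "(\<integral>t. (\<Sum>k. G k t) \<partial>pos_lborel) =
        (\<integral>t. (?pi / \<omega>) * (h t * (1 / (exp (u t) - 1)) - g t / (2 * ?pi * \<omega>) + h t / 2) \<partial>pos_lborel)"
      by (rule Bochner_Integration.integral_cong[OF refl sumG])
    also have "\<dots> = (?pi / \<omega>) * (I0 - (\<integral>t. g t \<partial>pos_lborel) / (2 * ?pi * \<omega>) + (\<integral>t. h t \<partial>pos_lborel) / 2)"
      unfolding I0_def
      by (simp only: integral_mult_right_zero integral_divide_zero
          Bochner_Integration.integral_add[OF Bochner_Integration.integrable_diff[OF iI0 integrable_divide[OF ig]] integrable_divide[OF ih]]
          Bochner_Integration.integral_diff[OF iI0 integrable_divide[OF ig]])
    finally show ?thesis using sums_integral[OF iG aG sG] by (simp only: vg vh)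
  qed
  show ?thesis
  proof (rule that[of "b powr s * I0"])
    show "(\<lambda>d. b powr s * ray_integral s b (2 * ?pi * of_nat (Suc d) * (- e * w * b))) sums (b powr s * I0)"
      using sums_mult[OF sumsf] unfolding \<omega>_def .
    have bb: "b powr s * b powr (- s) = 1" "b powr s * b powr (- (s - 1)) = b"
      using nz by (simp_all flip: powr_add)
    have be: "b / \<omega> = e / w"
      unfolding \<omega>_def using nz ee by (simp add: field_simps)
    have "(\<lambda>k. b powr s * (\<omega> / ?pi) * (\<integral>t. G k t \<partial>pos_lborel)) sums
        (b powr s * (\<omega> / ?pi) * ((?pi / \<omega>) * (I0 - b powr (- (s - 1)) * X / (2 * ?pi * \<omega>) + b powr (- s) * Y / 2)))"
      by (intro sums_mult sumsG)
    also have "b powr s * (\<omega> / ?pi) * ((?pi / \<omega>) * (I0 - b powr (- (s - 1)) * X / (2 * ?pi * \<omega>) + b powr (- s) * Y / 2)) =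
       b powr s * I0 - (b powr s * b powr (- (s - 1))) / \<omega> * X / (2 * ?pi) + (b powr s * b powr (- s)) * Y / 2"
      using nz by (simp add: algebra_simps)
    also have "\<dots> = b powr s * I0 - e * X / (2 * ?pi * w) + Y / 2"
      unfolding bb be by simp
    also have "(\<lambda>k. b powr s * (\<omega> / ?pi) * (\<integral>t. G k t \<partial>pos_lborel)) =
        (\<lambda>k. X / (?pi * (w\<^sup>2 + (of_nat (Suc k))\<^sup>2)) * (e * w - e powr s * w powr (2 - s) * of_nat (Suc k) powr (s - 1)))"
    proof
      fix k
      define K where "K = complex_of_nat (Suc k)"
      have Kp: "K = of_real (real (Suc k))" by (simp add: K_def)
      have q1: "b powr s * b powr (1 - s) = b" using nz by (simp flip: powr_add)
      have ew: "- e = \<i> \<or> - e = - \<i>" using e by auto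
      have nege: "(- e) powr v = e powr (- v)" for v
        using e by (auto simp: powr_ii powr_minus_ii)
      have om1: "\<omega> powr (1 - s) = e powr (s - 1) * w powr (1 - s) * b powr (1 - s)"
        unfolding \<omega>_def using ii_powr_mult3[OF ew w b pos, of "1 - s"] nege[of "1 - s"] by simp
      have "(\<omega> / K) powr (1 - s) = \<omega> powr (1 - s) * K powr (s - 1)"
      proof -
        have "(of_real (1 / real (Suc k)) * \<omega>) powr (1 - s) = of_real (1 / real (Suc k)) powr (1 - s) * \<omega> powr (1 - s)"
          by (intro powr_times_real_left) auto
        moreover have "K powr (1 - s) * complex_of_real (1 / real (Suc k)) powr (1 - s) = 1"
          unfolding Kp by (subst cpow_mult[symmetric]) auto
        then have "complex_of_real (1 / real (Suc k)) powr (1 - s) = K powr (s - 1)"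
          using inverse_unique powr_minus[of K "1 - s"] by (metis minus_diff_eq)
        moreover have "of_real (1 / real (Suc k)) * \<omega> = \<omega> / K" by (simp add: Kp)
        ultimately show ?thesis by (metis mult.commute)
      qed
      also have "\<dots> = e powr (s - 1) * w powr (1 - s) * K powr (s - 1) * b powr (1 - s)"
        unfolding om1 by simp
      finally have om2: "(\<omega> / K) powr (1 - s) = e powr (s - 1) * w powr (1 - s) * K powr (s - 1) * b powr (1 - s)" .
      have pe: "e powr (s - 1) = - e * e powr s"
      proof -
        have "e powr (s - 1) = e powr s / e" using nz by (simp add: powr_diff)
        also have "1 / e = - e" using nz ee by (simp add: field_simps)
        then have "e powr s / e = - e * e powr s" by (simp add: divide_inverse)
        finally show ?thesis .
      qed
      have pw: "w powr (2 - s) = w * w powr (1 - s)"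
        using nz by (simp add: powr_diff power2_eq_square)
      have wb: "\<omega> * b / b\<^sup>2 = - e * w" unfolding \<omega>_def using nz by (simp add: power2_eq_square)
      have "b powr s * (\<omega> / ?pi) * (\<integral>t. G k t \<partial>pos_lborel) =
         b powr s * (\<omega> / ?pi) * (- X / (b\<^sup>2 * (w\<^sup>2 + K\<^sup>2)) * (b powr (1 - s) - e powr (s - 1) * w powr (1 - s) * K powr (s - 1) * b powr (1 - s)))"
        unfolding vG K_def[symmetric] om2 ..
      also have "\<dots> = - X / (?pi * (w\<^sup>2 + K\<^sup>2)) * (\<omega> * (b powr s * b powr (1 - s)) / b\<^sup>2) * (1 - e powr (s - 1) * w powr (1 - s) * K powr (s - 1))"
      proof -
        have "B * (u / p) * (- X / (c * W) * (v - E * F * G * v)) = - X / (p * W) * (u * (B * v) / c) * (1 - E * F * G)"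
          for B u p c W v E F G :: complex
        proof -
          have "v - E * F * G * v = (1 - E * F * G) * v" by (simp add: left_diff_distrib)
          then show ?thesis by (simp only: divide_inverse inverse_mult_distrib mult_ac)
        qed
        then show ?thesis .
      qed
      also have "\<dots> = X / (?pi * (w\<^sup>2 + K\<^sup>2)) * (e * w * (1 + e * e powr s * w powr (1 - s) * K powr (s - 1)))"
        unfolding q1 wb pe by simp
      also have "e * w * (1 + e * e powr s * w powr (1 - s) * K powr (s - 1)) = e * w + (e * e) * e powr s * (w * w powr (1 - s)) * K powr (s - 1)"
        by (simp add: algebra_simps)
      also have "\<dots> = e * w - e powr s * w powr (2 - s) * K powr (s - 1)"
        unfolding ee pw by simp
      finally show "b powr s * (\<omega> / ?pi) * (\<integral>t. G k t \<partial>pos_lborel) =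
        X / (?pi * (w\<^sup>2 + (of_nat (Suc k))\<^sup>2)) * (e * w - e powr s * w powr (2 - s) * of_nat (Suc k) powr (s - 1))"
        by (simp only: K_def)
    qed
    finally show "(\<lambda>k. X / (?pi * (w\<^sup>2 + (of_nat (Suc k))\<^sup>2)) * (e * w - e powr s * w powr (2 - s) * of_nat (Suc k) powr (s - 1)))
       sums (b powr s * I0 - e * X / (2 * ?pi * w) + Y / 2)" .
  qed
qed

text \<open>Abel--Plana summation along the two rays; the residues at the points \<open>k / w\<close> appear
  through the partial fractions of \<open>1 / (exp u - 1)\<close>.\<close>

theorem wedge_integral_sums:
  assumes s: "1 < Re s" "Re s < 2" and \<epsilon>: "\<epsilon> > 0" and w: "w \<in> wedge \<epsilon>"
  obtains S where
    "(\<lambda>d. of_real pi * wedge_integral \<epsilon> s (2 * of_real pi * of_nat (Suc d) * w)) sums S"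
    "(\<lambda>k. w powr (2 - s) * of_nat (Suc k) powr (s - 1) / (w\<^sup>2 + (of_nat (Suc k))\<^sup>2)) sums
       (S + of_real pi / (2 * sin (of_real pi * s / 2)))"
proof -
  let ?pi = "complex_of_real pi"
  define X where "X = ?pi / (2 * sin (?pi * (s - 1) / 2))"
  define Y where "Y = ?pi / (2 * sin (?pi * s / 2))"
  let ?b = "of_real \<epsilon> + \<i>" and ?c = "of_real \<epsilon> - \<i>"
  have b: "Re ?b > 0" "Re ?c > 0" using \<epsilon> by auto
  have Rw: "Re w > 0" by (rule wedge_Re_pos[OF w])
  have x: "- \<i> * w * ?b = w * (1 - \<i> * of_real \<epsilon>)" "- (- \<i>) * w * ?c = w * (1 + \<i> * of_real \<epsilon>)"
    by (simp_all add: algebra_simps)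
  have pos: "Re (- \<i> * w * ?b) > 0" "Re (- (- \<i>) * w * ?c) > 0"
    unfolding x using w by (simp_all add: wedge_def)
  obtain I where I: "(\<lambda>d. ?b powr s * ray_integral s ?b (2 * ?pi * of_nat (Suc d) * (- \<i> * w * ?b))) sums I"
    "(\<lambda>k. X / (?pi * (w\<^sup>2 + (of_nat (Suc k))\<^sup>2)) * (\<i> * w - \<i> powr s * w powr (2 - s) * of_nat (Suc k) powr (s - 1)))
       sums (I - \<i> * X / (2 * ?pi * w) + Y / 2)"
    using ray_integral_sums[OF s b(1) _ Rw pos(1)] unfolding X_def Y_def by blast
  obtain J where J: "(\<lambda>d. ?c powr s * ray_integral s ?c (2 * ?pi * of_nat (Suc d) * (- (- \<i>) * w * ?c))) sums J"
    "(\<lambda>k. X / (?pi * (w\<^sup>2 + (of_nat (Suc k))\<^sup>2)) * ((- \<i>) * w - (- \<i>) powr s * w powr (2 - s) * of_nat (Suc k) powr (s - 1)))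
       sums (J - (- \<i>) * X / (2 * ?pi * w) + Y / 2)"
    using ray_integral_sums[OF s b(2) _ Rw pos(2)] unfolding X_def Y_def by blast
  show ?thesis
  proof (rule that[of "I + J"])
    have "(\<lambda>d. ?b powr s * ray_integral s ?b (2 * ?pi * of_nat (Suc d) * (- \<i> * w * ?b)) +
        ?c powr s * ray_integral s ?c (2 * ?pi * of_nat (Suc d) * (- (- \<i>) * w * ?c))) sums (I + J)"
      by (intro sums_add I J)
    then show "(\<lambda>d. ?pi * wedge_integral \<epsilon> s (2 * ?pi * of_nat (Suc d) * w)) sums (I + J)"
      unfolding wedge_integral_def x by (simp add: mult.assoc)
    \<comment> \<open>The denominator of \<open>X\<close> contains sin(pi (s - 1) / 2) = -cos(pi s /
      2), which cancels the cosine in the sum of the two powers. The terms with i w and -i w cancel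
      between the rays.\<close>
    have XC: "X * (\<i> powr s + (- \<i>) powr s) = - ?pi"
    proof -
      have "sin (?pi * (s - 1) / 2) \<noteq> 0" using s by (intro complex_sin_half_neq_0) auto
      moreover have "sin (?pi * (s - 1) / 2) = - cos (?pi * s / 2)"
        using sin_diff[of "?pi * s / 2" "?pi / 2"] by (simp add: right_diff_distrib diff_divide_distrib)
      ultimately show ?thesis unfolding X_def ii_powr_add by simp
    qed
    have "(\<lambda>k. X / (?pi * (w\<^sup>2 + (of_nat (Suc k))\<^sup>2)) * (\<i> * w - \<i> powr s * w powr (2 - s) * of_nat (Suc k) powr (s - 1))
        + X / (?pi * (w\<^sup>2 + (of_nat (Suc k))\<^sup>2)) * ((- \<i>) * w - (- \<i>) powr s * w powr (2 - s) * of_nat (Suc k) powr (s - 1))) sums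
       ((I - \<i> * X / (2 * ?pi * w) + Y / 2) + (J - (- \<i>) * X / (2 * ?pi * w) + Y / 2))"
      by (intro sums_add I J)
    also have "(I - \<i> * X / (2 * ?pi * w) + Y / 2) + (J - (- \<i>) * X / (2 * ?pi * w) + Y / 2) = I + J + Y"
      by simp
    also have "(\<lambda>k. X / (?pi * (w\<^sup>2 + (of_nat (Suc k))\<^sup>2)) * (\<i> * w - \<i> powr s * w powr (2 - s) * of_nat (Suc k) powr (s - 1))
        + X / (?pi * (w\<^sup>2 + (of_nat (Suc k))\<^sup>2)) * ((- \<i>) * w - (- \<i>) powr s * w powr (2 - s) * of_nat (Suc k) powr (s - 1)))
       = (\<lambda>k. w powr (2 - s) * of_nat (Suc k) powr (s - 1) / (w\<^sup>2 + (of_nat (Suc k))\<^sup>2))"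
    proof
      fix k
      have "X / (?pi * W) * (\<i> * w - p * u * v) + X / (?pi * W) * ((- \<i>) * w - q * u * v) = - (X * (p + q)) / ?pi * (u * v / W)" for W p q u v
        by (simp add: divide_inverse algebra_simps)
      then show "X / (?pi * (w\<^sup>2 + (of_nat (Suc k))\<^sup>2)) * (\<i> * w - \<i> powr s * w powr (2 - s) * of_nat (Suc k) powr (s - 1))
        + X / (?pi * (w\<^sup>2 + (of_nat (Suc k))\<^sup>2)) * ((- \<i>) * w - (- \<i>) powr s * w powr (2 - s) * of_nat (Suc k) powr (s - 1))
        = w powr (2 - s) * of_nat (Suc k) powr (s - 1) / (w\<^sup>2 + (of_nat (Suc k))\<^sup>2)"
        by (simp only: XC) simp
    qed
    finally show "(\<lambda>k. w powr (2 - s) * of_nat (Suc k) powr (s - 1) / (w\<^sup>2 + (of_nat (Suc k))\<^sup>2)) sums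
       (I + J + ?pi / (2 * sin (?pi * s / 2)))" unfolding Y_def .
  qed
qed

section \<open>The continuation of the zeta function\<close>

lemma norm_Suc_powr: "norm (complex_of_nat (Suc n) powr s) = real (Suc n) powr Re s"
  using norm_cpow[of "real (Suc n)" s] by simp

lemma summable_Suc_powr_complex: "Re s < -1 \<Longrightarrow> summable (\<lambda>n. norm (complex_of_nat (Suc n) powr s))"
  unfolding norm_Suc_powr by (rule summable_Suc_powr)

definition dirichlet_zeta :: "complex \<Rightarrow> complex" where
  "dirichlet_zeta s = (\<Sum>n. of_nat (Suc n) powr (- s))"

lemma dirichlet_zeta_sums: "Re s > 1 \<Longrightarrow> (\<lambda>n. of_nat (Suc n) powr (- s)) sums dirichlet_zeta s"
  unfolding dirichlet_zeta_def
  by (intro summable_sums summable_norm_cancel[OF summable_Suc_powr_complex]) auto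

lemma holomorphic_dirichlet_zeta: "dirichlet_zeta holomorphic_on {s. 1 < Re s}"
  unfolding dirichlet_zeta_def
proof (rule holomorphic_on_suminf[OF open_Re_gt])
  show "(\<lambda>s. of_nat (Suc n) powr - s) holomorphic_on {s. 1 < Re s}" for n
    by (intro holomorphic_intros)
  fix x :: complex assume x: "x \<in> {s. 1 < Re s}"
  define r where "r = (Re x - 1) / 2"
  have r: "r > 0" "Re x - r > 1" using x by (auto simp: r_def field_simps)
  have "norm (complex_of_nat (Suc n) powr - y) \<le> real (Suc n) powr (- (Re x - r))" if "y \<in> ball x r" for n y
    unfolding norm_Suc_powr using Re_dist_less[OF that] by (intro powr_mono) auto
  with r show "\<exists>d>0. \<exists>M. summable M \<and> (\<forall>n. \<forall>y\<in>ball x d \<inter> {s. 1 < Re s}. norm (complex_of_nat (Suc n) powr - y) \<le> M n)"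
    by (intro exI[of _ r] conjI exI[of _ "\<lambda>n. real (Suc n) powr (- (Re x - r))"] summable_Suc_powr) auto
qed

text \<open>The generalised binomial coefficient of 1 - s over k, that is, the Taylor coefficient of
  (1 + x)^(1 - s) at 0.\<close>

definition shift_coeff :: "nat \<Rightarrow> complex \<Rightarrow> complex" where
  "shift_coeff k s = (\<Prod>j<k. 1 - s - of_nat j) / fact k"

text \<open>With x = 1 / (n + 1) this is (n + 1)^(1 - s) times the Taylor remainder of order N of (1
  + x)^(1 - s), hence of size (n + 1)^(-Re s - N): larger N gives convergence further to the
  left.\<close>

definition shift_remainder :: "nat \<Rightarrow> nat \<Rightarrow> complex \<Rightarrow> complex" where
  "shift_remainder N n s = of_nat (Suc (Suc n)) powr (1 - s) -
     (\<Sum>k\<le>N. shift_coeff k s * of_nat (Suc n) powr (1 - s - of_nat k))"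

text \<open>The numerator bounds the derivative of order N + 1 on the segment from 0 to 1, uniformly
  for norm s <= rho; that uniformity makes the remainder series holomorphic in s.\<close>

lemma binomial_Taylor_bound:
  fixes s :: complex and x \<rho> :: real
  assumes x: "0 \<le> x" "x \<le> 1" and s: "norm s \<le> \<rho>"
  shows "norm (of_real (1 + x) powr (1 - s) - (\<Sum>k\<le>N. shift_coeff k s * of_real x ^ k))
     \<le> ((\<Prod>j<Suc N. 1 + \<rho> + real j) * 2 powr (1 + \<rho>)) / fact N * x ^ Suc N"
proof -
  define f where "f = (\<lambda>i z. (\<Prod>j<i. 1 - s - of_nat j) * (1 + z) powr (1 - s - of_nat i))"
  let ?S = "closed_segment (0::complex) 1"
  have S: "\<exists>u. z = of_real u \<and> 0 \<le> u \<and> u \<le> 1" if "z \<in> ?S" for z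
    using that by (auto simp: in_segment scaleR_conv_of_real)
  have "\<rho> \<ge> 0" using s norm_ge_zero order_trans by blast
  have "norm (f 0 (of_real x) - (\<Sum>i\<le>N. f i 0 * (of_real x - 0) ^ i / fact i))
     \<le> ((\<Prod>j<Suc N. 1 + \<rho> + real j) * 2 powr (1 + \<rho>)) * norm (of_real x - (0::complex)) ^ Suc N / fact N"
  proof (rule complex_Taylor[of ?S])
    fix i and z :: complex assume z: "z \<in> ?S"
    obtain u where u: "z = of_real u" "0 \<le> u" "u \<le> 1" using S[OF z] by blast
    have "1 + z \<notin> \<real>\<^sub>\<le>\<^sub>0" using u by (auto simp: complex_nonpos_Reals_iff)
    then have "((\<lambda>z. (1 + z) powr (1 - s - of_nat i)) has_field_derivative
        ((1 - s - of_nat i) * (1 + z) powr (1 - s - of_nat i - 1) * (0 + 1))) (at z within ?S)"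
      by (intro DERIV_chain2[OF has_field_derivative_powr] DERIV_add DERIV_const DERIV_ident)
    from DERIV_cmult[OF this, of "\<Prod>j<i. 1 - s - of_nat j"]
    show "(f i has_field_derivative f (Suc i) z) (at z within ?S)"
      unfolding f_def by (simp add: algebra_simps)
    next
    fix z :: complex assume z: "z \<in> ?S"
    obtain u where u: "z = of_real u" "0 \<le> u" "u \<le> 1" using S[OF z] by blast
    have "norm (\<Prod>j<Suc N. 1 - s - of_nat j) \<le> (\<Prod>j<Suc N. 1 + \<rho> + real j)"
    proof (rule order_trans[OF norm_prod_le prod_mono], intro conjI)
      fix j
      have "norm (1 - s - of_nat j) \<le> norm (1 - s) + norm (of_nat j :: complex)" by (rule norm_triangle_ineq4)
      also have "norm (1 - s) \<le> norm (1::complex) + norm s" by (rule norm_triangle_ineq4)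
      finally show "norm (1 - s - of_nat j) \<le> 1 + \<rho> + real j" using s by simp
    qed auto
    moreover have "norm ((1 + z) powr (1 - s - of_nat (Suc N))) \<le> 2 powr (1 + \<rho>)"
    proof -
      have "1 + z = of_real (1 + u)" using u by simp
      then have "norm ((1 + z) powr (1 - s - of_nat (Suc N))) = (1 + u) powr Re (1 - s - of_nat (Suc N))"
        using u by (simp only:) (subst norm_cpow, auto)
      also have "\<dots> \<le> (1 + u) powr (1 + \<rho>)"
        using u s abs_Re_le_cmod[of s] by (intro powr_mono) auto
      also have "\<dots> \<le> 2 powr (1 + \<rho>)" using u \<open>\<rho> \<ge> 0\<close> by (intro powr_mono2) auto
      finally show ?thesis .
    qed
    moreover have "0 \<le> (\<Prod>j<Suc N. 1 + \<rho> + real j)"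
      using \<open>\<rho> \<ge> 0\<close> by (intro prod_nonneg) auto
    ultimately show "norm (f (Suc N) z) \<le> (\<Prod>j<Suc N. 1 + \<rho> + real j) * 2 powr (1 + \<rho>)"
      unfolding f_def norm_mult by (intro mult_mono norm_ge_zero)
  qed (use x in \<open>auto simp: in_segment scaleR_conv_of_real\<close>)
  then show ?thesis
    unfolding f_def shift_coeff_def using x by (simp add: mult_ac)
qed

lemma shift_remainder_bound:
  assumes "norm s \<le> \<rho>"
  shows "norm (shift_remainder N n s) \<le>
     ((\<Prod>j<Suc N. 1 + \<rho> + real j) * 2 powr (1 + \<rho>)) / fact N * real (Suc n) powr (- Re s - real N)"
proof -
  define x where "x = 1 / real (Suc n)"
  define K where "K = real (Suc n)"
  have K: "K > 0" "x = 1 / K" by (simp_all add: K_def x_def)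
  have x: "0 \<le> x" "x \<le> 1" "x > 0" by (auto simp: x_def)
  let ?C = "((\<Prod>j<Suc N. 1 + \<rho> + real j) * 2 powr (1 + \<rho>)) / fact N"
  have "K * (1 + x) = K + 1" using K by (simp add: distrib_left)
  then have "complex_of_nat (Suc (Suc n)) = of_real (K * (1 + x))"
    by (simp add: K_def)
  then have 1: "complex_of_nat (Suc (Suc n)) powr (1 - s) = of_real K powr (1 - s) * of_real (1 + x) powr (1 - s)"
    using K x by (simp only: cpow_mult)
  have 2: "complex_of_nat (Suc n) powr (1 - s - of_nat k) = of_real K powr (1 - s) * of_real x ^ k" for k
  proof -
    have "complex_of_nat (Suc n) powr (1 - s - of_nat k) = of_real K powr (1 - s) * of_real K powr (- of_nat k)"
      unfolding K_def by (simp flip: powr_add)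
    also have "complex_of_real K powr (- of_nat k) = of_real x ^ k"
      unfolding powr_minus using K by (subst powr_complexpow) (auto simp: power_divide inverse_eq_divide)
    finally show ?thesis .
  qed
  have "shift_remainder N n s = of_real K powr (1 - s) * (of_real (1 + x) powr (1 - s) - (\<Sum>k\<le>N. shift_coeff k s * of_real x ^ k))"
    unfolding shift_remainder_def 1 2 right_diff_distrib sum_distrib_left by (simp add: mult_ac)
  then have "norm (shift_remainder N n s) = K powr (1 - Re s) * norm (of_real (1 + x) powr (1 - s) - (\<Sum>k\<le>N. shift_coeff k s * of_real x ^ k))"
    by (simp only: norm_mult norm_cpow[OF K(1)] minus_complex.sel one_complex.sel)
  also have "\<dots> \<le> K powr (1 - Re s) * (?C * x ^ Suc N)"
    by (intro mult_left_mono binomial_Taylor_bound x assms) auto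
  also have "K powr (1 - Re s) * (?C * x ^ Suc N) = ?C * (K powr (1 - Re s) * x ^ Suc N)" by simp
  also have "x ^ Suc N = K powr (- real (Suc N))"
    using K by (simp add: powr_minus powr_realpow power_divide inverse_eq_divide del: of_nat_Suc power_Suc)
  also have "K powr (1 - Re s) * K powr (- real (Suc N)) = K powr (- Re s - real N)"
    by (simp flip: powr_add)
  finally show ?thesis by (simp only: K_def)
qed

lemma holomorphic_shift_coeff: "shift_coeff k holomorphic_on A"
  unfolding shift_coeff_def by (intro holomorphic_intros) auto

lemma holomorphic_shift_remainder_sum:
  "(\<lambda>s. \<Sum>n. shift_remainder N n s) holomorphic_on {s. 1 - real N < Re s}"
proof (rule holomorphic_on_suminf[OF open_Re_gt])
  show "shift_remainder N n holomorphic_on {s. 1 - real N < Re s}" for n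
    unfolding shift_remainder_def by (intro holomorphic_intros holomorphic_shift_coeff)
  fix x :: complex assume x: "x \<in> {s. 1 - real N < Re s}"
  define r where "r = (Re x - (1 - real N)) / 2"
  have r: "r > 0" "Re x - r > 1 - real N" using x by (auto simp: r_def field_simps)
  define \<rho> where "\<rho> = norm x + r"
  let ?C = "((\<Prod>j<Suc N. 1 + \<rho> + real j) * 2 powr (1 + \<rho>)) / fact N"
  have C: "?C \<ge> 0" using r by (auto simp: \<rho>_def intro!: divide_nonneg_nonneg mult_nonneg_nonneg prod_nonneg add_nonneg_nonneg)
  have "norm (shift_remainder N n y) \<le> ?C * real (Suc n) powr (- (Re x - r) - real N)" if "y \<in> ball x r" for n y
  proof -
    have "norm y \<le> \<rho>" using that norm_triangle_ineq2[of y x] by (auto simp: \<rho>_def dist_norm norm_minus_commute)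
    then have "norm (shift_remainder N n y) \<le> ?C * real (Suc n) powr (- Re y - real N)" by (rule shift_remainder_bound)
    also have "\<dots> \<le> ?C * real (Suc n) powr (- (Re x - r) - real N)"
      using Re_dist_less[OF that] by (intro mult_left_mono powr_mono C) auto
    finally show ?thesis .
  qed
  with r show "\<exists>d>0. \<exists>M. summable M \<and> (\<forall>n. \<forall>y\<in>ball x d \<inter> {s. 1 - real N < Re s}. norm (shift_remainder N n y) \<le> M n)"
    by (intro exI[of _ r] conjI exI[of _ "\<lambda>n. ?C * real (Suc n) powr (- (Re x - r) - real N)"] summable_mult summable_Suc_powr) auto
qed

lemma telescope_powr:
  assumes s: "Re s > 1"
  shows "(\<lambda>n. complex_of_nat (Suc (Suc n)) powr (1 - s) - of_nat (Suc n) powr (1 - s)) sums (- 1)"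
proof -
  have "(\<lambda>n. norm (complex_of_nat (Suc n) powr (1 - s))) \<longlonglongrightarrow> 0"
  proof -
    have "(\<lambda>n. real n powr (1 - Re s)) \<longlonglongrightarrow> 0"
      using s by (intro tendsto_neg_powr filterlim_real_sequentially) auto
    from LIMSEQ_Suc[OF this] show ?thesis unfolding norm_Suc_powr by simp
  qed
  then have "(\<lambda>n. complex_of_nat (Suc n) powr (1 - s)) \<longlonglongrightarrow> 0" by (rule tendsto_norm_zero_cancel)
  from telescope_sums[OF this] show ?thesis by simp
qed

text \<open>The differences (n + 2)^(1 - s) - (n + 1)^(1 - s) telescope to -1. Expanded in powers of
  1 / (n + 1), their leading terms sum to (1 - s) zeta(s) and the others to values further right. A
  factor s + j is split off so that only (u - 1) zeta(u) occurs, which has no pole.\<close>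

lemma dirichlet_zeta_shift:
  assumes s: "Re s > 1"
  shows "(s - 1) * dirichlet_zeta s = 1 + (\<Sum>n. shift_remainder (Suc K) n s) -
     (\<Sum>j<K. (\<Prod>i<Suc j. 1 - s - of_nat i) / fact (j + 2) * ((s + of_nat j) * dirichlet_zeta (s + of_nat j + 1)))"
proof -
  have tail: "(\<lambda>n. shift_coeff k s * of_nat (Suc n) powr (1 - s - of_nat k)) sums (shift_coeff k s * dirichlet_zeta (s + of_nat k - 1))"
    if "k \<ge> 1" for k
  proof -
    have "Re (s + of_nat k - 1) > 1" using s that by simp
    from sums_mult[OF dirichlet_zeta_sums[OF this], of "shift_coeff k s"] show ?thesis
      by (simp add: algebra_simps)
  qed
  have split: "(\<Sum>k\<le>Suc K. shift_coeff k s * of_nat (Suc n) powr (1 - s - of_nat k)) =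
      of_nat (Suc n) powr (1 - s) + (\<Sum>k<Suc K. shift_coeff (Suc k) s * of_nat (Suc n) powr (1 - s - of_nat (Suc k)))" for n
    unfolding sum.atMost_Suc_shift lessThan_Suc_atMost by (simp add: shift_coeff_def)
  have "(\<lambda>n. (complex_of_nat (Suc (Suc n)) powr (1 - s) - of_nat (Suc n) powr (1 - s)) -
      (\<Sum>k<Suc K. shift_coeff (Suc k) s * of_nat (Suc n) powr (1 - s - of_nat (Suc k)))) sums
     (- 1 - (\<Sum>k<Suc K. shift_coeff (Suc k) s * dirichlet_zeta (s + of_nat (Suc k) - 1)))"
    by (intro sums_diff telescope_powr s sums_sum tail) auto
  then have "(\<lambda>n. shift_remainder (Suc K) n s) sums
     (- 1 - (\<Sum>k<Suc K. shift_coeff (Suc k) s * dirichlet_zeta (s + of_nat (Suc k) - 1)))"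
    unfolding shift_remainder_def split by (simp only: diff_diff_eq)
  then have "(\<Sum>n. shift_remainder (Suc K) n s) = - 1 - (\<Sum>k<Suc K. shift_coeff (Suc k) s * dirichlet_zeta (s + of_nat (Suc k) - 1))"
    by (rule sums_unique[symmetric])
  also have "(\<Sum>k<Suc K. shift_coeff (Suc k) s * dirichlet_zeta (s + of_nat (Suc k) - 1)) =
      (1 - s) * dirichlet_zeta s + (\<Sum>j<K. shift_coeff (Suc (Suc j)) s * dirichlet_zeta (s + of_nat (Suc (Suc j)) - 1))"
    unfolding sum.lessThan_Suc_shift by (simp add: shift_coeff_def)
  also have "(\<Sum>j<K. shift_coeff (Suc (Suc j)) s * dirichlet_zeta (s + of_nat (Suc (Suc j)) - 1)) =
      - (\<Sum>j<K. (\<Prod>i<Suc j. 1 - s - of_nat i) / fact (j + 2) * ((s + of_nat j) * dirichlet_zeta (s + of_nat j + 1)))"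
    unfolding sum_negf[symmetric]
  proof (intro sum.cong refl)
    fix j
    have a: "s + of_nat (Suc (Suc j)) - 1 = s + of_nat j + 1" by simp
    have b: "1 - s - of_nat (Suc j) = - (s + of_nat j)" by simp
    have c: "Suc (Suc j) = j + 2" by simp
    show "shift_coeff (Suc (Suc j)) s * dirichlet_zeta (s + of_nat (Suc (Suc j)) - 1) =
        - ((\<Prod>i<Suc j. 1 - s - of_nat i) / fact (j + 2) * ((s + of_nat j) * dirichlet_zeta (s + of_nat j + 1)))"
      unfolding a shift_coeff_def prod.lessThan_Suc[of _ "Suc j"] b unfolding c
      by (simp only: divide_inverse mult_minus_right mult_minus_left mult_ac)
  qed
  finally show ?thesis by (simp add: algebra_simps)
qed

text \<open>One unit strip per step: the recurrence expresses the function at s through its values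
  at s + 1, s + 2, ..., and a remainder series that is holomorphic for Re s > -K.\<close>

lemma zeta_continuation_strip:
  "\<exists>g. g holomorphic_on {s. 1 - real K < Re s} \<and> (\<forall>s. Re s > 1 \<longrightarrow> g s = (s - 1) * dirichlet_zeta s)"
proof (induction K)
  case 0
  have "(\<lambda>s. (s - 1) * dirichlet_zeta s) holomorphic_on {s. 1 - real 0 < Re s}"
    using holomorphic_dirichlet_zeta by (auto intro!: holomorphic_intros)
  then show ?case by blast
next
  case (Suc K)
  then obtain g where g: "g holomorphic_on {s. 1 - real K < Re s}" "\<And>s. Re s > 1 \<Longrightarrow> g s = (s - 1) * dirichlet_zeta s"
    by blast
  define h where "h = (\<lambda>s. 1 + (\<Sum>n. shift_remainder (Suc K) n s) -
     (\<Sum>j<K. (\<Prod>i<Suc j. 1 - s - of_nat i) / fact (j + 2) * g (s + of_nat j + 1)))"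
  have "(\<lambda>s. g (s + of_nat j + 1)) holomorphic_on {s. 1 - real (Suc K) < Re s}" for j
    by (rule holomorphic_on_compose_gen[OF _ g(1), of "\<lambda>s. s + of_nat j + 1", unfolded o_def])
       (auto intro!: holomorphic_intros)
  then have "h holomorphic_on {s. 1 - real (Suc K) < Re s}"
    unfolding h_def by (intro holomorphic_intros holomorphic_shift_remainder_sum) auto
  moreover have "h s = (s - 1) * dirichlet_zeta s" if "Re s > 1" for s
  proof -
    have "g (s + of_nat j + 1) = (s + of_nat j) * dirichlet_zeta (s + of_nat j + 1)" for j
      using that by (subst g(2)) auto
    then show ?thesis unfolding h_def dirichlet_zeta_shift[OF that, of K] by simp
  qed
  ultimately show ?case by blast
qed

text \<open>Existence of the function selected in \<open>zeta\<close>. The strip functions are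
  divided by s - 1 and glued; they agree on overlaps by the identity theorem.\<close>

lemma zeta_continuation:
  "\<exists>f. f holomorphic_on (- {1}) \<and> (\<forall>s. Re s > 1 \<longrightarrow> (\<lambda>n. of_nat (Suc n) powr (- s)) sums f s)"
proof -
  have "\<forall>K. \<exists>g. g holomorphic_on {s. 1 - real K < Re s} \<and> (\<forall>s. Re s > 1 \<longrightarrow> g s = (s - 1) * dirichlet_zeta s)"
    using zeta_continuation_strip by blast
  then obtain g where g: "\<And>K. g K holomorphic_on {s. 1 - real K < Re s}"
      "\<And>K s. Re s > 1 \<Longrightarrow> g K s = (s - 1) * dirichlet_zeta s"
    unfolding choice_iff by blast
  \<comment> \<open>The index of some strip containing s; \<open>agree\<close> makes the glued value
    independent of it.\<close>
  define N where "N = (\<lambda>s. nat \<lceil>2 - Re s\<rceil>)"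
  have N: "1 - real (N s) < Re s" for s unfolding N_def by linarith
  have agree: "g K s = g L s" if "1 - real K < Re s" "1 - real L < Re s" for K L s
  proof (rule holomorphic_eq_on_real_segment[where a = 2 and b = 3 and S = "{s. max (1 - real K) (1 - real L) < Re s}"
        and f = "g K" and g = "g L" and w = s])
    show "g K holomorphic_on {s. max (1 - real K) (1 - real L) < Re s}" "g L holomorphic_on {s. max (1 - real K) (1 - real L) < Re s}"
      by (rule holomorphic_on_subset[OF g(1)]; auto)+
    show "connected {s. max (1 - real K) (1 - real L) < Re s}" by (intro convex_connected convex_Re_gt)
    show "open {s. max (1 - real K) (1 - real L) < Re s}" by (rule open_Re_gt)
  qed (use that g(2) in auto)
  define f where "f = (\<lambda>s. g (N s) s / (s - 1))"
  have "f holomorphic_on (- {1})"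
  proof (rule holomorphic_onI)
    fix s :: complex assume s: "s \<in> - {1}"
    let ?U = "{u. 1 - real (N s) < Re u} - {1}"
    have "(\<lambda>u. g (N s) u / (u - 1)) holomorphic_on ?U"
      by (intro holomorphic_intros holomorphic_on_subset[OF g(1)]) auto
    then have "f holomorphic_on ?U"
    proof (rule holomorphic_transform)
      fix u assume "u \<in> ?U"
      then show "g (N s) u / (u - 1) = f u" unfolding f_def using agree[of "N s" u "N u"] N[of u] by simp
    qed
    moreover have "open ?U" by (intro open_Diff open_Re_gt) auto
    moreover have "s \<in> ?U" using s N by simp
    ultimately have "f field_differentiable at s" using holomorphic_on_imp_differentiable_at by blast
    then show "f field_differentiable at s within - {1}" by (rule field_differentiable_at_within)
  qed
  moreover have "(\<lambda>n. of_nat (Suc n) powr (- s)) sums f s" if "Re s > 1" for s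
  proof -
    have "s \<noteq> 1" using that by auto
    then have "f s = dirichlet_zeta s" unfolding f_def g(2)[OF that] by simp
    then show ?thesis using dirichlet_zeta_sums[OF that] by simp
  qed
  ultimately show ?thesis by blast
qed

lemma holomorphic_zeta: "zeta holomorphic_on (- {1})"
  and zeta_sums: "Re s > 1 \<Longrightarrow> (\<lambda>n. of_nat (Suc n) powr (- s)) sums zeta s"
  using someI_ex[OF zeta_continuation] unfolding zeta_def by blast+

section \<open>Divisor series of the kernel\<close>

lemma summable_on_product_nat:
  fixes a b :: "nat \<Rightarrow> real"
  assumes "summable a" "summable b" "\<And>n. a n \<ge> 0" "\<And>n. b n \<ge> 0"
  shows "(\<lambda>(i, j). a i * b j) summable_on UNIV"
proof -
  have "(\<lambda>p. a (fst p) * b (snd p)) summable_on (SIGMA i:UNIV. UNIV)"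
  proof (rule summable_on_SigmaI[where g = "\<lambda>i. a i * suminf b"])
    fix i
    have "(\<lambda>j. a i * b j) sums (a i * suminf b)" by (intro sums_mult summable_sums assms)
    moreover have "summable (\<lambda>j. norm (a i * b j))" using assms by (simp add: summable_mult)
    ultimately show "((\<lambda>y. a (fst (i, y)) * b (snd (i, y))) has_sum a i * suminf b) UNIV"
      by (simp add: norm_summable_imp_has_sum)
  next
    have "summable (\<lambda>n. norm (a n * suminf b))"
      using assms suminf_nonneg[OF assms(2,4)] by (simp add: summable_mult2)
    then show "(\<lambda>i. a i * suminf b) summable_on UNIV" by (rule norm_summable_imp_summable_on)
  qed (use assms in auto)
  then show ?thesis by (simp add: case_prod_unfold)
qed

text \<open>One absolutely convergent family summed by rows, by columns and along the products (i +
  1)(j + 1) = n + 1. The last order comes from the bijection between pairs and divisors d of n + 1,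
  with cofactor (n + 1) / d and all indices lowered by one.\<close>

lemma double_series:
  fixes f :: "nat \<Rightarrow> nat \<Rightarrow> 'a :: {banach, second_countable_topology}"
  assumes "(\<lambda>(i, j). norm (f i j)) summable_on UNIV"
  obtains T where
    "(\<lambda>i. \<Sum>j. f i j) sums T" "(\<lambda>j. \<Sum>i. f i j) sums T"
    "\<And>i. summable (\<lambda>j. norm (f i j))" "\<And>j. summable (\<lambda>i. norm (f i j))"
    "(\<lambda>n. \<Sum>d | d dvd Suc n. f (d - 1) (Suc n div d - 1)) sums T"
proof -
  let ?F = "\<lambda>p. f (fst p) (snd p)"
  let ?G = "\<lambda>p. f (snd p) (fst p)"
  have F: "(\<lambda>p. norm (?F p)) summable_on UNIV" using assms by (simp add: case_prod_unfold)
  define T where "T = infsum ?F UNIV"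
  have FT: "(?F has_sum T) UNIV" unfolding T_def using Infinite_Sum.abs_summable_summable[OF F] by simp
  have b: "bij_betw prod.swap (UNIV :: (nat \<times> nat) set) UNIV" by simp
  have GT: "(?G has_sum T) UNIV"
    using has_sum_reindex_bij_betw[OF b, of ?F T] FT by simp
  have G: "(\<lambda>p. norm (?G p)) summable_on UNIV"
    using summable_on_reindex_bij_betw[OF b, of "\<lambda>p. norm (?F p)"] F by simp
  have rows: "(\<lambda>j. norm (h (i, j))) summable_on UNIV" if "(\<lambda>p. norm (h p)) summable_on UNIV" for h :: "nat \<times> nat \<Rightarrow> 'a" and i
    using that Infinite_Sum.abs_summable_on_Sigma_iff[where f = h and A = UNIV and B = "\<lambda>_. UNIV"] by simp
  have rn: "summable (\<lambda>j. norm (h (i, j)))" if "(\<lambda>p. norm (h p)) summable_on UNIV" for h :: "nat \<times> nat \<Rightarrow> 'a" and i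
    using summable_on_imp_summable[OF rows[OF that]] .
  have rs: "(\<lambda>i. \<Sum>j. h (i, j)) sums S" if "(\<lambda>p. norm (h p)) summable_on UNIV" "(h has_sum S) UNIV" for h :: "nat \<times> nat \<Rightarrow> 'a" and S
  proof -
    have S: "(h has_sum S) (SIGMA i:UNIV. UNIV)" using that(2) by simp
    have "((\<lambda>i. \<Sum>j. h (i, j)) has_sum S) UNIV"
    proof (rule has_sum_SigmaD[OF S])
      fix i
      show "((\<lambda>j. h (i, j)) has_sum (\<Sum>j. h (i, j))) UNIV"
        by (rule norm_summable_imp_has_sum[OF rn[OF that(1)] summable_sums[OF summable_norm_cancel[OF rn[OF that(1)]]]])
    qed
    then show ?thesis by (rule has_sum_imp_sums)
  qed
  have bd: "bij_betw (\<lambda>(n, d). (d - 1, Suc n div d - 1)) (SIGMA n:UNIV. {d. d dvd Suc n}) (UNIV :: (nat \<times> nat) set)"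
  proof (rule bij_betwI[of _ _ _ "\<lambda>(i, j). (Suc i * Suc j - 1, Suc i)"])
    fix x assume "x \<in> (SIGMA n:UNIV. {d. d dvd Suc n})"
    then obtain n d where x: "x = (n, d)" "d dvd Suc n" by auto
    then obtain k where k: "Suc n = d * k" by (auto elim: dvdE)
    then have "d > 0" "k > 0" by (auto intro: gr0I)
    then show "(case case x of (n, d) \<Rightarrow> (d - 1, Suc n div d - 1) of (i, j) \<Rightarrow> (Suc i * Suc j - 1, Suc i)) = x"
      unfolding x using k by (simp del: mult_Suc mult_Suc_right)
  next
    fix y :: "nat \<times> nat"
    obtain i j where y: "y = (i, j)" by (cases y)
    have "Suc (Suc i * Suc j - 1) = Suc i * Suc j" by simp
    then show "(case case y of (i, j) \<Rightarrow> (Suc i * Suc j - 1, Suc i) of (n, d) \<Rightarrow> (d - 1, Suc n div d - 1)) = y"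
      unfolding y by (simp del: mult_Suc mult_Suc_right)
  next
    show "(\<lambda>(i, j). (Suc i * Suc j - 1, Suc i)) \<in> UNIV \<rightarrow> (SIGMA n:UNIV. {d. d dvd Suc n})"
    proof (rule funcsetI)
      fix y :: "nat \<times> nat"
      obtain i j where y: "y = (i, j)" by (cases y)
      have "Suc (Suc i * Suc j - 1) = Suc i * Suc j" by simp
      then have "Suc i dvd Suc (Suc i * Suc j - 1)" by (simp only: dvd_triv_left)
      then show "(case y of (i, j) \<Rightarrow> (Suc i * Suc j - 1, Suc i)) \<in> (SIGMA n:UNIV. {d. d dvd Suc n})"
        unfolding y by simp
    qed
  qed auto
  have BD: "((\<lambda>p. ?F ((\<lambda>(n, d). (d - 1, Suc n div d - 1)) p)) has_sum T) (SIGMA n:UNIV. {d. d dvd Suc n})"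
    using has_sum_reindex_bij_betw[OF bd, of ?F T] FT by blast
  have "((\<lambda>n. \<Sum>d | d dvd Suc n. f (d - 1) (Suc n div d - 1)) has_sum T) UNIV"
    by (rule has_sum_SigmaD[OF BD]) (auto intro!: has_sum_finiteI)
  then have "(\<lambda>n. \<Sum>d | d dvd Suc n. f (d - 1) (Suc n div d - 1)) sums T"
    by (rule has_sum_imp_sums)
  then show ?thesis
    using rs[OF F FT] rs[OF G GT] rn[OF F] rn[OF G] by (intro that[of T]) auto
qed

section \<open>Majorants for divisor sums and for the kernel\<close>

definition real_sigma :: "real \<Rightarrow> nat \<Rightarrow> real" where
  "real_sigma \<alpha> n = (\<Sum>d | d dvd n. real d powr \<alpha>)"

lemma norm_sigma_pow_le: "norm (sigma_pow a (Suc n)) \<le> real_sigma (Re a) (Suc n)"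
  unfolding sigma_pow_def real_sigma_def
proof (rule order_trans[OF norm_sum sum_mono])
  fix d assume "d \<in> {d. d dvd Suc n}"
  then have "d > 0" by (auto intro: gr0I)
  then show "norm (complex_of_nat d powr a) \<le> real d powr Re a"
    using norm_cpow[of "real d" a] by simp
qed

lemma real_sigma_mono: "\<alpha> \<le> \<beta> \<Longrightarrow> real_sigma \<alpha> (Suc n) \<le> real_sigma \<beta> (Suc n)"
  unfolding real_sigma_def
proof (rule sum_mono)
  fix d assume "\<alpha> \<le> \<beta>" "d \<in> {d. d dvd Suc n}"
  then have "d > 0" by (auto intro: gr0I)
  then show "real d powr \<alpha> \<le> real d powr \<beta>" using \<open>\<alpha> \<le> \<beta>\<close> by (intro powr_mono) auto
qed

lemma real_sigma_nonneg: "real_sigma \<alpha> n \<ge> 0"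
  unfolding real_sigma_def by (intro sum_nonneg) auto

lemma divisor_pair:
  assumes "d dvd Suc n" shows "Suc (d - 1) = d" "Suc (Suc n div d - 1) = Suc n div d" "d * (Suc n div d) = Suc n" "d > 0"
proof -
  obtain k where k: "Suc n = d * k" using assms by (auto elim: dvdE)
  then have p: "d > 0" "k > 0" by (auto intro: gr0I)
  then show "Suc (d - 1) = d" "d > 0" by auto
  have "Suc n div d = k" using k p by simp
  with p k show "Suc (Suc n div d - 1) = Suc n div d" "d * (Suc n div d) = Suc n" by auto
qed

text \<open>Its sum is the product of the Dirichlet series of zeta at p and at p - alpha, so the two
  hypotheses are their convergence conditions.\<close>

lemma summable_real_sigma:
  assumes "p > 1" "p - \<alpha> > 1"
  shows "summable (\<lambda>n. real_sigma \<alpha> (Suc n) * real (Suc n) powr (- p))"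
proof -
  define f where "f = (\<lambda>i j. real (Suc i) powr (\<alpha> - p) * real (Suc j) powr (- p))"
  have "(\<lambda>(i, j). norm (f i j)) summable_on UNIV"
    unfolding f_def norm_mult using assms
    by (intro summable_on_product_nat) (auto intro!: summable_Suc_powr simp del: of_nat_Suc)
  then obtain T where "(\<lambda>n. \<Sum>d | d dvd Suc n. f (d - 1) (Suc n div d - 1)) sums T"
    by (rule double_series)
  moreover have "(\<Sum>d | d dvd Suc n. f (d - 1) (Suc n div d - 1)) = real_sigma \<alpha> (Suc n) * real (Suc n) powr (- p)" for n
    unfolding real_sigma_def sum_distrib_right
  proof (rule sum.cong[OF refl])
    fix d assume "d \<in> {d. d dvd Suc n}"
    then have d: "d dvd Suc n" by simp
    note dd = divisor_pair[OF d]
    have "real (Suc n) powr (- p) = real (d * (Suc n div d)) powr (- p)" by (simp only: dd(3))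
    also have "\<dots> = real d powr (- p) * real (Suc n div d) powr (- p)" by (simp add: powr_mult)
    finally show "f (d - 1) (Suc n div d - 1) = real d powr \<alpha> * real (Suc n) powr (- p)"
      unfolding f_def dd(1,2) by (simp add: powr_diff powr_minus divide_inverse mult_ac)
  qed
  ultimately show ?thesis by (simp add: sums_iff)
qed

text \<open>Scaling z by r scales the Laplace variable on each ray, and the Gamma integral that
  bounds it is homogeneous of degree -Re s. The constant is uniform in s because Gamma is continuous
  on [s1, s2] and b^s is bounded for norm s <= Lambda.\<close>

lemma wedge_integral_bound:
  assumes \<epsilon>: "\<epsilon> > 0" and z: "z \<in> wedge \<epsilon>" and s1: "0 < s1"
  obtains C where "C \<ge> 0" "\<And>s r. s1 \<le> Re s \<Longrightarrow> Re s \<le> s2 \<Longrightarrow> norm s \<le> \<Lambda> \<Longrightarrow> r > 0 \<Longrightarrow>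
    norm (wedge_integral \<epsilon> s (of_real r * z)) \<le> C * r powr (- Re s)"
proof -
  have part: "\<exists>C\<ge>0. \<forall>s r. s1 \<le> Re s \<and> Re s \<le> s2 \<and> norm s \<le> \<Lambda> \<and> r > 0 \<longrightarrow>
      norm (b powr s * ray_integral s b (of_real r * x)) \<le> C * r powr (- Re s)"
    if b: "Re b > 0" and x: "Re x > 0" for b x
  proof -
    obtain d where d: "d > 0" "\<And>s x. Re s > 0 \<Longrightarrow> Re x > 0 \<Longrightarrow> norm (ray_integral s b x) \<le> Gamma (Re s) * Re x powr (- Re s) / d"
      using ray_integral_bound[OF b] by metis
    have "continuous_on {s1..s2} (\<lambda>\<sigma>. Gamma \<sigma> * Re x powr (- \<sigma>))"
      using x s1 by (intro continuous_intros continuous_on_Gamma) (auto dest: nonpos_Ints_nonpos)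
    then have "bounded ((\<lambda>\<sigma>. Gamma \<sigma> * Re x powr (- \<sigma>)) ` {s1..s2})"
      by (intro compact_imp_bounded compact_continuous_image compact_Icc)
    then obtain B where B: "\<forall>\<sigma>\<in>{s1..s2}. norm (Gamma \<sigma> * Re x powr (- \<sigma>)) \<le> B"
      unfolding bounded_iff by auto
    define C where "C = exp (\<Lambda> * norm (Ln b)) * (max B 0 / d)"
    have "norm (b powr s * ray_integral s b (of_real r * x)) \<le> C * r powr (- Re s)"
      if s: "s1 \<le> Re s" "Re s \<le> s2" "norm s \<le> \<Lambda>" and r: "r > 0" for s r
    proof -
      have b0: "b \<noteq> 0" using b by auto
      have "norm (b powr s) \<le> exp (norm (s * Ln b))"
        using b0 norm_exp[of "s * Ln b"] by (simp add: powr_def)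
      also have "\<dots> \<le> exp (\<Lambda> * norm (Ln b))"
        using s(3) by (simp add: norm_mult mult_right_mono)
      finally have 1: "norm (b powr s) \<le> exp (\<Lambda> * norm (Ln b))" .
      have Rr: "Re (of_real r * x) = r * Re x" by simp
      have "norm (ray_integral s b (of_real r * x)) \<le> Gamma (Re s) * Re (of_real r * x) powr (- Re s) / d"
        using s s1 r x by (intro d(2)) auto
      also have "\<dots> = (Gamma (Re s) * Re x powr (- Re s)) / d * r powr (- Re s)"
        unfolding Rr using r x by (simp add: powr_mult)
      also have "\<dots> \<le> max B 0 / d * r powr (- Re s)"
      proof -
        have "Re s \<in> {s1..s2}" using s by simp
        with B have "norm (Gamma (Re s) * Re x powr (- Re s)) \<le> B" by blast
        then have "Gamma (Re s) * Re x powr (- Re s) \<le> max B 0" by simp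
        then show ?thesis using d(1) by (intro mult_right_mono divide_right_mono) auto
      qed
      finally have 2: "norm (ray_integral s b (of_real r * x)) \<le> max B 0 / d * r powr (- Re s)" .
      show ?thesis unfolding norm_mult C_def mult.assoc
        using mult_mono[OF 1 2] by simp
    qed
    moreover have "C \<ge> 0" using d(1) by (simp add: C_def)
    ultimately show ?thesis by blast
  qed
  let ?b = "of_real \<epsilon> + \<i>" and ?c = "of_real \<epsilon> - \<i>"
  let ?x = "z * (1 - \<i> * of_real \<epsilon>)" and ?y = "z * (1 + \<i> * of_real \<epsilon>)"
  have bc: "Re ?b > 0" "Re ?c > 0" using \<epsilon> by auto
  have xy: "Re ?x > 0" "Re ?y > 0" using z by (simp_all add: wedge_def)
  obtain C where C: "C \<ge> 0" "\<And>s r. s1 \<le> Re s \<Longrightarrow> Re s \<le> s2 \<Longrightarrow> norm s \<le> \<Lambda> \<Longrightarrow> r > 0 \<Longrightarrow>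
      norm (?b powr s * ray_integral s ?b (of_real r * ?x)) \<le> C * r powr (- Re s)"
    using part[OF bc(1) xy(1)] by blast
  obtain D where D: "D \<ge> 0" "\<And>s r. s1 \<le> Re s \<Longrightarrow> Re s \<le> s2 \<Longrightarrow> norm s \<le> \<Lambda> \<Longrightarrow> r > 0 \<Longrightarrow>
      norm (?c powr s * ray_integral s ?c (of_real r * ?y)) \<le> D * r powr (- Re s)"
    using part[OF bc(2) xy(2)] by blast
  show ?thesis
  proof (rule that[of "(C + D) / pi"])
    fix s r assume s: "s1 \<le> Re s" "Re s \<le> s2" "norm s \<le> \<Lambda>" and r: "(r::real) > 0"
    have "norm (wedge_integral \<epsilon> s (of_real r * z)) =
      norm (?b powr s * ray_integral s ?b (of_real r * ?x) + ?c powr s * ray_integral s ?c (of_real r * ?y)) / pi"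
      unfolding wedge_integral_def by (simp add: norm_divide mult.assoc)
    also have "\<dots> \<le> (C * r powr (- Re s) + D * r powr (- Re s)) / pi"
      using norm_triangle_mono[OF C(2)[OF s r] D(2)[OF s r]] by (intro divide_right_mono) auto
    finally show "norm (wedge_integral \<epsilon> s (of_real r * z)) \<le> (C + D) / pi * r powr (- Re s)"
      by (simp add: distrib_right add_divide_distrib)
  qed (use C D in simp)
qed

text \<open>Common treatment of the two kernel series in use, with coefficients 1 and sigma_a(n):
  local domination of coefficients and exponents passes to the products through the kernel
  bound.\<close>

lemma wedge_series:
  fixes c :: "nat \<Rightarrow> complex \<Rightarrow> complex"
  assumes \<epsilon>: "\<epsilon> > 0" and z: "z \<in> wedge \<epsilon>" and A: "open A"
    and hol: "\<And>n. c n holomorphic_on A"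
    and pos: "\<And>a. a \<in> A \<Longrightarrow> Re (a + q) > 0"
    and bound: "\<And>a. a \<in> A \<Longrightarrow> \<exists>d>0. \<exists>p C. summable (\<lambda>n. C n * real (Suc n) powr (- p)) \<and>
       (\<forall>n. \<forall>x\<in>ball a d \<inter> A. norm (c n x) \<le> C n \<and> p \<le> Re (x + q))"
  shows "(\<lambda>a. \<Sum>n. c n a * wedge_integral \<epsilon> (a + q) (of_nat (Suc n) * z)) holomorphic_on A"
    and "a \<in> A \<Longrightarrow> summable (\<lambda>n. norm (c n a * wedge_integral \<epsilon> (a + q) (of_nat (Suc n) * z)))"
proof -
  have main: "\<exists>d>0. \<exists>M. summable M \<and> (\<forall>n. \<forall>x\<in>ball a d \<inter> A. norm (c n x * wedge_integral \<epsilon> (x + q) (of_nat (Suc n) * z)) \<le> M n)"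
    if a: "a \<in> A" for a
  proof -
    obtain d p C where d: "d > 0" "summable (\<lambda>n. C n * real (Suc n) powr (- p))"
       "\<And>n x. x \<in> ball a d \<inter> A \<Longrightarrow> norm (c n x) \<le> C n \<and> p \<le> Re (x + q)"
      using bound[OF a] by blast
    define r where "r = min d (Re (a + q) / 2)"
    have r: "r > 0" "r \<le> d" using d(1) pos[OF a] by (auto simp: r_def)
    have r2: "r \<le> Re (a + q) / 2" unfolding r_def by (rule min.cobounded2)
    define s1 where "s1 = Re (a + q) - r"
    have s1: "s1 > 0" using r2 pos[OF a] unfolding s1_def by linarith
    obtain K where K: "K \<ge> 0" "\<And>s u. s1 \<le> Re s \<Longrightarrow> Re s \<le> Re (a + q) + r \<Longrightarrow> norm s \<le> norm (a + q) + r \<Longrightarrow> u > 0 \<Longrightarrow>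
        norm (wedge_integral \<epsilon> s (of_real u * z)) \<le> K * u powr (- Re s)"
      using wedge_integral_bound[OF \<epsilon> z s1] by metis
    have "norm (c n x * wedge_integral \<epsilon> (x + q) (of_nat (Suc n) * z)) \<le> K * (C n * real (Suc n) powr (- p))"
      if x: "x \<in> ball a r \<inter> A" for n x
    proof -
      have x': "x \<in> ball a d \<inter> A" using x r by auto
      have pn: "p \<le> Re (x + q)" using d(3)[OF x'] by blast
      have "norm (x + q) \<le> norm (a + q) + norm (x - a)"
        using norm_triangle_ineq[of "a + q" "x - a"] by (simp add: add.commute)
      also have "norm (x - a) \<le> r" using x by (auto simp: dist_norm norm_minus_commute)
      finally have "norm (x + q) \<le> norm (a + q) + r" by simp
      then have "norm (wedge_integral \<epsilon> (x + q) (of_real (real (Suc n)) * z)) \<le> K * real (Suc n) powr (- Re (x + q))"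
        using Re_dist_less[of x a r] x by (intro K(2)) (auto simp: s1_def abs_if split: if_splits)
      also have "\<dots> \<le> K * real (Suc n) powr (- p)"
        using pn by (intro mult_left_mono powr_mono K) auto
      finally have 1: "norm (wedge_integral \<epsilon> (x + q) (of_nat (Suc n) * z)) \<le> K * real (Suc n) powr (- p)" by simp
      have 2: "norm (c n x) \<le> C n" using d(3)[OF x'] by blast
      then have "0 \<le> C n" using norm_ge_zero order_trans by blast
      then have "norm (c n x * wedge_integral \<epsilon> (x + q) (of_nat (Suc n) * z)) \<le> C n * (K * real (Suc n) powr (- p))"
        unfolding norm_mult by (intro mult_mono 1 2) auto
      then show ?thesis by (simp only: mult_ac)
    qed
    with r(1) d(2) show ?thesis
      by (intro exI[of _ r] conjI exI[of _ "\<lambda>n. K * (C n * real (Suc n) powr (- p))"] summable_mult) auto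
  qed
  show "(\<lambda>a. \<Sum>n. c n a * wedge_integral \<epsilon> (a + q) (of_nat (Suc n) * z)) holomorphic_on A"
  proof (rule holomorphic_on_suminf[OF A _ main])
    fix n
    have zn: "of_nat (Suc n) * z \<in> wedge \<epsilon>" using wedge_scale[OF z, of "real (Suc n)"] by simp
    have "(\<lambda>a. wedge_integral \<epsilon> (a + q) (of_nat (Suc n) * z)) holomorphic_on A"
      by (rule holomorphic_on_compose_gen[OF _ holomorphic_wedge_integral[OF \<epsilon> zn], of "\<lambda>a. a + q", unfolded o_def])
         (use pos in \<open>auto intro!: holomorphic_intros\<close>)
    then show "(\<lambda>a. c n a * wedge_integral \<epsilon> (a + q) (of_nat (Suc n) * z)) holomorphic_on A"
      by (intro holomorphic_intros hol)
  qed
  show "summable (\<lambda>n. norm (c n a * wedge_integral \<epsilon> (a + q) (of_nat (Suc n) * z)))" if a: "a \<in> A"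
  proof -
    obtain d M where d: "d > 0" "summable M" "\<forall>n. \<forall>x\<in>ball a d \<inter> A. norm (c n x * wedge_integral \<epsilon> (x + q) (of_nat (Suc n) * z)) \<le> M n"
      using main[OF a] by blast
    show ?thesis
      by (rule summable_comparison_test'[OF d(2)]) (use d a in auto)
  qed
qed

section \<open>The lattice sum\<close>

lemma sin_half_shift:
  "sin (of_real pi * (a + 2 * of_nat k) / 2) = (-1) ^ k * sin (of_real pi * a / 2 :: complex)"
proof (induction k)
  case (Suc k)
  have "of_real pi * (a + 2 * of_nat (Suc k)) / 2 = of_real pi * (a + 2 * of_nat k) / 2 + of_real pi"
    by (simp add: field_simps)
  then show ?case by (simp only: sin_add Suc.IH) simp
qed simp

text \<open>Compare the integral representations of \<open>even_remainder\<close> at s and at s + 2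
  M; the sine changes sign M times in between.\<close>

lemma wedge_integral_shift:
  assumes \<epsilon>: "\<epsilon> > 0" and z: "z \<in> wedge \<epsilon>" and s: "Re s > 0" "sin (of_real pi * s / 2) \<noteq> 0"
  shows "(-1) ^ M * wedge_integral \<epsilon> (s + 2 * of_nat M) z =
    wedge_integral \<epsilon> s z - (\<Sum>k<M. z powr (- s - 2 * of_nat k) * rGamma (1 - s - 2 * of_nat k)) / sin (of_real pi * s / 2)"
proof -
  let ?S = "\<Sum>k<M. z powr (- s - 2 * of_nat k) * rGamma (1 - s - 2 * of_nat k)"
  let ?sn = "sin (of_real pi * s / 2)"
  have z0: "z \<noteq> 0" using wedge_Re_pos[OF z] by auto
  have "Re (s + 2 * of_nat M) > 0" using s by (simp add: add_pos_nonneg)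
  from even_remainder_eq_wedge_integral[OF \<epsilon> z this]
  have "even_remainder (s + 2 * of_nat M) z = - ((-1) ^ M * ?sn) * wedge_integral \<epsilon> (s + 2 * of_nat M) z"
    by (simp only: sin_half_shift)
  moreover have "even_remainder (s + 2 * of_nat M) z = - ?sn * wedge_integral \<epsilon> s z + ?S"
    unfolding even_remainder_shift[OF z0] even_remainder_eq_wedge_integral[OF \<epsilon> z s(1)] ..
  ultimately have eq: "- ((-1) ^ M * ?sn) * wedge_integral \<epsilon> (s + 2 * of_nat M) z = - ?sn * wedge_integral \<epsilon> s z + ?S"
    by (simp only:)
  have "P * J' = J - T / S" if "- (P * S) * J' = - S * J + T" "S \<noteq> 0" for P S J J' T :: complex
  proof -
    have "S * (P * J') = - (- (P * S) * J')" by simp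
    also have "\<dots> = S * J - T" unfolding that(1) by simp
    also have "\<dots> = S * (J - T / S)" using that(2) by (simp add: right_diff_distrib)
    finally show ?thesis using that(2) by simp
  qed
  from this[OF eq s(2)] show ?thesis .
qed

lemma sin_half_neq_0:
  assumes "a \<notin> \<int>" shows "sin (of_real pi * a / 2) \<noteq> (0::complex)"
proof
  assume "sin (of_real pi * a / 2) = 0"
  then obtain n :: int where "of_real pi * a / 2 = of_real (n * pi)" by (auto simp: sin_eq_0)
  then have "a = of_int (2 * n)" by (simp add: field_simps)
  with assms show False by (metis Ints_of_int)
qed

lemma open_minus_Ints: "open S \<Longrightarrow> open (S - (\<int> :: complex set))"
  by (intro open_Diff) (auto simp: closed_Ints)

lemma connected_minus_Ints: "open S \<Longrightarrow> convex S \<Longrightarrow> connected (S - (\<int> :: complex set))"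
  by (rule connected_open_diff_countable) (auto simp: Ints_def intro: convex_connected)

lemma holomorphic_zeta_shift:
  assumes "f holomorphic_on A" "\<And>a. a \<in> A \<Longrightarrow> f a \<noteq> 1"
  shows "(\<lambda>a. zeta (f a)) holomorphic_on A"
  by (rule holomorphic_on_compose_gen[OF assms(1) holomorphic_zeta, unfolded o_def]) (use assms(2) in auto)

lemma rational_kernel_bound:
  assumes "Re w > 0"
  obtains d where "d > 0" "\<And>t. d * (1 + t\<^sup>2) \<le> norm (w\<^sup>2 + (of_real t)\<^sup>2)"
proof -
  have "Re (1 / w) > 0"
    using assms by (auto simp: Re_divide intro!: divide_pos_pos add_pos_nonneg)
  then obtain d where d: "d > 0" "\<And>t. d * (1 + t\<^sup>2) \<le> norm (1 + (1 / w)\<^sup>2 * (of_real t)\<^sup>2)"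
    using add_one_square_bound by metis
  have w0: "w \<noteq> 0" using assms by auto
  show ?thesis
  proof (rule that[of "(norm w)\<^sup>2 * d"])
    show "(norm w)\<^sup>2 * d > 0" using d w0 by simp
    fix t
    have "w\<^sup>2 + (of_real t)\<^sup>2 = w\<^sup>2 * (1 + (1 / w)\<^sup>2 * (of_real t)\<^sup>2)"
      using w0 by (simp add: field_simps power_divide)
    then have "norm (w\<^sup>2 + (of_real t)\<^sup>2) = (norm w)\<^sup>2 * norm (1 + (1 / w)\<^sup>2 * (of_real t)\<^sup>2)"
      by (simp only: norm_mult norm_power)
    also have "\<dots> \<ge> (norm w)\<^sup>2 * (d * (1 + t\<^sup>2))" by (intro mult_left_mono d) auto
    finally show "(norm w)\<^sup>2 * d * (1 + t\<^sup>2) \<le> norm (w\<^sup>2 + (of_real t)\<^sup>2)" by (simp only: mult.assoc)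
  qed
qed

lemma
  assumes w: "Re w > 0"
  shows holomorphic_rational_series: "(\<lambda>a. \<Sum>k. w powr (- a) * of_nat (Suc k) powr (a + 1) / (w\<^sup>2 + (of_nat (Suc k))\<^sup>2)) holomorphic_on {a. Re a < 0}"
    and summable_rational_series: "Re a < 0 \<Longrightarrow> summable (\<lambda>k. w powr (- a) * of_nat (Suc k) powr (a + 1) / (w\<^sup>2 + (of_nat (Suc k))\<^sup>2))"
proof -
  obtain d where d: "d > 0" "\<And>t. d * (1 + t\<^sup>2) \<le> norm (w\<^sup>2 + (of_real t)\<^sup>2)"
    using rational_kernel_bound[OF w] by metis
  have w0: "w \<noteq> 0" using w by auto
  have ge: "d * (real (Suc k))\<^sup>2 \<le> norm (w\<^sup>2 + (of_nat (Suc k))\<^sup>2)" for k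
  proof -
    have "d * (real (Suc k))\<^sup>2 \<le> d * (1 + (real (Suc k))\<^sup>2)" using d(1) by (intro mult_left_mono) auto
    also have "\<dots> \<le> norm (w\<^sup>2 + (of_nat (Suc k))\<^sup>2)" using d(2)[of "real (Suc k)"] by simp
    finally show ?thesis .
  qed
  have nz: "w\<^sup>2 + (of_nat (Suc k))\<^sup>2 \<noteq> 0" for k
  proof -
    have "0 < d * (real (Suc k))\<^sup>2" using d(1) by (simp del: of_nat_Suc)
    with ge[of k] show ?thesis by auto
  qed
  have hol: "(\<lambda>a. w powr (- a) * of_nat (Suc k) powr (a + 1) / (w\<^sup>2 + (of_nat (Suc k))\<^sup>2)) holomorphic_on {a. Re a < 0}" for k
    using nz w0 by (intro holomorphic_intros) auto
  have main: "\<exists>d>0. \<exists>M. summable M \<and> (\<forall>k. \<forall>y\<in>ball x d \<inter> {a. Re a < 0}.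
      norm (w powr (- y) * of_nat (Suc k) powr (y + 1) / (w\<^sup>2 + (of_nat (Suc k))\<^sup>2)) \<le> M k)"
    if x: "x \<in> {a. Re a < 0}" for x
  proof -
  define r where "r = - Re x / 2"
  have r: "r > 0" "Re x + r < 0" using x by (auto simp: r_def)
  define E where "E = exp ((norm x + r) * norm (Ln w)) / d"
  have "norm (w powr (- y) * of_nat (Suc k) powr (y + 1) / (w\<^sup>2 + (of_nat (Suc k))\<^sup>2)) \<le> E * real (Suc k) powr (Re x + r - 1)"
    if y: "y \<in> ball x r" for y k
  proof -
    define K where "K = real (Suc k)"
    have K: "K > 0" "K \<ge> 1" by (auto simp: K_def)
    have "norm (w powr (- y)) \<le> exp (norm (- y * Ln w))"
      using w0 norm_exp[of "- y * Ln w"] by (simp add: powr_def)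
    also have "\<dots> \<le> exp ((norm x + r) * norm (Ln w))"
    proof -
      have "norm y \<le> norm x + r" using y norm_triangle_ineq2[of y x] by (auto simp: dist_norm norm_minus_commute)
      then show ?thesis by (simp add: norm_mult mult_right_mono)
    qed
    finally have 1: "norm (w powr (- y)) \<le> exp ((norm x + r) * norm (Ln w))" .
    have 2: "norm (of_nat (Suc k) powr (y + 1) :: complex) \<le> K powr (Re x + r + 1)"
      unfolding norm_Suc_powr K_def[symmetric] using Re_dist_less[OF y] K by (intro powr_mono) auto
    have "norm (w powr (- y) * of_nat (Suc k) powr (y + 1) / (w\<^sup>2 + (of_nat (Suc k))\<^sup>2)) \<le>
       (exp ((norm x + r) * norm (Ln w)) * K powr (Re x + r + 1)) / (d * K\<^sup>2)"
      unfolding norm_divide norm_mult K_def using d(1) K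
      by (intro frac_le mult_mono 1 2[unfolded K_def] ge) (auto simp: K_def)
    also have "\<dots> = E * K powr (Re x + r - 1)"
    proof -
      have "K powr (Re x + r + 1) = K powr (Re x + r - 1) * K powr 2" by (simp add: add_ac flip: powr_add)
      also have "K powr 2 = K\<^sup>2" using K by simp
      finally show ?thesis using K d(1) by (simp add: E_def)
    qed
    finally show ?thesis by (simp only: K_def)
  qed
  with r show "\<exists>d>0. \<exists>M. summable M \<and> (\<forall>k. \<forall>y\<in>ball x d \<inter> {a. Re a < 0}.
      norm (w powr (- y) * of_nat (Suc k) powr (y + 1) / (w\<^sup>2 + (of_nat (Suc k))\<^sup>2)) \<le> M k)"
    by (intro exI[of _ r] conjI exI[of _ "\<lambda>k. E * real (Suc k) powr (Re x + r - 1)"] summable_mult summable_Suc_powr) auto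
  qed
  show "(\<lambda>a. \<Sum>k. w powr (- a) * of_nat (Suc k) powr (a + 1) / (w\<^sup>2 + (of_nat (Suc k))\<^sup>2)) holomorphic_on {a. Re a < 0}"
    by (rule holomorphic_on_suminf[OF open_Re_lt hol main])
  show "summable (\<lambda>k. w powr (- a) * of_nat (Suc k) powr (a + 1) / (w\<^sup>2 + (of_nat (Suc k))\<^sup>2))" if a: "Re a < 0"
  proof -
    from a have "a \<in> {a. Re a < 0}" by simp
    from main[OF this] obtain d M where d: "d > 0" "summable M" "\<forall>k. \<forall>y\<in>ball a d \<inter> {a. Re a < 0}.
      norm (w powr (- y) * of_nat (Suc k) powr (y + 1) / (w\<^sup>2 + (of_nat (Suc k))\<^sup>2)) \<le> M k" by blast
    have "a \<in> ball a d \<inter> {a. Re a < 0}" using d a by simp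
    with d(3) have "norm (w powr (- a) * of_nat (Suc k) powr (a + 1) / (w\<^sup>2 + (of_nat (Suc k))\<^sup>2)) \<le> M k" for k
      by blast
    then show ?thesis by (rule summable_comparison_test'[OF d(2)])
  qed
qed

lemma wedge_integral_series_holomorphic:
  assumes \<epsilon>: "\<epsilon> > 0" and z: "z \<in> wedge \<epsilon>"
  shows "(\<lambda>a. \<Sum>d. wedge_integral \<epsilon> (a + q) (of_nat (Suc d) * z)) holomorphic_on {a. 1 - Re q < Re a}"
    and "1 - Re q < Re a \<Longrightarrow> summable (\<lambda>d. norm (wedge_integral \<epsilon> (a + q) (of_nat (Suc d) * z)))"
proof -
  have bound: "\<exists>d>0. \<exists>p C. summable (\<lambda>n. C n * real (Suc n) powr (- p)) \<and>
       (\<forall>n. \<forall>x\<in>ball a d \<inter> {a. 1 - Re q < Re a}. norm ((\<lambda>_ _. 1 :: complex) n x) \<le> C n \<and> p \<le> Re (x + q))"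
    if a: "a \<in> {a. 1 - Re q < Re a}" for a
  proof -
    define r where "r = (Re (a + q) - 1) / 2"
    have "0 < Re (a + q) - 1" using a by simp
    then have r: "r > 0" "Re (a + q) - r > 1" unfolding r_def by (simp_all add: field_simps)
    have "Re (a + q) - r \<le> Re (x + q)" if "x \<in> ball a r" for x
      using Re_dist_less[OF that] by (auto simp: abs_if split: if_splits)
    with r show ?thesis
      by (intro exI[of _ r] conjI exI[of _ "Re (a + q) - r"] exI[of _ "\<lambda>_. 1"])
         (auto intro!: summable_Suc_powr simp del: of_nat_Suc)
  qed
  show "(\<lambda>a. \<Sum>d. wedge_integral \<epsilon> (a + q) (of_nat (Suc d) * z)) holomorphic_on {a. 1 - Re q < Re a}"
    using wedge_series(1)[where c = "\<lambda>_ _. 1", OF \<epsilon> z open_Re_gt _ _ bound] by simp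
  show "summable (\<lambda>d. norm (wedge_integral \<epsilon> (a + q) (of_nat (Suc d) * z)))" if "1 - Re q < Re a"
    using wedge_series(2)[where c = "\<lambda>_ _. 1", OF \<epsilon> z open_Re_gt _ _ bound, of a] that by simp
qed

text \<open>For -1 < Re a < 0 the Abel--Plana formula holds with s = a + 2, and the terms removed by
  the shifts sum to convergent zeta series because Re s > 1. The shifted kernel series converges on
  the whole strip. Deleting the countable set of integers keeps the strip connected.\<close>

lemma lattice_sum_continued:
  assumes \<epsilon>: "\<epsilon> > 0" and w: "w \<in> wedge \<epsilon>"
    and a: "- 2 * real m - 3 < Re a" "Re a < 0" "a \<notin> \<int>"
  defines "z \<equiv> 2 * of_real pi * w"
  shows "(\<Sum>k. w powr (- a) * of_nat (Suc k) powr (a + 1) / (w\<^sup>2 + (of_nat (Suc k))\<^sup>2)) =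
     of_real pi / sin (of_real pi * a / 2) * (- 1 / 2 - (\<Sum>k<Suc m. zeta (a + 2 + 2 * of_nat k) * z powr (- (a + 2) - 2 * of_nat k) * rGamma (1 - (a + 2) - 2 * of_nat k)))
     + of_real pi * (-1) ^ Suc m * (\<Sum>d. wedge_integral \<epsilon> (a + (2 + 2 * of_nat (Suc m))) (of_nat (Suc d) * z))"
    (is "?L a = ?R a")
proof -
  let ?pi = "complex_of_real pi"
  let ?\<Omega> = "({a. - 2 * real m - 3 < Re a} \<inter> {a. Re a < 0}) - \<int>"
  have z: "z \<in> wedge \<epsilon>" using wedge_scale[OF w, of "2 * pi"] by (simp add: z_def)
  have z0: "z \<noteq> 0" using wedge_Re_pos[OF z] by auto
  have ni: "a + 2 + 2 * of_nat k \<noteq> 1" if "a \<notin> \<int>" for a :: complex and k :: nat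
  proof
    assume "a + 2 + 2 * of_nat k = 1"
    then have "a = 1 - 2 * of_nat k - 2" by (simp only: eq_diff_eq)
    then have "a = of_int (- 1 - 2 * int k)" by simp
    with that show False by (metis Ints_of_int)
  qed
  show ?thesis
  proof (rule holomorphic_eq_on_real_segment[where S = ?\<Omega> and f = ?L and g = ?R and a = "-1" and b = 0])
    show "open ?\<Omega>" by (intro open_minus_Ints open_Int open_Re_gt open_Re_lt)
    show "connected ?\<Omega>" by (intro connected_minus_Ints open_Int open_Re_gt open_Re_lt convex_Int convex_Re_gt convex_Re_lt)
    show "?L holomorphic_on ?\<Omega>"
      by (rule holomorphic_on_subset[OF holomorphic_rational_series[OF wedge_Re_pos[OF w]]]) auto
    have "(\<lambda>a. zeta (a + 2 + 2 * of_nat k)) holomorphic_on ?\<Omega>" for k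
    proof (rule holomorphic_zeta_shift)
      show "(\<lambda>a. a + 2 + 2 * of_nat k) holomorphic_on ?\<Omega>" by (intro holomorphic_intros)
      fix a assume "a \<in> ?\<Omega>"
      then show "a + 2 + 2 * of_nat k \<noteq> 1" using ni[of a k] by blast
    qed
    moreover have "(\<lambda>a. \<Sum>d. wedge_integral \<epsilon> (a + (2 + 2 * of_nat (Suc m))) (of_nat (Suc d) * z)) holomorphic_on ?\<Omega>"
      by (rule holomorphic_on_subset[OF wedge_integral_series_holomorphic(1)[OF \<epsilon> z]]) auto
    ultimately show "?R holomorphic_on ?\<Omega>"
      using z0 sin_half_neq_0 by (intro holomorphic_intros) auto
  next
    fix x :: real assume x: "- 1 < x" "x < 0"
    let ?a = "complex_of_real x" and ?s = "complex_of_real x + 2"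
    have "?a \<notin> \<int>"
    proof
      assume "?a \<in> \<int>"
      then obtain n where "?a = of_int n" by (auto elim: Ints_cases)
      then have "x = of_int n" by (metis of_real_eq_iff of_real_of_int_eq)
      with x have "- 1 < n" "n < 0" by auto
      then show False by linarith
    qed
    note sn = sin_half_neq_0[OF this]
    have s: "1 < Re ?s" "Re ?s < 2" "0 < Re ?s" using x by auto
    \<comment> \<open>This change of sign turns the boundary term pi / (2 sin(pi s / 2)) into the
      summand -1/2 inside the bracket.\<close>
    have ss: "sin (?pi * ?s / 2) = - sin (?pi * ?a / 2)" using sin_half_shift[of ?a 1] by simp
    obtain S where S: "(\<lambda>d. ?pi * wedge_integral \<epsilon> ?s (2 * ?pi * of_nat (Suc d) * w)) sums S"
       "(\<lambda>k. w powr (2 - ?s) * of_nat (Suc k) powr (?s - 1) / (w\<^sup>2 + (of_nat (Suc k))\<^sup>2)) sums (S + ?pi / (2 * sin (?pi * ?s / 2)))"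
      by (rule wedge_integral_sums[OF s(1,2) \<epsilon> w])
    let ?f = "\<lambda>d k. (of_nat (Suc d) * z) powr (- ?s - 2 * of_nat k) * rGamma (1 - ?s - 2 * of_nat k)"
    have f: "(\<lambda>d. ?f d k) sums (zeta (?s + 2 * of_nat k) * z powr (- ?s - 2 * of_nat k) * rGamma (1 - ?s - 2 * of_nat k))" for k
    proof -
      have "Re (?s + 2 * of_nat k) > 1" using s by simp
      from sums_mult2[OF zeta_sums[OF this], of "z powr (- ?s - 2 * of_nat k) * rGamma (1 - ?s - 2 * of_nat k)"]
      have "(\<lambda>d. of_nat (Suc d) powr (- (?s + 2 * of_nat k)) * (z powr (- ?s - 2 * of_nat k) * rGamma (1 - ?s - 2 * of_nat k))) sums
        (zeta (?s + 2 * of_nat k) * (z powr (- ?s - 2 * of_nat k) * rGamma (1 - ?s - 2 * of_nat k)))" .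
      moreover have "(of_nat (Suc d) * z) powr (- ?s - 2 * of_nat k) = of_nat (Suc d) powr (- (?s + 2 * of_nat k)) * z powr (- ?s - 2 * of_nat k)" for d
        by (subst powr_times_real_left) (auto simp del: of_nat_Suc)
      ultimately show ?thesis by (simp only: mult.assoc)
    qed
    have "(\<lambda>d. wedge_integral \<epsilon> ?s (of_nat (Suc d) * z)) sums (S / ?pi)"
    proof -
      have "(\<lambda>d. ?pi * wedge_integral \<epsilon> ?s (2 * ?pi * of_nat (Suc d) * w) / ?pi) sums (S / ?pi)"
        by (rule sums_divide[OF S(1)])
      then show ?thesis by (simp add: z_def mult_ac del: of_nat_Suc)
    qed
    then have "(\<lambda>d. wedge_integral \<epsilon> ?s (of_nat (Suc d) * z) - (\<Sum>k<Suc m. ?f d k) / sin (?pi * ?s / 2)) sums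
       (S / ?pi - (\<Sum>k<Suc m. zeta (?s + 2 * of_nat k) * z powr (- ?s - 2 * of_nat k) * rGamma (1 - ?s - 2 * of_nat k)) / sin (?pi * ?s / 2))"
      by (intro sums_diff sums_divide sums_sum f)
    moreover have "wedge_integral \<epsilon> ?s (of_nat (Suc d) * z) - (\<Sum>k<Suc m. ?f d k) / sin (?pi * ?s / 2) =
       (-1) ^ Suc m * wedge_integral \<epsilon> (?s + 2 * of_nat (Suc m)) (of_nat (Suc d) * z)" for d
    proof -
      have "of_nat (Suc d) * z \<in> wedge \<epsilon>" using wedge_scale[OF z, of "real (Suc d)"] by simp
      then show ?thesis using wedge_integral_shift[OF \<epsilon> _ s(3), of "of_nat (Suc d) * z" "Suc m"] sn ss by simp
    qed
    ultimately have W: "(\<lambda>d. (-1) ^ Suc m * wedge_integral \<epsilon> (?s + 2 * of_nat (Suc m)) (of_nat (Suc d) * z)) sums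
       (S / ?pi - (\<Sum>k<Suc m. zeta (?s + 2 * of_nat k) * z powr (- ?s - 2 * of_nat k) * rGamma (1 - ?s - 2 * of_nat k)) / sin (?pi * ?s / 2))"
      by (simp only:)
    have "summable (\<lambda>d. wedge_integral \<epsilon> (?a + (2 + 2 * of_nat (Suc m))) (of_nat (Suc d) * z))"
      using x by (intro summable_norm_cancel[OF wedge_integral_series_holomorphic(2)[OF \<epsilon> z]]) auto
    from sums_mult[OF summable_sums[OF this], of "(-1) ^ Suc m"]
    have "(-1) ^ Suc m * (\<Sum>d. wedge_integral \<epsilon> (?a + (2 + 2 * of_nat (Suc m))) (of_nat (Suc d) * z)) =
      S / ?pi - (\<Sum>k<Suc m. zeta (?s + 2 * of_nat k) * z powr (- ?s - 2 * of_nat k) * rGamma (1 - ?s - 2 * of_nat k)) / sin (?pi * ?s / 2)"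
      using sums_unique2[OF _ W] by (simp only: add.assoc)
    then have R: "?R ?a = ?pi / sin (?pi * ?a / 2) * (- 1 / 2 - (\<Sum>k<Suc m. zeta (?s + 2 * of_nat k) * z powr (- ?s - 2 * of_nat k) * rGamma (1 - ?s - 2 * of_nat k)))
       + ?pi * (S / ?pi - (\<Sum>k<Suc m. zeta (?s + 2 * of_nat k) * z powr (- ?s - 2 * of_nat k) * rGamma (1 - ?s - 2 * of_nat k)) / sin (?pi * ?s / 2))"
      by (simp only: mult.assoc)
    have "?L ?a = S + ?pi / (2 * sin (?pi * ?s / 2))"
      using sums_unique[OF S(2)] by (simp add: algebra_simps)
    also have "\<dots> = ?R ?a"
    proof -
      have "S + p / (2 * - q) = p / q * (- 1 / 2 - T) + p * (S / p - T / - q)" if "p \<noteq> 0" "q \<noteq> 0" for p q T :: complex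
        using that by (simp add: field_simps)
      then show ?thesis unfolding R ss using sn by (simp only: of_real_eq_0_iff pi_neq_zero not_False_eq_True)
    qed
    finally show "?a \<in> ?\<Omega> \<and> ?L ?a = ?R ?a" using x \<open>?a \<notin> \<int>\<close> by simp
  qed (use a in auto)
qed

section \<open>The Lambert series and the summation formula\<close>

lemma inverse_powr_right_half:
  assumes "Re y > 0" shows "(1 / y) powr u = y powr (- u)"
proof -
  have "y \<notin> \<real>\<^sub>\<le>\<^sub>0" "y \<noteq> 0" using assms by (auto simp: complex_nonpos_Reals_iff)
  then show ?thesis by (simp add: powr_def Ln_inverse inverse_eq_divide[symmetric])
qed

lemma norm_exp_neg: "norm (exp (- of_nat n * y)) = exp (- (real n * Re y))"
  by (simp add: norm_exp_eq_Re)

text \<open>With terms d^a h(d j), grouping by n = d j produces sigma_a(n) h(n). It serves the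
  exponential side and the kernel side alike.\<close>

lemma divisor_series:
  fixes h :: "nat \<Rightarrow> complex"
  assumes "(\<lambda>(i, j). norm (of_nat (Suc i) powr a * h (Suc i * Suc j))) summable_on UNIV"
  obtains T where "(\<lambda>n. sigma_pow a (Suc n) * h (Suc n)) sums T"
    "(\<lambda>i. of_nat (Suc i) powr a * (\<Sum>j. h (Suc i * Suc j))) sums T"
proof -
  obtain T where T: "(\<lambda>i. \<Sum>j. of_nat (Suc i) powr a * h (Suc i * Suc j)) sums T"
    "\<And>i. summable (\<lambda>j. norm (of_nat (Suc i) powr a * h (Suc i * Suc j)))"
    "(\<lambda>n. \<Sum>d | d dvd Suc n. of_nat (Suc (d - 1)) powr a * h (Suc (d - 1) * Suc (Suc n div d - 1))) sums T"
    by (rule double_series[OF assms]) blast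
  show ?thesis
  proof (rule that[of T])
    have "(\<Sum>d | d dvd Suc n. of_nat (Suc (d - 1)) powr a * h (Suc (d - 1) * Suc (Suc n div d - 1))) = sigma_pow a (Suc n) * h (Suc n)" for n
      unfolding sigma_pow_def sum_distrib_right
    proof (rule sum.cong[OF refl])
      fix d assume "d \<in> {d. d dvd Suc n}"
      then have d: "d dvd Suc n" by simp
      show "of_nat (Suc (d - 1)) powr a * h (Suc (d - 1) * Suc (Suc n div d - 1)) = of_nat d powr a * h (Suc n)"
        unfolding divisor_pair(1,2)[OF d] divisor_pair(3)[OF d] ..
    qed
    with T(3) show "(\<lambda>n. sigma_pow a (Suc n) * h (Suc n)) sums T" by (simp only:)
    have "(\<Sum>j. of_nat (Suc i) powr a * h (Suc i * Suc j)) = of_nat (Suc i) powr a * (\<Sum>j. h (Suc i * Suc j))" for i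
    proof (rule suminf_mult)
      have "summable (\<lambda>j. (1 / of_nat (Suc i) powr a) * (of_nat (Suc i) powr a * h (Suc i * Suc j)))"
        by (intro summable_mult summable_norm_cancel[OF T(2)])
      then show "summable (\<lambda>j. h (Suc i * Suc j))" by (simp del: of_nat_Suc)
    qed
    with T(1) show "(\<lambda>i. of_nat (Suc i) powr a * (\<Sum>j. h (Suc i * Suc j))) sums T" by (simp only:)
  qed
qed

lemma summable_sigma_exp:
  assumes y: "Re y > 0"
  shows "summable (\<lambda>n. real_sigma \<alpha> (Suc n) * exp (- (real (Suc n) * Re y)))"
proof -
  \<comment> \<open>Large enough for both k > 1 and k - alpha > 1, the conditions of
    \<open>summable_real_sigma\<close>, since the exponential is dominated by n^(-k).\<close>
  define k where "k = nat \<lceil>2 + \<bar>\<alpha>\<bar>\<rceil>"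
  have k: "real k \<ge> 2 + \<bar>\<alpha>\<bar>" unfolding k_def by linarith
  have "filterlim (\<lambda>n. real n * Re y) at_top sequentially"
    by (rule filterlim_at_top_mult_tendsto_pos[OF tendsto_const y filterlim_real_sequentially, simplified])
  then have "(\<lambda>n. (real n * Re y) ^ k / exp (real n * Re y)) \<longlonglongrightarrow> 0"
    by (rule filterlim_compose[OF tendsto_power_div_exp_0])
  then have "Bseq (\<lambda>n. (real n * Re y) ^ k / exp (real n * Re y))"
    by (intro convergent_imp_Bseq) (auto simp: convergent_def)
  then obtain K where K: "K > 0" "\<And>n. norm ((real n * Re y) ^ k / exp (real n * Re y)) \<le> K" by (auto simp: Bseq_def)
  have s: "summable (\<lambda>n. K / Re y ^ k * (real_sigma \<alpha> (Suc n) * real (Suc n) powr (- real k)))"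
    using k by (intro summable_mult summable_real_sigma) auto
  show ?thesis
  proof (rule summable_comparison_test'[OF s])
    fix n :: nat
    define x where "x = real (Suc n)"
    have x: "x > 0" by (simp add: x_def)
    have "(x * Re y) ^ k / exp (x * Re y) \<le> K"
      using K(2)[of "Suc n"] x y by (simp add: x_def del: of_nat_Suc)
    then have "exp (- (x * Re y)) \<le> K / (x * Re y) ^ k"
      using x y by (simp add: exp_minus field_simps)
    also have "\<dots> = K / Re y ^ k * x powr (- real k)"
      using x by (simp add: powr_minus powr_realpow power_mult_distrib divide_inverse mult_ac)
    finally have "real_sigma \<alpha> (Suc n) * exp (- (x * Re y)) \<le> real_sigma \<alpha> (Suc n) * (K / Re y ^ k * x powr (- real k))"
      by (intro mult_left_mono real_sigma_nonneg)
    then show "norm (real_sigma \<alpha> (Suc n) * exp (- (real (Suc n) * Re y))) \<le> K / Re y ^ k * (real_sigma \<alpha> (Suc n) * real (Suc n) powr (- real k))"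
      using real_sigma_nonneg[of \<alpha> "Suc n"] by (simp add: mult_ac x_def del: of_nat_Suc)
  qed
qed

lemma sigma_exp_series:
  assumes y: "Re y > 0"
  shows "summable (\<lambda>n. sigma_pow a (Suc n) * exp (- of_nat (Suc n) * y))"
    and "(\<lambda>a. \<Sum>n. sigma_pow a (Suc n) * exp (- of_nat (Suc n) * y)) holomorphic_on UNIV"
proof -
  have b: "norm (sigma_pow a (Suc n) * exp (- of_nat (Suc n) * y)) \<le> real_sigma \<alpha> (Suc n) * exp (- (real (Suc n) * Re y))"
    if "Re a \<le> \<alpha>" for a \<alpha> n
  proof -
    show ?thesis unfolding norm_mult norm_exp_neg
      using order_trans[OF norm_sigma_pow_le real_sigma_mono[OF that], of n] by (simp add: mult_right_mono)
  qed
  show "summable (\<lambda>n. sigma_pow a (Suc n) * exp (- of_nat (Suc n) * y))"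
    by (rule summable_comparison_test'[OF summable_sigma_exp[OF y, of "Re a"]]) (rule b, simp)
  show "(\<lambda>a. \<Sum>n. sigma_pow a (Suc n) * exp (- of_nat (Suc n) * y)) holomorphic_on UNIV"
  proof (rule holomorphic_on_suminf)
    show "(\<lambda>a. sigma_pow a (Suc n) * exp (- of_nat (Suc n) * y)) holomorphic_on UNIV" for n
      unfolding sigma_pow_def by (intro holomorphic_intros)
    fix x :: complex
    have "norm (sigma_pow a (Suc n) * exp (- of_nat (Suc n) * y)) \<le> real_sigma (Re x + 1) (Suc n) * exp (- (real (Suc n) * Re y))"
      if "a \<in> ball x 1" for a n
      using Re_dist_less[OF that] by (intro b) linarith
    then show "\<exists>d>0. \<exists>M. summable M \<and> (\<forall>n. \<forall>a\<in>ball x d \<inter> UNIV. norm (sigma_pow a (Suc n) * exp (- of_nat (Suc n) * y)) \<le> M n)"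
      by (intro exI[of _ 1] conjI exI[of _ "\<lambda>n. real_sigma (Re x + 1) (Suc n) * exp (- (real (Suc n) * Re y))"]
          summable_sigma_exp y) auto
  qed simp
qed

text \<open>Origin of the half-plane in the theorem: the kernel decays like n^(-p) with p = Re a + 2
  m + 4, and the divisor series asks for p > 1, while p - Re a = 2 m + 4 exceeds 1 anyway.\<close>

lemma sigma_wedge_series:
  assumes \<epsilon>: "\<epsilon> > 0" and z: "z \<in> wedge \<epsilon>"
  shows "(\<lambda>a. \<Sum>n. sigma_pow a (Suc n) * wedge_integral \<epsilon> (a + (4 + 2 * of_nat m)) (of_nat (Suc n) * z))
      holomorphic_on {a. - 2 * real m - 3 < Re a}"
    and "- 2 * real m - 3 < Re a \<Longrightarrow>
      summable (\<lambda>n. norm (sigma_pow a (Suc n) * wedge_integral \<epsilon> (a + (4 + 2 * of_nat m)) (of_nat (Suc n) * z)))"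
proof -
  let ?A = "{a. - 2 * real m - 3 < Re a}" and ?q = "4 + 2 * of_nat m :: complex"
  have bound: "\<exists>d>0. \<exists>p C. summable (\<lambda>n. C n * real (Suc n) powr (- p)) \<and>
       (\<forall>n. \<forall>x\<in>ball a d \<inter> ?A. norm (sigma_pow x (Suc n)) \<le> C n \<and> p \<le> Re (x + ?q))"
    if a: "a \<in> ?A" for a
  proof -
    \<comment> \<open>The second bound keeps the decay exponent above 1 on the disc; r <= 1 keeps
      the other exponent, 2 m + 4 - 2 r, above 1.\<close>
    define r where "r = min 1 ((Re (a + ?q) - 1) / 2)"
    have "0 < Re (a + ?q) - 1" using a by simp
    moreover have "r \<le> (Re (a + ?q) - 1) / 2" unfolding r_def by (rule min.cobounded2)
    moreover have "r \<le> 1" unfolding r_def by (rule min.cobounded1)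
    ultimately have r: "r > 0" "Re (a + ?q) - r > 1" "r \<le> 1" by (auto simp: r_def)
    have "norm (sigma_pow x (Suc n)) \<le> real_sigma (Re a + r) (Suc n) \<and> Re (a + ?q) - r \<le> Re (x + ?q)" if "x \<in> ball a r" for x n
      using Re_dist_less[OF that] order_trans[OF norm_sigma_pow_le real_sigma_mono[of "Re x" "Re a + r"], of n]
      by (auto simp: abs_if split: if_splits)
    moreover have "summable (\<lambda>n. real_sigma (Re a + r) (Suc n) * real (Suc n) powr (- (Re (a + ?q) - r)))"
      using r by (intro summable_real_sigma) auto
    ultimately show ?thesis using r(1)
      by (intro exI[of _ r] conjI exI[of _ "Re (a + ?q) - r"] exI[of _ "\<lambda>n. real_sigma (Re a + r) (Suc n)"]) auto
  qed
  have hol: "(\<lambda>a. sigma_pow a (Suc n)) holomorphic_on ?A" for n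
    unfolding sigma_pow_def by (intro holomorphic_intros)
  have pos: "Re (a + ?q) > 0" if "a \<in> ?A" for a using that by simp
  show "(\<lambda>a. \<Sum>n. sigma_pow a (Suc n) * wedge_integral \<epsilon> (a + ?q) (of_nat (Suc n) * z)) holomorphic_on ?A"
    by (rule wedge_series(1)[OF \<epsilon> z open_Re_gt hol pos bound])
  show "summable (\<lambda>n. norm (sigma_pow a (Suc n) * wedge_integral \<epsilon> (a + ?q) (of_nat (Suc n) * z)))"
    if "- 2 * real m - 3 < Re a"
    by (rule wedge_series(2)[OF \<epsilon> z open_Re_gt hol pos bound]) (use that in auto)
qed

text \<open>Summing over the cofactors first gives 1 / (exp(d y) - 1) for each divisor d. In its
  partial fractions, 1 / u and -1/2 sum to the two zeta values, and the rest is a double series that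
  may be summed over d first.\<close>

lemma Lambert_series:
  assumes y: "Re y > 0" and a: "Re a < -1"
  defines "w \<equiv> 2 * of_real pi / y"
  obtains T where
    "(\<Sum>n. sigma_pow a (Suc n) * exp (- of_nat (Suc n) * y)) = zeta (1 - a) / y - zeta (- a) / 2 + T"
    "(\<lambda>k. 2 / y * (\<Sum>i. of_nat (Suc i) powr (a + 1) / ((of_nat (Suc k) * w)\<^sup>2 + (of_nat (Suc i))\<^sup>2))) sums T"
proof -
  let ?pi = "complex_of_real pi"
  have y0: "y \<noteq> 0" using y by auto
  have w: "Re w > 0"
    using y by (auto simp: w_def Re_divide intro!: divide_pos_pos add_pos_nonneg mult_pos_pos)
  define \<alpha> where "\<alpha> = Re a"
  have \<alpha>: "\<alpha> < -1" using a by (simp add: \<alpha>_def)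
  have "(\<lambda>(i, j). norm (of_nat (Suc i) powr a * exp (- of_nat (Suc i * Suc j) * y))) summable_on UNIV"
  proof (rule summable_on_comparison_test)
    have "summable (\<lambda>j. exp (- (real (Suc j) * Re y)))"
      using exp_geometric_sums(2)[OF y] unfolding norm_exp_neg .
    then show "(\<lambda>(i, j). real (Suc i) powr \<alpha> * exp (- (real (Suc j) * Re y))) summable_on UNIV"
      using \<alpha> by (intro summable_on_product_nat summable_Suc_powr) auto
    fix x :: "nat \<times> nat"
    obtain i j where x: "x = (i, j)" by (cases x)
    have "real (Suc j) * Re y \<le> real (Suc i * Suc j) * Re y"
      using y by (intro mult_right_mono) auto
    then have "norm (exp (- of_nat (Suc i * Suc j) * y)) \<le> exp (- (real (Suc j) * Re y))"
      unfolding norm_exp_neg by (simp only: exp_le_cancel_iff neg_le_iff_le)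
    then show "(case x of (i, j) \<Rightarrow> norm (of_nat (Suc i) powr a * exp (- of_nat (Suc i * Suc j) * y))) \<le> (case x of (i, j) \<Rightarrow> real (Suc i) powr \<alpha> * exp (- (real (Suc j) * Re y)))"
      unfolding x prod.case norm_mult norm_Suc_powr \<alpha>_def by (intro mult_left_mono) auto
  qed auto
  then obtain N where N: "(\<lambda>n. sigma_pow a (Suc n) * exp (- of_nat (Suc n) * y)) sums N"
    "(\<lambda>i. of_nat (Suc i) powr a * (\<Sum>j. exp (- of_nat (Suc i * Suc j) * y))) sums N"
    by (rule divisor_series[where h = "\<lambda>n. exp (- of_nat n * y)"])
  define g where "g = (\<lambda>i k. 2 / y * (of_nat (Suc i) powr (a + 1) / ((of_nat (Suc k) * w)\<^sup>2 + (of_nat (Suc i))\<^sup>2)))"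
  obtain d where d: "d > 0" "\<And>k t. k > 0 \<Longrightarrow> d * (k\<^sup>2 + t\<^sup>2) \<le> norm ((complex_of_real k)\<^sup>2 + w\<^sup>2 * (of_real t)\<^sup>2)"
    using square_sum_bound[OF w] by metis
  \<comment> \<open>Convergence needs p > 1 for the sum over k and p < -alpha for the sum over i; (1
    - alpha) / 2 is the midpoint, and the cap 2 is the range of \<open>Young_powr\<close>.\<close>
  define p where "p = min 2 ((1 - \<alpha>) / 2)"
  have p: "1 < p" "p \<le> 2" "p < - \<alpha>" using \<alpha> by (auto simp: p_def min_def field_simps)
  have gb: "norm (g i k) \<le> norm (2 / y) / d * (real (Suc i) powr (\<alpha> - 1 + p) * real (Suc k) powr (- p))" for i k
  proof -
    define I K where "I = real (Suc i)" and "K = real (Suc k)"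
    have IK: "I > 0" "K > 0" by (auto simp: I_def K_def)
    have 1: "d * (K\<^sup>2 + I\<^sup>2) \<le> norm ((of_real K * w)\<^sup>2 + (of_real I)\<^sup>2)"
      using d(2)[OF IK(1), of K] by (simp add: power_mult_distrib mult.commute add.commute)
    have "d * (K powr p * I powr (2 - p)) \<le> d * (K\<^sup>2 + I\<^sup>2)"
      using IK p d by (intro mult_left_mono Young_powr) auto
    with 1 have 2: "d * (K powr p * I powr (2 - p)) \<le> norm ((of_real K * w)\<^sup>2 + (of_real I)\<^sup>2)" by linarith
    have "norm (g i k) = norm (2 / y) * (I powr (\<alpha> + 1) / norm ((of_real K * w)\<^sup>2 + (of_real I)\<^sup>2))"
      unfolding g_def norm_mult norm_divide norm_Suc_powr by (simp add: I_def K_def \<alpha>_def)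
    also have "\<dots> \<le> norm (2 / y) * (I powr (\<alpha> + 1) / (d * (K powr p * I powr (2 - p))))"
      using IK d 2 by (intro mult_left_mono frac_le) auto
    also have "I powr (\<alpha> + 1) / (d * (K powr p * I powr (2 - p))) = 1 / d * ((I powr (\<alpha> + 1) / I powr (2 - p)) * K powr (- p))"
      by (simp add: powr_minus divide_inverse)
    also have "I powr (\<alpha> + 1) / I powr (2 - p) = I powr (\<alpha> - 1 + p)"
      by (simp add: algebra_simps flip: powr_diff)
    finally show ?thesis by (simp add: I_def K_def)
  qed
  have "(\<lambda>(i, k). norm (g i k)) summable_on UNIV"
  proof (rule summable_on_comparison_test)
    have "(\<lambda>(i, k). (norm (2 / y) / d * real (Suc i) powr (\<alpha> - 1 + p)) * real (Suc k) powr (- p)) summable_on UNIV"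
      using p d by (intro summable_on_product_nat summable_mult summable_Suc_powr) auto
    then show "(\<lambda>(i, k). norm (2 / y) / d * (real (Suc i) powr (\<alpha> - 1 + p) * real (Suc k) powr (- p))) summable_on UNIV"
      by (simp only: mult.assoc)
  qed (use gb in auto)
  then obtain T where T: "(\<lambda>i. \<Sum>k. g i k) sums T" "(\<lambda>k. \<Sum>i. g i k) sums T" "\<And>k. summable (\<lambda>i. norm (g i k))"
    by (rule double_series) blast
  have row: "of_nat (Suc i) powr a * (\<Sum>j. exp (- of_nat (Suc i * Suc j) * y)) =
      of_nat (Suc i) powr (- (1 - a)) / y - of_nat (Suc i) powr (- (- a)) / 2 + (\<Sum>k. g i k)" for i
  proof -
    define D where "D = complex_of_nat (Suc i)"
    have D0: "D \<noteq> 0" by (simp add: D_def del: of_nat_Suc)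
    have u: "Re (D * y) > 0" using y by (simp add: D_def del: of_nat_Suc)
    have "(\<Sum>j. exp (- of_nat (Suc i * Suc j) * y)) = (\<Sum>j. exp (- of_nat (Suc j) * (D * y)))"
    proof -
      have "- of_nat (Suc i * Suc j) * y = - of_nat (Suc j) * (D * y)" for j
        by (simp add: D_def del: of_nat_Suc mult_Suc mult_Suc_right)
      then show ?thesis by (simp only:)
    qed
    also have "\<dots> = 1 / (exp (D * y) - 1)" using exp_geometric_sums(1)[OF u] by (rule sums_unique[symmetric])
    finally have e: "(\<Sum>j. exp (- of_nat (Suc i * Suc j) * y)) = 1 / (exp (D * y) - 1)" .
    have "(\<lambda>k. D powr a * (2 * (D * y) / ((D * y)\<^sup>2 + 4 * ?pi\<^sup>2 * (of_nat (Suc k))\<^sup>2))) sums (D powr a * (1 / (exp (D * y) - 1) - 1 / (D * y) + 1 / 2))"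
      by (intro sums_mult Planck_partial_fractions u)
    moreover have "D powr a * (2 * (D * y) / ((D * y)\<^sup>2 + 4 * ?pi\<^sup>2 * (of_nat (Suc k))\<^sup>2)) = g i k" for k
    proof -
      have "(D * y)\<^sup>2 + 4 * ?pi\<^sup>2 * (of_nat (Suc k))\<^sup>2 = y\<^sup>2 * ((of_nat (Suc k) * w)\<^sup>2 + D\<^sup>2)"
        unfolding w_def using y0 by (simp add: power_mult_distrib power_divide distrib_left del: of_nat_Suc)
      moreover have "D powr (a + 1) = D powr a * D" using D0 by (simp add: powr_add)
      ultimately show ?thesis unfolding g_def D_def[symmetric] using y0 by (simp add: power2_eq_square)
    qed
    ultimately have "(\<Sum>k. g i k) = D powr a * (1 / (exp (D * y) - 1) - 1 / (D * y) + 1 / 2)"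
      by (simp add: sums_iff)
    moreover have "D powr (- (1 - a)) = D powr a / D" using D0 by (simp add: powr_diff)
    ultimately show ?thesis unfolding e D_def[symmetric] by (simp add: algebra_simps)
  qed
  have "(\<lambda>i. of_nat (Suc i) powr (- (1 - a)) / y - of_nat (Suc i) powr (- (- a)) / 2 + (\<Sum>k. g i k)) sums (zeta (1 - a) / y - zeta (- a) / 2 + T)"
    using a by (intro sums_add sums_diff sums_divide zeta_sums T) auto
  then have "N = zeta (1 - a) / y - zeta (- a) / 2 + T"
    using N(2) unfolding row by (rule sums_unique2[rotated])
  then have "(\<Sum>n. sigma_pow a (Suc n) * exp (- of_nat (Suc n) * y)) = zeta (1 - a) / y - zeta (- a) / 2 + T"
    using sums_unique[OF N(1)] by simp
  moreover have "(\<Sum>i. g i k) = 2 / y * (\<Sum>i. of_nat (Suc i) powr (a + 1) / ((of_nat (Suc k) * w)\<^sup>2 + (of_nat (Suc i))\<^sup>2))" for k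
    unfolding g_def
  proof (rule suminf_mult)
    have "summable (\<lambda>i. (y / 2) * g i k)" by (intro summable_mult summable_norm_cancel[OF T(3)])
    then show "summable (\<lambda>i. of_nat (Suc i) powr (a + 1) / ((of_nat (Suc k) * w)\<^sup>2 + (of_nat (Suc i))\<^sup>2))"
      unfolding g_def using y0 by (simp del: of_nat_Suc)
  qed
  ultimately show ?thesis using T(2) by (intro that[of T]) simp_all
qed

lemma summable_wedge_pairs:
  assumes \<epsilon>: "\<epsilon> > 0" and z: "z \<in> wedge \<epsilon>" and s: "Re s > 1" "Re s - Re a > 1"
  shows "(\<lambda>(i, j). norm (of_nat (Suc i) powr a * wedge_integral \<epsilon> s (of_nat (Suc i * Suc j) * z))) summable_on UNIV"
proof -
  obtain C where C: "C \<ge> 0" "\<And>r. r > 0 \<Longrightarrow> norm (wedge_integral \<epsilon> s (of_real r * z)) \<le> C * r powr (- Re s)"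
  proof -
    have "0 < Re s" using s by simp
    then show ?thesis
      using wedge_integral_bound[OF \<epsilon> z, of "Re s" "Re s" "norm s"] that by (metis order_refl)
  qed
  show ?thesis
  proof (rule summable_on_comparison_test)
    show "(\<lambda>(i, j). (C * real (Suc i) powr (Re a - Re s)) * real (Suc j) powr (- Re s)) summable_on UNIV"
      using C s by (intro summable_on_product_nat summable_mult summable_Suc_powr) auto
    fix x :: "nat \<times> nat"
    obtain i j where x: "x = (i, j)" by (cases x)
    have "norm (wedge_integral \<epsilon> s (of_real (real (Suc i * Suc j)) * z)) \<le> C * real (Suc i * Suc j) powr (- Re s)"
      by (intro C) (simp del: of_nat_Suc)
    also have "real (Suc i * Suc j) powr (- Re s) = real (Suc i) powr (- Re s) * real (Suc j) powr (- Re s)"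
      unfolding of_nat_mult by (rule powr_mult)
    finally have "norm (of_nat (Suc i) powr a * wedge_integral \<epsilon> s (of_nat (Suc i * Suc j) * z)) \<le>
       real (Suc i) powr Re a * (C * (real (Suc i) powr (- Re s) * real (Suc j) powr (- Re s)))"
      unfolding norm_mult norm_Suc_powr of_real_of_nat_eq by (intro mult_left_mono) auto
    also have "\<dots> = (C * real (Suc i) powr (Re a - Re s)) * real (Suc j) powr (- Re s)"
      by (simp add: powr_diff powr_minus divide_inverse del: of_nat_Suc)
    finally show "(case x of (i, j) \<Rightarrow> norm (of_nat (Suc i) powr a * wedge_integral \<epsilon> s (of_nat (Suc i * Suc j) * z))) \<le>
       (case x of (i, j) \<Rightarrow> (C * real (Suc i) powr (Re a - Re s)) * real (Suc j) powr (- Re s))"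
      unfolding x prod.case .
  qed auto
qed

text \<open>The inner sum for index k is a lattice sum at (k + 1) times 2 pi / y, so its closed form
  applies. Summation over k turns the powers of k + 1 into zeta(-a) and zeta(2 j + 2), and the
  kernel series into a divisor sum. The strip lies in Re a < -1, contains no integer, and is right
  of -2 m - 3 for every m.\<close>

lemma Voronoi_strip:
  assumes \<epsilon>: "\<epsilon> > 0" and y: "Re y > 0" and w: "2 * of_real pi / y \<in> wedge \<epsilon>"
    and a: "- 2 < Re a" "Re a < - 1"
  shows "(\<Sum>n. sigma_pow a (Suc n) * exp (- of_nat (Suc n) * y)) + zeta_part y a + finite_part m y a =
     (-1) ^ Suc m * (2 * of_real pi / y) powr (1 + a) *
     (\<Sum>n. sigma_pow a (Suc n) * wedge_integral \<epsilon> (a + (4 + 2 * of_nat m)) (of_nat (Suc n) * (4 * (of_real pi)\<^sup>2 / y)))"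
proof -
  let ?pi = "complex_of_real pi"
  define w1 where "w1 = 2 * ?pi / y"
  define z1 where "z1 = 4 * ?pi\<^sup>2 / y"
  define s where "s = a + (4 + 2 * of_nat m)"
  define \<sigma> where "\<sigma> = sin (?pi * a / 2)"
  define Z where "Z = (\<lambda>k. zeta (a + 2 + 2 * of_nat k) * rGamma (1 - (a + 2) - 2 * of_nat k))"
  have ww: "w1 \<in> wedge \<epsilon>" using w by (simp add: w1_def)
  have w0: "w1 \<noteq> 0" using wedge_Re_pos[OF ww] by auto
  have zw: "z1 = 2 * ?pi * w1" by (simp add: z1_def w1_def power2_eq_square)
  have zz: "z1 \<in> wedge \<epsilon>" using wedge_scale[OF ww, of "2 * pi"] by (simp add: zw)
  have z0: "z1 \<noteq> 0" using wedge_Re_pos[OF zz] by auto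
  have aI: "a \<notin> \<int>"
  proof
    assume "a \<in> \<int>"
    then obtain n where "a = of_int n" by (auto elim: Ints_cases)
    with a have "- 2 < n" "n < - 1" by auto
    then show False by linarith
  qed
  have \<sigma>0: "\<sigma> \<noteq> 0" unfolding \<sigma>_def by (rule sin_half_neq_0[OF aI])
  have Rs: "Re s > 1" "Re s - Re a > 1" using a by (simp_all add: s_def)
  obtain T where T:
    "(\<Sum>n. sigma_pow a (Suc n) * exp (- of_nat (Suc n) * y)) = zeta (1 - a) / y - zeta (- a) / 2 + T"
    "(\<lambda>k. 2 / y * (\<Sum>i. of_nat (Suc i) powr (a + 1) / ((of_nat (Suc k) * w1)\<^sup>2 + (of_nat (Suc i))\<^sup>2))) sums T"
    using Lambert_series[OF y a(2)] unfolding w1_def by blast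
  obtain W where W: "(\<lambda>n. sigma_pow a (Suc n) * wedge_integral \<epsilon> s (of_nat (Suc n) * z1)) sums W"
    "(\<lambda>i. of_nat (Suc i) powr a * (\<Sum>j. wedge_integral \<epsilon> s (of_nat (Suc i * Suc j) * z1))) sums W"
    by (rule divisor_series[OF summable_wedge_pairs[OF \<epsilon> zz Rs]])
  have kpow: "(of_nat (Suc k) * x) powr u = of_nat (Suc k) powr u * x powr u" for k and x u :: complex
    by (intro powr_times_real_left) auto
  have summand: "2 / y * (\<Sum>i. of_nat (Suc i) powr (a + 1) / ((of_nat (Suc k) * w1)\<^sup>2 + (of_nat (Suc i))\<^sup>2)) =
      2 / y * w1 powr a * ?pi * ((- 1 / 2 / \<sigma>) * of_nat (Suc k) powr (- (- a))
      - (\<Sum>j<Suc m. Z j * z1 powr (- (a + 2) - 2 * of_nat j) * of_nat (Suc k) powr (- (2 * of_nat j + 2))) / \<sigma>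
      + (-1) ^ Suc m * (of_nat (Suc k) powr a * (\<Sum>j. wedge_integral \<epsilon> s (of_nat (Suc k * Suc j) * z1))))" for k
  proof -
    define K where "K = complex_of_nat (Suc k)"
    define v where "v = K * w1"
    have K0: "K \<noteq> 0" by (simp add: K_def del: of_nat_Suc)
    have v: "v \<in> wedge \<epsilon>" using wedge_scale[OF ww, of "real (Suc k)"] by (simp add: v_def K_def)
    have v0: "v \<noteq> 0" using wedge_Re_pos[OF v] by auto
    have zv: "2 * ?pi * v = K * z1" by (simp add: v_def zw)
    have L: "(\<Sum>i. v powr (- a) * of_nat (Suc i) powr (a + 1) / (v\<^sup>2 + (of_nat (Suc i))\<^sup>2)) =
      ?pi / \<sigma> * (- 1 / 2 - (\<Sum>j<Suc m. zeta (a + 2 + 2 * of_nat j) * (K * z1) powr (- (a + 2) - 2 * of_nat j) * rGamma (1 - (a + 2) - 2 * of_nat j)))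
      + ?pi * (-1) ^ Suc m * (\<Sum>d. wedge_integral \<epsilon> (a + (2 + 2 * of_nat (Suc m))) (of_nat (Suc d) * (K * z1)))"
      using lattice_sum_continued[OF \<epsilon> v, of m a] a aI unfolding zv \<sigma>_def by simp
    have sm: "summable (\<lambda>i. v powr (- a) * of_nat (Suc i) powr (a + 1) / (v\<^sup>2 + (of_nat (Suc i))\<^sup>2))"
      by (rule summable_rational_series) (use wedge_Re_pos[OF v] a in auto)
    have "(\<Sum>i. of_nat (Suc i) powr (a + 1) / (v\<^sup>2 + (of_nat (Suc i))\<^sup>2)) =
        (\<Sum>i. v powr a * (v powr (- a) * of_nat (Suc i) powr (a + 1) / (v\<^sup>2 + (of_nat (Suc i))\<^sup>2)))"
    proof -
      have "v powr a * (v powr (- a) * A / D) = A / D" for A D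
        using v0 by (simp add: powr_minus)
      then show ?thesis by (simp only:)
    qed
    also have "\<dots> = v powr a * (\<Sum>i. v powr (- a) * of_nat (Suc i) powr (a + 1) / (v\<^sup>2 + (of_nat (Suc i))\<^sup>2))"
      by (rule suminf_mult[OF sm])
    also have "v powr a = w1 powr a * K powr a" unfolding v_def K_def kpow by simp
    also note L
    also have "(\<Sum>j<Suc m. zeta (a + 2 + 2 * of_nat j) * (K * z1) powr (- (a + 2) - 2 * of_nat j) * rGamma (1 - (a + 2) - 2 * of_nat j))
       = (\<Sum>j<Suc m. Z j * z1 powr (- (a + 2) - 2 * of_nat j) * K powr (- (2 * of_nat j + 2))) / K powr a"
      unfolding sum_divide_distrib
    proof (rule sum.cong[OF refl])
      fix j
      have "- (a + 2) - 2 * of_nat j = - (2 * of_nat j + 2) - a" by simp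
      then have "K powr (- (a + 2) - 2 * of_nat j) = K powr (- (2 * of_nat j + 2)) / K powr a"
        by (simp only: powr_diff)
      moreover have "(K * z1) powr (- (a + 2) - 2 * of_nat j) = K powr (- (a + 2) - 2 * of_nat j) * z1 powr (- (a + 2) - 2 * of_nat j)"
        unfolding K_def by (rule kpow)
      ultimately show "zeta (a + 2 + 2 * of_nat j) * (K * z1) powr (- (a + 2) - 2 * of_nat j) * rGamma (1 - (a + 2) - 2 * of_nat j) =
          Z j * z1 powr (- (a + 2) - 2 * of_nat j) * K powr (- (2 * of_nat j + 2)) / K powr a"
        unfolding Z_def by simp
    qed
    also have "(\<Sum>d. wedge_integral \<epsilon> (a + (2 + 2 * of_nat (Suc m))) (of_nat (Suc d) * (K * z1))) =
        (\<Sum>j. wedge_integral \<epsilon> s (of_nat (Suc k * Suc j) * z1))"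
    proof (rule suminf_cong)
      fix j
      have "of_nat (Suc j) * (K * z1) = of_nat (Suc k * Suc j) * z1" unfolding K_def of_nat_mult by (simp only: mult_ac)
      moreover have "a + (2 + 2 * of_nat (Suc m)) = s" by (simp add: s_def)
      ultimately show "wedge_integral \<epsilon> (a + (2 + 2 * of_nat (Suc m))) (of_nat (Suc j) * (K * z1)) = wedge_integral \<epsilon> s (of_nat (Suc k * Suc j) * z1)"
        by (simp only:)
    qed
    finally have E: "(\<Sum>i. of_nat (Suc i) powr (a + 1) / (v\<^sup>2 + (of_nat (Suc i))\<^sup>2)) =
       w1 powr a * K powr a * (?pi / \<sigma> * (- 1 / 2 - (\<Sum>j<Suc m. Z j * z1 powr (- (a + 2) - 2 * of_nat j) * K powr (- (2 * of_nat j + 2))) / K powr a)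
        + ?pi * (-1) ^ Suc m * (\<Sum>j. wedge_integral \<epsilon> s (of_nat (Suc k * Suc j) * z1)))" .
    \<comment> \<open>\<open>P\<close> stands for K^a: it survives at the constant -1/2, giving
      zeta(-a), and at the kernel series, giving sigma_a, but cancels in the finite sum against the
      K^(-a) split off there.\<close>
    have gen: "A * (W' * P * (p / q * (- 1 / 2 - S / P) + p * e * R)) = A * W' * p * ((- 1 / 2 / q) * P - S / q + e * (P * R))"
      if "P \<noteq> 0" for A W' P p q S e R :: complex
      using that by (simp add: algebra_simps add_divide_distrib)
    have "K powr a \<noteq> 0" using K0 by simp
    from gen[OF this] show ?thesis
      unfolding K_def[symmetric] v_def[symmetric] E minus_minus .
  qed
  have Z2: "(\<lambda>k. of_nat (Suc k) powr (- (2 * of_nat j + 2))) sums zeta (2 * of_nat j + 2)" for j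
    by (rule zeta_sums) simp
  have Z1: "(\<lambda>k. of_nat (Suc k) powr (- (- a))) sums zeta (- a)"
    using a by (intro zeta_sums) auto
  have "(\<lambda>k. 2 / y * w1 powr a * ?pi * ((- 1 / 2 / \<sigma>) * of_nat (Suc k) powr (- (- a))
      - (\<Sum>j<Suc m. Z j * z1 powr (- (a + 2) - 2 * of_nat j) * of_nat (Suc k) powr (- (2 * of_nat j + 2))) / \<sigma>
      + (-1) ^ Suc m * (of_nat (Suc k) powr a * (\<Sum>j. wedge_integral \<epsilon> s (of_nat (Suc k * Suc j) * z1))))) sums
     (2 / y * w1 powr a * ?pi * ((- 1 / 2 / \<sigma>) * zeta (- a)
      - (\<Sum>j<Suc m. Z j * z1 powr (- (a + 2) - 2 * of_nat j) * zeta (2 * of_nat j + 2)) / \<sigma>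
      + (-1) ^ Suc m * W))"
    by (intro sums_mult sums_add sums_diff sums_divide sums_sum Z1 Z2 W(2))
  then have TT: "T = 2 / y * w1 powr a * ?pi * ((- 1 / 2 / \<sigma>) * zeta (- a)
      - (\<Sum>j<Suc m. Z j * z1 powr (- (a + 2) - 2 * of_nat j) * zeta (2 * of_nat j + 2)) / \<sigma>
      + (-1) ^ Suc m * W)"
    using T(2) unfolding summand by (rule sums_unique2[rotated])
  have w1a: "2 / y * w1 powr a * ?pi = w1 powr (1 + a)"
    using w0 by (simp add: powr_add) (simp add: w1_def)
  have fin: "w1 powr (1 + a) * ((\<Sum>j<Suc m. Z j * z1 powr (- (a + 2) - 2 * of_nat j) * zeta (2 * of_nat j + 2)) / \<sigma>) = finite_part m y a"
  proof -
    \<comment> \<open>Since \<open>z1\<close> is the positive number 2 pi times \<open>w1\<close>,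
      principal powers split without a branch correction, and this yields the constant (2 pi)^(-a -
      3) of \<open>finite_part\<close>.\<close>
    have c: "w1 powr (1 + a) * z1 powr (- (a + 2) - 2 * of_nat j) = y * (2 * ?pi) powr (- a - 3) * z1 powi (- 2 * int j)" for j
    proof -
      have e1: "z1 powr (- (a + 2) - 2 * of_nat j) = z1 powr (- (a + 2)) * z1 powi (- 2 * int j)"
      proof -
        have "z1 powi (- 2 * int j) = z1 powr (- of_nat (2 * j))"
          unfolding powr_minus power_int_neg_even using z0 by (subst powr_complexpow) auto
        then show ?thesis by (simp flip: powr_add)
      qed
      have e2: "z1 powr (- (a + 2)) = (2 * ?pi) powr (- (a + 2)) * w1 powr (- (a + 2))"
      proof -
        have "(of_real (2 * pi) * w1) powr (- (a + 2)) = of_real (2 * pi) powr (- (a + 2)) * w1 powr (- (a + 2))"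
          by (intro powr_times_real_left) auto
        then show ?thesis by (simp add: zw)
      qed
      have e3: "w1 powr (1 + a) * w1 powr (- (a + 2)) = y / (2 * ?pi)"
      proof -
        have "w1 powr (1 + a) * w1 powr (- (a + 2)) = w1 powr (- 1)" by (simp flip: powr_add)
        also have "\<dots> = 1 / w1" using w0 powr_minus[of w1 1] by (simp add: inverse_eq_divide)
        finally show ?thesis by (simp add: w1_def)
      qed
      have e4: "(2 * ?pi) powr (- a - 3) = (2 * ?pi) powr (- (a + 2)) / (2 * ?pi)"
      proof -
        have "- a - 3 = - (a + 2) - 1" by simp
        then show ?thesis by (simp only: powr_diff) simp
      qed
      have "w1 powr (1 + a) * z1 powr (- (a + 2) - 2 * of_nat j) =
         (w1 powr (1 + a) * w1 powr (- (a + 2))) * (2 * ?pi) powr (- (a + 2)) * z1 powi (- 2 * int j)"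
        unfolding e1 e2 by (simp only: mult_ac)
      then show ?thesis unfolding e3 e4 by simp
    qed
    have "w1 powr (1 + a) * ((\<Sum>j<Suc m. Z j * z1 powr (- (a + 2) - 2 * of_nat j) * zeta (2 * of_nat j + 2)) / \<sigma>) =
       (\<Sum>j<Suc m. Z j * (w1 powr (1 + a) * z1 powr (- (a + 2) - 2 * of_nat j)) * zeta (2 * of_nat j + 2)) / \<sigma>"
      by (simp add: sum_distrib_left mult_ac del: sum.lessThan_Suc)
    also have "\<dots> = (\<Sum>j<Suc m. y * (2 * ?pi) powr (- a - 3) / \<sigma> * (zeta (a + 2 * of_nat j + 2) * zeta (2 * of_nat j + 2) / Gamma (- a - 1 - 2 * of_nat j) * z1 powi (- 2 * int j)))"
      unfolding sum_divide_distrib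
    proof (rule sum.cong[OF refl])
      fix j
      have r: "1 - (a + 2) - 2 * of_nat j = - a - 1 - 2 * of_nat j" by simp
      have q: "a + 2 + 2 * of_nat j = a + 2 * of_nat j + 2" by simp
      show "Z j * (w1 powr (1 + a) * z1 powr (- (a + 2) - 2 * of_nat j)) * zeta (2 * of_nat j + 2) / \<sigma> =
        y * (2 * ?pi) powr (- a - 3) / \<sigma> * (zeta (a + 2 * of_nat j + 2) * zeta (2 * of_nat j + 2) / Gamma (- a - 1 - 2 * of_nat j) * z1 powi (- 2 * int j))"
        unfolding c Z_def r q rGamma_inverse_Gamma by (simp add: divide_inverse)
    qed
    also have "\<dots> = finite_part m y a"
      unfolding finite_part_def sum_distrib_left[symmetric] \<sigma>_def z1_def by (simp add: atLeast0AtMost lessThan_Suc_atMost)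
    finally show ?thesis .
  qed
  have zp: "zeta_part y a = 1/2 * (w1 powr (1 + a) * (1 / \<sigma>) + 1) * zeta (- a) - zeta (1 - a) / y"
    unfolding zeta_part_def w1_def \<sigma>_def ..
  have "(\<Sum>n. sigma_pow a (Suc n) * wedge_integral \<epsilon> s (of_nat (Suc n) * z1)) = W"
    using sums_unique[OF W(1)] by simp
  moreover have "zeta (1 - a) / y - zeta (- a) / 2 + w1 powr (1 + a) * ((- 1 / 2 / \<sigma>) * zeta (- a) - F / \<sigma> + e * W)
      + (1/2 * (w1 powr (1 + a) * (1 / \<sigma>) + 1) * zeta (- a) - zeta (1 - a) / y) + w1 powr (1 + a) * (F / \<sigma>) = e * w1 powr (1 + a) * W" for F e
    by (simp add: algebra_simps add_divide_distrib)
  ultimately show ?thesis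
    unfolding T(1) TT w1a zp fin[symmetric] z1_def[symmetric] s_def[symmetric] w1_def[symmetric] by (simp only:)
qed

section \<open>Continuation to the half-plane and passage to the integers\<close>

lemma holomorphic_zeta_part:
  assumes y: "Re y > 0"
  shows "zeta_part y holomorphic_on (A - \<int>)"
proof -
  have "2 * of_real pi / y \<noteq> 0" using y by auto
  moreover have "- a \<noteq> 1" "1 - a \<noteq> 1" if "a \<in> A - \<int>" for a
  proof -
    show "- a \<noteq> 1"
    proof
      assume "- a = 1"
      then have "a = of_int (- 1)" by (simp add: minus_equation_iff)
      with that show False by (metis DiffD2 Ints_of_int)
    qed
    show "1 - a \<noteq> 1" using that by auto
  qed
  ultimately show ?thesis
    unfolding zeta_part_def using sin_half_neq_0 y
    by (intro holomorphic_intros holomorphic_zeta_shift) auto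
qed

lemma holomorphic_finite_part: "finite_part m y holomorphic_on (A - \<int>)"
proof -
  have "(\<lambda>a. zeta (a + 2 * of_nat k + 2)) holomorphic_on (A - \<int>)" for k
  proof (rule holomorphic_zeta_shift)
    fix a assume a: "a \<in> A - \<int>"
    show "a + 2 * of_nat k + 2 \<noteq> 1"
    proof
      assume "a + 2 * of_nat k + 2 = 1"
      then have "a = 1 - 2 - 2 * of_nat k" by (simp only: eq_diff_eq)
      then have "a = of_int (1 - 2 - 2 * int k)" by simp
      with a show False by (metis DiffD2 Ints_of_int)
    qed
  qed (intro holomorphic_intros)
  then show ?thesis
    unfolding finite_part_def divide_inverse[of _ "Gamma _"] rGamma_inverse_Gamma[symmetric]
    using sin_half_neq_0 by (intro holomorphic_intros) auto
qed

text \<open>The elementary parts are singular at most at integers, and the half-plane without them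
  is still connected, so the real segment from -2 to -1 determines the identity.\<close>

lemma Voronoi_continued:
  assumes \<epsilon>: "\<epsilon> > 0" and y: "Re y > 0" and w: "2 * of_real pi / y \<in> wedge \<epsilon>"
    and a: "- 2 * real m - 3 < Re a" "a \<notin> \<int>"
  shows "(\<Sum>n. sigma_pow a (Suc n) * exp (- of_nat (Suc n) * y)) + zeta_part y a + finite_part m y a =
     (-1) ^ Suc m * (2 * of_real pi / y) powr (1 + a) *
     (\<Sum>n. sigma_pow a (Suc n) * wedge_integral \<epsilon> (a + (4 + 2 * of_nat m)) (of_nat (Suc n) * (4 * (of_real pi)\<^sup>2 / y)))"
    (is "?L a = ?R a")
proof (rule holomorphic_eq_on_real_segment[where f = ?L and g = ?R and S = "{a. - 2 * real m - 3 < Re a} - \<int>" and a = "-2" and b = "-1"])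
  let ?S = "{a. - 2 * real m - 3 < Re a} - \<int>"
  have y0: "2 * of_real pi / y \<noteq> 0" using y by auto
  have "of_real (2 * pi) * (2 * of_real pi / y) \<in> wedge \<epsilon>" by (rule wedge_scale[OF w]) simp
  then have z: "4 * (of_real pi)\<^sup>2 / y \<in> wedge \<epsilon>" by (simp add: power2_eq_square)
  show "open ?S" "connected ?S"
    by (intro open_minus_Ints connected_minus_Ints open_Re_gt convex_Re_gt)+
  have "(\<lambda>a. \<Sum>n. sigma_pow a (Suc n) * exp (- of_nat (Suc n) * y)) holomorphic_on ?S"
    by (rule holomorphic_on_subset[OF sigma_exp_series(2)[OF y]]) simp
  then show "?L holomorphic_on ?S"
    by (intro holomorphic_on_add holomorphic_zeta_part[OF y] holomorphic_finite_part)
  have "(\<lambda>a. \<Sum>n. sigma_pow a (Suc n) * wedge_integral \<epsilon> (a + (4 + 2 * of_nat m)) (of_nat (Suc n) * (4 * (of_real pi)\<^sup>2 / y))) holomorphic_on ?S"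
    by (rule holomorphic_on_subset[OF sigma_wedge_series(1)[OF \<epsilon> z]]) auto
  then show "?R holomorphic_on ?S"
    using y0 by (intro holomorphic_intros) auto
  fix x :: real assume x: "- 2 < x" "x < - 1"
  have "complex_of_real x \<notin> \<int>"
  proof
    assume "complex_of_real x \<in> \<int>"
    then obtain n where "complex_of_real x = of_int n" by (auto elim: Ints_cases)
    then have "x = of_int n" by (metis of_real_eq_iff of_real_of_int_eq)
    with x have "- 2 < n" "n < - 1" by auto
    then show False by linarith
  qed
  moreover have "?L (of_real x) = ?R (of_real x)"
    using Voronoi_strip[OF \<epsilon> y w, of "of_real x" m] x by simp
  ultimately show "of_real x \<in> ?S \<and> ?L (of_real x) = ?R (of_real x)" using x by simp
qed (use a in auto)

lemma eventually_at_not_Ints: "eventually (\<lambda>s. s \<notin> \<int>) (at (a :: complex))" if "a \<in> \<int>"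
  unfolding eventually_at
proof (intro exI[of _ 1] conjI ballI impI notI)
  fix x assume x: "x \<noteq> a \<and> dist x a < 1" "x \<in> \<int>"
  then have "x - a \<in> \<int>" using that by simp
  then obtain n where n: "x - a = of_int n" by (auto elim: Ints_cases)
  then have "norm (complex_of_int n) < 1" using x by (simp add: dist_norm)
  then have "n = 0" by simp
  with n x show False by simp
qed simp

theorem theorem2p6:
  fixes m :: nat and y a :: complex
  assumes "Re y > 0" and "Re a > - 2 * real m - 3"
  shows
    "summable (\<lambda>n. sigma_pow a (Suc n) * exp (- of_nat (Suc n) * y)) \<and>
     (a \<notin> \<int> \<longrightarrow>
        summable (\<lambda>n. sigma_pow a (Suc n) * of_nat (Suc n) powr (- a / 2) *
                        bessel_part m y (Suc n) a) \<and>
        (\<Sum>n. sigma_pow a (Suc n) * exp (- of_nat (Suc n) * y)) + zeta_part y a =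
          2 * of_real (sqrt (2 * pi)) / y powr (1 + a / 2) *
            (\<Sum>n. sigma_pow a (Suc n) * of_nat (Suc n) powr (- a / 2) * bessel_part m y (Suc n) a)
          - finite_part m y a) \<and>
     (a \<in> \<int> \<longrightarrow>
        \<comment> \<open>some factors have poles here, so the expressions are taken as limits in the parameter;
           at negative even integers only the sum of the two elementary parts has a limit\<close>
        (\<exists>L b. ((\<lambda>s. zeta_part y s + finite_part m y s) \<longlongrightarrow> L) (at a) \<and>
           (\<forall>n. (bessel_part m y (Suc n) \<longlongrightarrow> b n) (at a)) \<and>
           summable (\<lambda>n. sigma_pow a (Suc n) * of_nat (Suc n) powr (- a / 2) * b n) \<and>
           (\<Sum>n. sigma_pow a (Suc n) * exp (- of_nat (Suc n) * y)) + L =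
             2 * of_real (sqrt (2 * pi)) / y powr (1 + a / 2) *
               (\<Sum>n. sigma_pow a (Suc n) * of_nat (Suc n) powr (- a / 2) * b n)))"
proof -
  let ?pi = "complex_of_real pi"
  let ?S = "{a. - 2 * real m - 3 < Re a}"
  note y = assms(1)
  have a: "a \<in> ?S" using assms(2) by simp
  define w where "w = 2 * ?pi / y"
  define z where "z = 4 * ?pi\<^sup>2 / y"
  have "Re w > 0"
    using y by (auto simp: w_def Re_divide intro!: divide_pos_pos add_pos_nonneg mult_pos_pos)
  then obtain \<epsilon> where \<epsilon>: "\<epsilon> > 0" and w: "w \<in> wedge \<epsilon>" by (rule wedge_exists)
  have "of_real (2 * pi) * w \<in> wedge \<epsilon>" by (rule wedge_scale[OF w]) simp
  then have z: "z \<in> wedge \<epsilon>" by (simp add: w_def z_def power2_eq_square)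
  have zn: "of_nat (Suc n) * z \<in> wedge \<epsilon>" for n using wedge_scale[OF z, of "real (Suc n)"] by simp
  have zn0: "of_nat (Suc n) * z \<noteq> 0" for n
    using wedge_Re_pos[OF zn, of n] by (metis less_irrefl zero_complex.sel(1))
  define N where "N = (\<lambda>a. \<Sum>n. sigma_pow a (Suc n) * exp (- of_nat (Suc n) * y))"
  define J where "J = (\<lambda>n a. wedge_integral \<epsilon> (a + (4 + 2 * of_nat m)) (of_nat (Suc n) * z))"
  \<comment> \<open>The sine at parameter s = a + 2 (m + 2) equals (-1)^m sin(pi a / 2), and the
    representation by \<open>wedge_integral\<close> carries a minus sign; together they give the
    sign here.\<close>
  define c where "c = (-1) ^ Suc m * complex_of_real (sqrt (pi / 2))"
  \<comment> \<open>The Bessel part after cancelling the sine against its denominator. It is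
    holomorphic on the whole half-plane and so provides the limits at integers.\<close>
  define B where "B = (\<lambda>n a. c * (of_nat (Suc n) * z) powr (a / 2) * J n a)"
  define \<Phi> where "\<Phi> = (\<lambda>a. (-1) ^ Suc m * w powr (1 + a) * (\<Sum>n. sigma_pow a (Suc n) * J n a))"
  have bessel: "bessel_part m y (Suc n) s = B n s" if s: "s \<in> ?S" "s \<notin> \<int>" for n s
  proof -
    have e: "4 * ?pi\<^sup>2 * of_nat (Suc n) / y = of_nat (Suc n) * z" by (simp add: z_def)
    have q: "s + 2 * of_nat m + 4 = s + (4 + 2 * of_nat m)" "s + (4 + 2 * of_nat m) = s + 2 * of_nat (m + 2)" by simp_all
    have "Re (s + (4 + 2 * of_nat m)) > 0" using s by simp
    from even_remainder_eq_wedge_integral[OF \<epsilon> zn this]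
    have "even_remainder (s + (4 + 2 * of_nat m)) (of_nat (Suc n) * z) = - ((-1) ^ (m + 2) * sin (?pi * s / 2)) * J n s"
      unfolding J_def by (simp only: q(2) sin_half_shift)
    then show ?thesis
      unfolding bessel_part_eq[OF s(2) y zero_less_Suc, of m n] e q(1) B_def c_def
      using sin_half_neq_0[OF s(2)] by simp
  qed
  have summand: "sigma_pow s (Suc n) * of_nat (Suc n) powr (- s / 2) * B n s = c * z powr (s / 2) * (sigma_pow s (Suc n) * J n s)" for n s
  proof -
    have "(of_nat (Suc n) * z) powr (s / 2) = of_nat (Suc n) powr (s / 2) * z powr (s / 2)"
      by (intro powr_times_real_left) auto
    moreover have "of_nat (Suc n) powr (- s / 2) * of_nat (Suc n) powr (s / 2) = (1 :: complex)"
      by (simp flip: powr_add del: of_nat_Suc)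
    ultimately show ?thesis unfolding B_def by (simp add: mult_ac del: of_nat_Suc)
  qed
  have sJ: "summable (\<lambda>n. sigma_pow s (Suc n) * J n s)" if "s \<in> ?S" for s
    unfolding J_def using that by (intro summable_norm_cancel[OF sigma_wedge_series(2)[OF \<epsilon> z]]) auto
  have sB: "summable (\<lambda>n. sigma_pow s (Suc n) * of_nat (Suc n) powr (- s / 2) * B n s)" if "s \<in> ?S" for s
    unfolding summand by (intro summable_mult sJ that)
  \<comment> \<open>All powers split on the principal branch because Re y > 0 and the other factors
    are positive; the square roots combine to sqrt(2 pi) sqrt(pi / 2) = pi.\<close>
  have prefactor: "2 * of_real (sqrt (2 * pi)) / y powr (1 + s / 2) * (c * z powr (s / 2)) = (-1) ^ Suc m * w powr (1 + s)" for s
  proof -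
    have r1: "z powr (s / 2) = of_real (2 * pi) powr s * y powr (- (s / 2))"
    proof -
      have "(of_real (2 * pi * (2 * pi)) * (1 / y)) powr (s / 2) = of_real (2 * pi * (2 * pi)) powr (s / 2) * (1 / y) powr (s / 2)"
        by (intro powr_times_real_left) auto
      moreover have "complex_of_real (2 * pi * (2 * pi)) powr (s / 2) = of_real (2 * pi) powr s"
        by (subst cpow_mult) (simp_all flip: powr_add)
      moreover have "of_real (2 * pi * (2 * pi)) * (1 / y) = z" by (simp add: z_def power2_eq_square)
      ultimately show ?thesis by (simp only: inverse_powr_right_half[OF y])
    qed
    have r2: "w powr (1 + s) = of_real (2 * pi) powr (1 + s) * y powr (- (1 + s))"
    proof -
      have "(of_real (2 * pi) * (1 / y)) powr (1 + s) = of_real (2 * pi) powr (1 + s) * (1 / y) powr (1 + s)"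
        by (intro powr_times_real_left) auto
      moreover have "of_real (2 * pi) * (1 / y) = w" by (simp add: w_def)
      ultimately show ?thesis by (simp only: inverse_powr_right_half[OF y])
    qed
    have r3: "complex_of_real (sqrt (2 * pi)) * of_real (sqrt (pi / 2)) = ?pi"
    proof -
      have "sqrt (2 * pi) * sqrt (pi / 2) = sqrt (pi * pi)" by (simp flip: real_sqrt_mult)
      then have "sqrt (2 * pi) * sqrt (pi / 2) = pi" by simp
      then show ?thesis by (metis of_real_mult)
    qed
    have r4: "y powr (- (s / 2)) / y powr (1 + s / 2) = y powr (- (1 + s))"
    proof -
      have "- (s / 2) - (1 + s / 2) = - (1 + s)" by simp
      then show ?thesis by (simp only: flip: powr_diff)
    qed
    have r5: "complex_of_real (2 * pi) powr (1 + s) = 2 * ?pi * of_real (2 * pi) powr s"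
      by (simp add: powr_add)
    have "2 * of_real (sqrt (2 * pi)) / y powr (1 + s / 2) * (c * z powr (s / 2)) =
        (-1) ^ Suc m * (2 * (of_real (sqrt (2 * pi)) * of_real (sqrt (pi / 2))) * of_real (2 * pi) powr s * (y powr (- (s / 2)) / y powr (1 + s / 2)))"
      unfolding r1 c_def by simp
    then show ?thesis unfolding r2 r3 r4 r5 by (simp only: mult.assoc)
  qed
  have total: "2 * of_real (sqrt (2 * pi)) / y powr (1 + s / 2) * (\<Sum>n. sigma_pow s (Suc n) * of_nat (Suc n) powr (- s / 2) * B n s) = \<Phi> s"
    if s: "s \<in> ?S" for s
    unfolding summand suminf_mult[OF sJ[OF s]] \<Phi>_def prefactor[symmetric] by (simp only: mult.assoc)
  have main: "N s + (zeta_part y s + finite_part m y s) = \<Phi> s" if "s \<in> ?S" "s \<notin> \<int>" for s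
    using Voronoi_continued[OF \<epsilon> y, of m s] w that unfolding N_def \<Phi>_def J_def w_def z_def by (simp add: add.assoc)
  have "open ?S" by (rule open_Re_gt)
  have cont: "isCont (\<lambda>s. \<Phi> s - N s) a" "isCont (B n) a" for n
  proof -
    have "(\<lambda>s. \<Sum>n. sigma_pow s (Suc n) * J n s) holomorphic_on ?S"
      unfolding J_def by (rule sigma_wedge_series(1)[OF \<epsilon> z])
    moreover have "N holomorphic_on ?S"
      unfolding N_def by (rule holomorphic_on_subset[OF sigma_exp_series(2)[OF y]]) simp
    moreover have "w \<noteq> 0" using wedge_Re_pos[OF w] by auto
    ultimately have "(\<lambda>s. \<Phi> s - N s) holomorphic_on ?S"
      unfolding \<Phi>_def by (intro holomorphic_intros) auto
    then show "isCont (\<lambda>s. \<Phi> s - N s) a"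
      using holomorphic_on_imp_continuous_on continuous_on_eq_continuous_at[OF \<open>open ?S\<close>] a by blast
    have "(\<lambda>s. wedge_integral \<epsilon> (s + (4 + 2 * of_nat m)) (of_nat (Suc n) * z)) holomorphic_on ?S"
      by (rule holomorphic_on_compose_gen[OF _ holomorphic_wedge_integral[OF \<epsilon> zn], of "\<lambda>s. s + (4 + 2 * of_nat m)", unfolded o_def])
         (auto intro!: holomorphic_intros)
    then have "B n holomorphic_on ?S"
      unfolding B_def J_def using zn0 by (intro holomorphic_intros) auto
    then show "isCont (B n) a"
      using holomorphic_on_imp_continuous_on continuous_on_eq_continuous_at[OF \<open>open ?S\<close>] a by blast
  qed
  show ?thesis
  proof (intro conjI impI)
    show "summable (\<lambda>n. sigma_pow a (Suc n) * exp (- of_nat (Suc n) * y))" by (rule sigma_exp_series(1)[OF y])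
  next
    assume aI: "a \<notin> \<int>"
    show "summable (\<lambda>n. sigma_pow a (Suc n) * of_nat (Suc n) powr (- a / 2) * bessel_part m y (Suc n) a)"
      unfolding bessel[OF a aI] by (rule sB[OF a])
  next
    assume aI: "a \<notin> \<int>"
    show "(\<Sum>n. sigma_pow a (Suc n) * exp (- of_nat (Suc n) * y)) + zeta_part y a =
          2 * of_real (sqrt (2 * pi)) / y powr (1 + a / 2) *
            (\<Sum>n. sigma_pow a (Suc n) * of_nat (Suc n) powr (- a / 2) * bessel_part m y (Suc n) a)
          - finite_part m y a"
      unfolding bessel[OF a aI] total[OF a] main[OF a aI, symmetric] N_def by simp
  next
    assume aI: "a \<in> \<int>"
    have ev: "eventually (\<lambda>s. s \<in> ?S \<and> s \<notin> \<int>) (at a)"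
      using eventually_at_not_Ints[OF aI] eventually_at_in_open'[OF \<open>open ?S\<close> a]
      by (rule eventually_elim2) simp
    \<comment> \<open>Near a, off the integers, the two elementary parts together equal the
      continuous function \<open>\<Phi>\<close> minus \<open>N\<close>, so their sum has a limit
      even where each of them has a pole.\<close>
    have "((\<lambda>s. zeta_part y s + finite_part m y s) \<longlongrightarrow> \<Phi> a - N a) (at a)"
    proof (rule Lim_transform_eventually)
      show "((\<lambda>s. \<Phi> s - N s) \<longlongrightarrow> \<Phi> a - N a) (at a)" using cont(1) by (simp add: isCont_def)
      show "eventually (\<lambda>s. \<Phi> s - N s = zeta_part y s + finite_part m y s) (at a)"
      proof (rule eventually_mono[OF ev])
        fix s assume "s \<in> ?S \<and> s \<notin> \<int>"
        then have "N s + (zeta_part y s + finite_part m y s) = \<Phi> s" using main by blast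
        then show "\<Phi> s - N s = zeta_part y s + finite_part m y s" by (simp add: algebra_simps)
      qed
    qed
    moreover have "(bessel_part m y (Suc n) \<longlongrightarrow> B n a) (at a)" for n
    proof (rule Lim_transform_eventually)
      show "(B n \<longlongrightarrow> B n a) (at a)" using cont(2)[of n] by (simp add: isCont_def)
      show "eventually (\<lambda>s. B n s = bessel_part m y (Suc n) s) (at a)"
        using ev by (rule eventually_mono) (use bessel in force)
    qed
    ultimately show "\<exists>L b. ((\<lambda>s. zeta_part y s + finite_part m y s) \<longlongrightarrow> L) (at a) \<and>
           (\<forall>n. (bessel_part m y (Suc n) \<longlongrightarrow> b n) (at a)) \<and>
           summable (\<lambda>n. sigma_pow a (Suc n) * of_nat (Suc n) powr (- a / 2) * b n) \<and>
           (\<Sum>n. sigma_pow a (Suc n) * exp (- of_nat (Suc n) * y)) + L =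
             2 * of_real (sqrt (2 * pi)) / y powr (1 + a / 2) *
               (\<Sum>n. sigma_pow a (Suc n) * of_nat (Suc n) powr (- a / 2) * b n)"
      using sB[OF a] total[OF a] by (intro exI[of _ "\<Phi> a - N a"] exI[of _ "\<lambda>n. B n a"]) (simp add: N_def)
  qed
qed

end
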